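(* Let $k=\mathbb C$ and let $\mathcal C\to S=\mathrm{Spec}(R_o[[\tau]])$ be the smoothing of the nodal family $\mathcal C_o/S_o$ described in the context. The monodromy (around $\tau=0$) of the WZW connection acting on $\mathcal H_\ell(\mathbb V)_{\mathcal C/S}$ has finite order and acts in the summand $\mathcal H_\ell(\tilde{\mathbb V}_{\mu,\mu^*})_{\tilde{\mathcal C}_o/S_o}[[\tau]]$ (of the decomposition $\mathcal H_\ell(\mathbb V)_{\mathcal C/S}\cong\bigoplus_{\mu\in P_\ell}\mathcal H_\ell(\tilde{\mathbb V}_{\mu,\mu^*})_{\tilde{\mathcal C}_o/S_o}[[\tau]]$ given by tensoring with the glueing tensors) as multiplication by the root of unity $\exp\big(-\pi\sqrt{-1}\,\frac{c_\mu}{\ell+\check h}\big)$.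
   Context: $\ell\ge0$ is an integer; $M_{\mathfrak a}=M/\mathfrak aM$. Lie algebra data. $\mathfrak g$ is a finite dimensional simple complex Lie algebra, $\check c$ its invariant form whose dual form takes the value $2$ on long roots, $(X_\kappa)$ a $\check c$-orthonormal basis, $\check h$ given by $\sum_\kappa[X_\kappa,[X_\kappa,Y]]=2\check hY$. The level of an irreducible representation is the smallest $m$ with $X^{m+1}=0$ on it, $X$ a generator of the highest root space. $P_\ell$ is the set of classes of irreducible representations of level $\le\ell$; $V_\mu$ is in the class $\mu$; $\mu^*$ is the dual class; $b_\mu:V_\mu\otimes V_{\mu^*}\to\mathbb C$ are $\mathfrak g$-equivariant dualities. $c_\mu$ is the scalar by which $\sum_\kappa X_\kappa X_\kappa$ acts in $V_\mu$. Nodal family. $S_o=\mathrm{Spec}(R_o)$, $R_o$ a regular local $\mathbb C$-algebra; $\mathcal C_o\to S_o$ is a proper flat family of connected curves with an ordinary double point along a section $x_0$ and smooth elsewhere; $\nu:\tilde{\mathcal C}_o\to\mathcal C_o$ is the partial normalization, an isomorphism off $x_0(S_o)$, such that $x_0$ has two disjoint lifts $x_\pm$. $\Sigma_o$ is a finite union of disjoint sections in the smooth part with $\mathcal C_o-\Sigma_o$ affine; $\mathbb V_o$ assigns to each section in $\Sigma_o$ an irreducible representation of level $\le\ell$. $\tilde{\mathbb V}_{\mu,\mu^*}$ is $\mathbb V_o$ on $\Sigma_o$, $V_\mu$ on $x_+$, $V_{\mu^*}$ on $x_-$. $B_o$ is the algebra of regular functions on $\tilde{\mathcal C}_o-\Sigma_o-x_\pm(S_o)$.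 Parameters $t_i$ along the sections in $\Sigma_o$ and $t_\pm$ along $x_\pm$ are fixed. Smoothing. In $\tilde{\mathcal C}_o\times\mathrm{Spec}\,\mathbb C[[\tau]]$ blow up $x_\pm\times\{0\}$, take the formal neighborhood of the strict transform of $\tilde{\mathcal C}_o\times\{0\}$ with formal charts $(t_\pm,\tau/t_\pm)$, and identify these by $(t_+,\tau/t_+)=(\tau/t_-,t_-)$. This gives (after algebraization) $\mathcal C\to S$, $R=R_o[[\tau]]$. $\Sigma$ is the extension of $\Sigma_o$, $\mathbb V$ that of $\mathbb V_o$, and $A$ is the algebra of regular functions on $\mathcal C-\Sigma$, contained in $B_o[[\tau]]$. Modules. Over a base ring $R'$ and for disjoint sections $x$ with parameters $t_x$: $L_x=R'((t_x))$, $L=\oplus L_x$, $\widehat{L\mathfrak g}=(\mathfrak g\otimes L)\oplus R'c$ with $c$ central and $[Xf,Yg]=[X,Y]fg+\check c(X,Y)\sum_x\mathrm{Res}_x(g\,df)c$. For $V$ of level $m\le\ell$ with highest weight vector $v$, $\mathbb H_\ell(V)$ is the quotient of the module induced from $R'\otimes V$ ($\mathfrak g\otimes R'[[t_x]]$ acts via $t_x=0$, $c$ as $\ell$) by the submodule generated by $(Xt_x^{-1})^{1+\ell-m}v$; for several sections take tensor products. $\mathcal H_\ell(\mathbb V)_{\mathcal C/S}=\mathbb H_\ell(\mathbb V)_{A\mathfrak g}$ (base $R$, sections $\Sigma$) and $\mathcal H_\ell(\tilde{\mathbb V}_{\mu,\mu^*})_{\tilde{\mathcal C}_o/S_o}=\mathbb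 H_\ell(\tilde{\mathbb V}_{\mu,\mu^*})_{B_o\mathfrak g}$ (base $R_o$, sections $\Sigma_o,x_\pm$). The decomposition is induced by $U\mapsto(U\otimes\sum_d\varepsilon_d^\mu\tau^d)_\mu$, where $\varepsilon^\mu_d$ is the transpose inverse, in degree $-d$ for the grading by exponents of $t_\pm$, of the unique extension of $b_\mu$ to a pairing of $\mathbb H_\ell(V_\mu)$ at $x_+$ with $\mathbb H_\ell(V_{\mu^*})$ at $x_-$ satisfying $b_\mu(Xt_+^nu,u')+b_\mu(u,Xt_-^{-n}u')=0$. WZW connection. For a derivation $D$ of $A$ preserving $R$ with $D|_R=\tau\frac d{d\tau}$, write $D=D_{hor}+D_{ver}$ on $L$ ($D_{hor}$ kills the $t_i$ and agrees with $D$ on $R$; $D_{ver}$ is $R$-linear). The operator $D_{hor}-\frac1{\ell+\check h}\hat C_{\mathfrak g}(D_{ver})$, with $\hat C_{\mathfrak g}(t_i^{n+1}\frac d{dt_i})=\frac12\sum_\kappa\sum_{a+b=n}:X_\kappa t_i^a\circ X_\kappa t_i^b:$ (normally ordered: highest exponent acts first) and $D_{hor}$ acting coefficientwise, induces an operator on $\mathbb H_\ell(\mathbb V)_{A\mathfrak g}$; a covariant derivative along $\tau\frac d{d\tau}$ is this operator plus a scalar in $R$. The connection considered is the one for which the scalar (independent of $\mu$) is normalized so that the covariant derivative along $\tau\frac d{d\tau}$ acts in the $\mu$-summand as $\tau\frac{d}{d\tau}+\frac{c_\mu}{2(\ell+\check h)}$. Its monodromy is the transformation of the multivalued flat sections in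 the $\tau$-direction when $\tau$ runs once counterclockwise around the unit circle, with the convention that the monodromy of $\tau^\alpha$ is $\exp(2\pi\sqrt{-1}\,\alpha)$. *)

theory Defs
  imports
    "HOL-Analysis.Abstract_Topology"
    "HOL-Algebra.Ideal_Product"
    "HOL-Algebra.Generated_Rings"
    "HOL-Algebra.Algebraic_Closure_Type"
    "HOL-Library.Poly_Mapping"
    "HOL-Computational_Algebra.Formal_Laurent_Series"
    "Jordan_Normal_Form.Matrix"
begin

no_notation var (\<open>X\<index>\<close>)

hide_const (open) Poly_Mapping.degree Poly_Mapping.range Poly_Mapping.map

section \<open>Schemes\<close>

record ('p, 's) rspace =
  sp_top :: "'p topology"
  sp_ring :: "'p set \<Rightarrow> 's ring"
  sp_res :: "'p set \<Rightarrow> 'p set \<Rightarrow> 's \<Rightarrow> 's"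

abbreviation pts :: "('p, 's) rspace \<Rightarrow> 'p set" where
  "pts X \<equiv> topspace (sp_top X)"

abbreviation sects :: "('p, 's) rspace \<Rightarrow> 'p set \<Rightarrow> 's set" where
  "sects X U \<equiv> carrier (sp_ring X U)"

definition ringed_space :: "('p, 's) rspace \<Rightarrow> bool" where
  "ringed_space X \<longleftrightarrow>
     (\<forall>U. openin (sp_top X) U \<longrightarrow> cring (sp_ring X U)) \<and>
     (\<forall>U V. openin (sp_top X) U \<longrightarrow> openin (sp_top X) V \<longrightarrow> V \<subseteq> U \<longrightarrow>
        sp_res X U V \<in> Ring.ring_hom (sp_ring X U) (sp_ring X V)) \<and>
     (\<forall>U. openin (sp_top X) U \<longrightarrow> (\<forall>f\<in>sects X U. sp_res X U U f = f)) \<and>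
     (\<forall>U V W. openin (sp_top X) U \<longrightarrow> openin (sp_top X) V \<longrightarrow> openin (sp_top X) W \<longrightarrow>
        W \<subseteq> V \<longrightarrow> V \<subseteq> U \<longrightarrow>
        (\<forall>f\<in>sects X U. sp_res X V W (sp_res X U V f) = sp_res X U W f)) \<and>
     (\<forall>\<U> \<phi>. (\<forall>U\<in>\<U>. openin (sp_top X) U \<and> \<phi> U \<in> sects X U) \<longrightarrow>
        (\<forall>U\<in>\<U>. \<forall>V\<in>\<U>. sp_res X U (U \<inter> V) (\<phi> U) = sp_res X V (U \<inter> V) (\<phi> V)) \<longrightarrow>
        (\<exists>!f. f \<in> sects X (\<Union>\<U>) \<and> (\<forall>U\<in>\<U>. sp_res X (\<Union>\<U>) U f = \<phi> U)))"

text \<open>The germ of \<open>f\<close> at \<open>x\<close> is a unit of the stalk.\<close>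

definition inv_at :: "('p, 's) rspace \<Rightarrow> 'p set \<Rightarrow> 's \<Rightarrow> 'p \<Rightarrow> bool" where
  "inv_at X U f x \<longleftrightarrow>
     (\<exists>V. openin (sp_top X) V \<and> x \<in> V \<and> V \<subseteq> U \<and> sp_res X U V f \<in> Units (sp_ring X V))"

text \<open>An open set is affine if the canonical map to the spectrum of its ring of sections is a
  homeomorphism (a bijection onto the prime ideals such that the sets \<open>D f\<close> form a basis of the
  topology) that identifies the structure sheaf on each \<open>D f\<close> with the localization at \<open>f\<close>.\<close>

definition affine_open :: "('p, 's) rspace \<Rightarrow> 'p set \<Rightarrow> bool" where
  "affine_open X U \<longleftrightarrow> openin (sp_top X) U \<and>
     (let A = sp_ring X U; D = (\<lambda>f. {x \<in> U. inv_at X U f x}) in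
       bij_betw (\<lambda>x. {f \<in> carrier A. \<not> inv_at X U f x}) U {P. primeideal P A} \<and>
       (\<forall>V. openin (sp_top X) V \<longrightarrow> V \<subseteq> U \<longrightarrow> (\<forall>x\<in>V. \<exists>f\<in>carrier A. x \<in> D f \<and> D f \<subseteq> V)) \<and>
       (\<forall>f\<in>carrier A.
          (\<forall>g\<in>sects X (D f). \<exists>n::nat. \<exists>a\<in>carrier A.
             g \<otimes>\<^bsub>sp_ring X (D f)\<^esub> sp_res X U (D f) (f [^]\<^bsub>A\<^esub> n) = sp_res X U (D f) a) \<and>
          (\<forall>a\<in>carrier A. sp_res X U (D f) a = \<zero>\<^bsub>sp_ring X (D f)\<^esub> \<longrightarrow>
             (\<exists>n::nat. f [^]\<^bsub>A\<^esub> n \<otimes>\<^bsub>A\<^esub> a = \<zero>\<^bsub>A\<^esub>))))"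

definition scheme :: "('p, 's) rspace \<Rightarrow> bool" where
  "scheme X \<longleftrightarrow> ringed_space X \<and> (\<forall>x\<in>pts X. \<exists>U. affine_open X U \<and> x \<in> U)"

record ('p, 's, 'q, 't) morph =
  mpt :: "'p \<Rightarrow> 'q"
  mpb :: "'q set \<Rightarrow> 't \<Rightarrow> 's"

definition mpre :: "('p, 's) rspace \<Rightarrow> ('p, 's, 'q, 't) morph \<Rightarrow> 'q set \<Rightarrow> 'p set" where
  "mpre X f V = {x \<in> pts X. mpt f x \<in> V}"

definition morphism ::
    "('p, 's) rspace \<Rightarrow> ('q, 't) rspace \<Rightarrow> ('p, 's, 'q, 't) morph \<Rightarrow> bool" where
  "morphism X Y f \<longleftrightarrow> continuous_map (sp_top X) (sp_top Y) (mpt f) \<and>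
     (\<forall>V. openin (sp_top Y) V \<longrightarrow>
        mpb f V \<in> Ring.ring_hom (sp_ring Y V) (sp_ring X (mpre X f V)) \<and>
        (\<forall>W g. openin (sp_top Y) W \<longrightarrow> W \<subseteq> V \<longrightarrow> g \<in> sects Y V \<longrightarrow>
           mpb f W (sp_res Y V W g) = sp_res X (mpre X f V) (mpre X f W) (mpb f V g)) \<and>
        (\<forall>g\<in>sects Y V. \<forall>x\<in>mpre X f V.
           inv_at X (mpre X f V) (mpb f V g) x \<longleftrightarrow> inv_at Y V g (mpt f x)))"

definition mcomp ::
    "('q, 't) rspace \<Rightarrow> ('q, 't, 'u, 'v) morph \<Rightarrow> ('p, 's, 'q, 't) morph \<Rightarrow>
     ('p, 's, 'u, 'v) morph" where
  "mcomp Y g f = \<lparr>mpt = mpt g \<circ> mpt f, mpb = (\<lambda>V. mpb f (mpre Y g V) \<circ> mpb g V)\<rparr>"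

definition mor_eq ::
    "('p, 's) rspace \<Rightarrow> ('q, 't) rspace \<Rightarrow> ('p, 's, 'q, 't) morph \<Rightarrow> ('p, 's, 'q, 't) morph \<Rightarrow> bool"
  where
  "mor_eq X Y f g \<longleftrightarrow> (\<forall>x\<in>pts X. mpt f x = mpt g x) \<and>
     (\<forall>V. openin (sp_top Y) V \<longrightarrow> (\<forall>t\<in>sects Y V. mpb f V t = mpb g V t))"

abbreviation mident :: "('p, 's, 'p, 's) morph" where
  "mident \<equiv> \<lparr>mpt = id, mpb = (\<lambda>_. id)\<rparr>"


section \<open>Schemes over an affine base\<close>

text \<open>A scheme over a model \<open>fbase\<close> of \<open>Spec R\<close>, where \<open>R\<close> is the ring on the whole type \<open>'r\<close>;
  \<open>fcoord\<close> identifies \<open>R\<close> with the global functions on the base.\<close>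

record ('p, 's, 'a, 'b, 'r) fam =
  ftot :: "('p, 's) rspace"
  fbase :: "('a, 'b) rspace"
  fproj :: "('p, 's, 'a, 'b) morph"
  fcoord :: "'r \<Rightarrow> 'b"

definition spec_fam :: "('p, 's, 'a, 'b, 'r::comm_ring_1) fam \<Rightarrow> bool" where
  "spec_fam F \<longleftrightarrow> scheme (ftot F) \<and> scheme (fbase F) \<and>
     affine_open (fbase F) (pts (fbase F)) \<and>
     fcoord F \<in> ring_iso ring_of_type_algebra (sp_ring (fbase F) (pts (fbase F))) \<and>
     morphism (ftot F) (fbase F) (fproj F)"

text \<open>The structure map from \<open>R\<close> to the functions on \<open>U\<close>.\<close>

definition fscal :: "('p, 's, 'a, 'b, 'r::comm_ring_1) fam \<Rightarrow> 'p set \<Rightarrow> 'r \<Rightarrow> 's" where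
  "fscal F U r =
     sp_res (ftot F) (pts (ftot F)) U (mpb (fproj F) (pts (fbase F)) (fcoord F r))"

definition finite_type :: "('p, 's, 'a, 'b, 'r::comm_ring_1) fam \<Rightarrow> bool" where
  "finite_type F \<longleftrightarrow>
     (\<exists>\<U>. finite \<U> \<and> \<Union>\<U> = pts (ftot F) \<and>
        (\<forall>U\<in>\<U>. affine_open (ftot F) U \<and>
           (\<exists>G. finite G \<and> G \<subseteq> sects (ftot F) U \<and>
              generate_ring (sp_ring (ftot F) U) (fscal F U ` UNIV \<union> G) = sects (ftot F) U)))"

text \<open>Flatness, by the equational criterion.\<close>

definition flat :: "('p, 's, 'a, 'b, 'r::comm_ring_1) fam \<Rightarrow> bool" where
  "flat F \<longleftrightarrow> (\<forall>U. affine_open (ftot F) U \<longrightarrow>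
     (let A = sp_ring (ftot F) U in
       \<forall>n (r :: nat \<Rightarrow> 'r) m. (\<forall>i<n. m i \<in> carrier A) \<longrightarrow>
         (\<Oplus>\<^bsub>A\<^esub>i\<in>{..<n}. fscal F U (r i) \<otimes>\<^bsub>A\<^esub> m i) = \<zero>\<^bsub>A\<^esub> \<longrightarrow>
         (\<exists>k s y. (\<forall>j<k. y j \<in> carrier A) \<and>
            (\<forall>i<n. m i = (\<Oplus>\<^bsub>A\<^esub>j\<in>{..<k::nat}. fscal F U (s i j) \<otimes>\<^bsub>A\<^esub> y j)) \<and>
            (\<forall>j<k. (\<Sum>i<n. r i * s i j) = 0))))"

text \<open>Properness is expressed by the valuative criterion, which may be tested on the valuation
  rings of the residue fields. Elements of the residue field of \<open>x\<close> are represented by pairs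
  \<open>(U, f)\<close> with \<open>f\<close> a function on the neighbourhood \<open>U\<close> of \<open>x\<close>. A lift of the spectrum of the
  valuation ring is a specialization \<open>y\<close> of \<open>x\<close> whose local ring is dominated by it.\<close>

definition germs :: "('p, 's) rspace \<Rightarrow> 'p \<Rightarrow> ('p set \<times> 's) set" where
  "germs X x = {(U, f). openin (sp_top X) U \<and> x \<in> U \<and> f \<in> sects X U}"

definition same_value ::
    "('p, 's) rspace \<Rightarrow> 'p \<Rightarrow> 'p set \<times> 's \<Rightarrow> 'p set \<times> 's \<Rightarrow> bool" where
  "same_value X x p q \<longleftrightarrow> (let W = fst p \<inter> fst q in
     \<not> inv_at X W (sp_res X (fst p) W (snd p) \<ominus>\<^bsub>sp_ring X W\<^esub> sp_res X (fst q) W (snd q)) x)"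

definition valuation_ring ::
    "('p, 's, 'a, 'b, 'r::comm_ring_1) fam \<Rightarrow> 'p \<Rightarrow> ('p set \<times> 's) set \<Rightarrow> bool" where
  "valuation_ring F x \<V> \<longleftrightarrow> (let X = ftot F in
     \<V> \<subseteq> germs X x \<and>
     (\<forall>p\<in>\<V>. \<forall>q\<in>germs X x. same_value X x p q \<longrightarrow> q \<in> \<V>) \<and>
     (\<forall>U. openin (sp_top X) U \<longrightarrow> x \<in> U \<longrightarrow>
        subring {f. (U, f) \<in> \<V>} (sp_ring X U) \<and>
        (\<forall>r. (U, fscal F U r) \<in> \<V>) \<and>
        (\<forall>f\<in>sects X U. \<forall>g\<in>sects X U. f \<otimes>\<^bsub>sp_ring X U\<^esub> g = \<one>\<^bsub>sp_ring X U\<^esub> \<longrightarrow>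
           (U, f) \<in> \<V> \<or> (U, g) \<in> \<V>)))"

definition center_of ::
    "('p, 's) rspace \<Rightarrow> 'p \<Rightarrow> ('p set \<times> 's) set \<Rightarrow> 'p \<Rightarrow> bool" where
  "center_of X x \<V> y \<longleftrightarrow> y \<in> pts X \<and>
     (\<forall>U. openin (sp_top X) U \<longrightarrow> y \<in> U \<longrightarrow> x \<in> U \<and>
        (\<forall>f\<in>sects X U. (U, f) \<in> \<V> \<and>
           (inv_at X U f y \<longleftrightarrow>
             (\<exists>W g. (W, g) \<in> \<V> \<and> W \<subseteq> U \<and>
                same_value X x (W, sp_res X U W f \<otimes>\<^bsub>sp_ring X W\<^esub> g) (W, \<one>\<^bsub>sp_ring X W\<^esub>)))))"

definition proper :: "('p, 's, 'a, 'b, 'r::comm_ring_1) fam \<Rightarrow> bool" where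
  "proper F \<longleftrightarrow> finite_type F \<and>
     (\<forall>x\<in>pts (ftot F). \<forall>\<V>. valuation_ring F x \<V> \<longrightarrow> (\<exists>!y. center_of (ftot F) x \<V> y))"

text \<open>Values at \<open>(a, b)\<close> of a polynomial in two variables and of its derivative with respect to
  the outer variable.\<close>

definition ev1 :: "'s ring \<Rightarrow> ('r::comm_ring_1 \<Rightarrow> 's) \<Rightarrow> 's \<Rightarrow> 'r poly \<Rightarrow> 's" where
  "ev1 A \<alpha> a P = (\<Oplus>\<^bsub>A\<^esub>i\<in>{..Polynomial.degree P}. \<alpha> (Polynomial.coeff P i) \<otimes>\<^bsub>A\<^esub> a [^]\<^bsub>A\<^esub> i)"

definition ev2 :: "'s ring \<Rightarrow> ('r::comm_ring_1 \<Rightarrow> 's) \<Rightarrow> 's \<Rightarrow> 's \<Rightarrow> 'r poly poly \<Rightarrow> 's" where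
  "ev2 A \<alpha> a b P =
     (\<Oplus>\<^bsub>A\<^esub>i\<in>{..Polynomial.degree P}. ev1 A \<alpha> a (Polynomial.coeff P i) \<otimes>\<^bsub>A\<^esub> b [^]\<^bsub>A\<^esub> i)"

definition ev2_deriv ::
    "'s ring \<Rightarrow> ('r::comm_ring_1 \<Rightarrow> 's) \<Rightarrow> 's \<Rightarrow> 's \<Rightarrow> 'r poly poly \<Rightarrow> 's" where
  "ev2_deriv A \<alpha> a b P =
     (\<Oplus>\<^bsub>A\<^esub>i\<in>{..Polynomial.degree P}.
        \<alpha> (of_nat i) \<otimes>\<^bsub>A\<^esub> ev1 A \<alpha> a (Polynomial.coeff P i) \<otimes>\<^bsub>A\<^esub> b [^]\<^bsub>A\<^esub> (i - 1))"

text \<open>Smooth of relative dimension one at \<open>p\<close>: near \<open>p\<close> the family is an open part of a plane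
  curve \<open>P = 0\<close> on which a partial derivative of \<open>P\<close> is invertible, that is, it is standard
  etale over an open part of the affine line.\<close>

definition smooth1_at :: "('p, 's, 'a, 'b, 'r::comm_ring_1) fam \<Rightarrow> 'p \<Rightarrow> bool" where
  "smooth1_at F p \<longleftrightarrow> (\<exists>U. affine_open (ftot F) U \<and> p \<in> U \<and>
     (let A = sp_ring (ftot F) U; \<alpha> = fscal F U in
       \<exists>a\<in>carrier A. \<exists>b\<in>carrier A. \<exists>P Q.
         ev2 A \<alpha> a b P = \<zero>\<^bsub>A\<^esub> \<and> ev2_deriv A \<alpha> a b P \<in> Units A \<and> ev2 A \<alpha> a b Q \<in> Units A \<and>
         (\<forall>f\<in>carrier A. \<exists>(n::nat) K. f \<otimes>\<^bsub>A\<^esub> ev2 A \<alpha> a b Q [^]\<^bsub>A\<^esub> n = ev2 A \<alpha> a b K) \<and>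
         (\<forall>K. ev2 A \<alpha> a b K = \<zero>\<^bsub>A\<^esub> \<longrightarrow> (\<exists>n. P dvd Q ^ n * K))))"

definition is_section ::
    "('p, 's, 'a, 'b, 'r) fam \<Rightarrow> ('a, 'b, 'p, 's) morph \<Rightarrow> bool" where
  "is_section F x \<longleftrightarrow> morphism (fbase F) (ftot F) x \<and>
     mor_eq (fbase F) (fbase F) (mcomp (ftot F) (fproj F) x) mident"

definition im :: "('p, 's, 'a, 'b, 'r) fam \<Rightarrow> ('a, 'b, 'q, 't) morph \<Rightarrow> 'q set" where
  "im F x = mpt x ` pts (fbase F)"

text \<open>The restriction to a section \<open>x\<close> of a function on a neighbourhood \<open>U\<close> of its image, as an
  element of \<open>R\<close>.\<close>

definition sval ::
    "('p, 's, 'a, 'b, 'r) fam \<Rightarrow> ('a, 'b, 'p, 's) morph \<Rightarrow> 'p set \<Rightarrow> 's \<Rightarrow> 'r" where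
  "sval F x U f = the_inv_into UNIV (fcoord F) (mpb x U f)"

definition sec_ideal ::
    "('p, 's, 'a, 'b, 'r::comm_ring_1) fam \<Rightarrow> ('a, 'b, 'p, 's) morph \<Rightarrow> 'p set \<Rightarrow> 's set" where
  "sec_ideal F x U = {f \<in> sects (ftot F) U. sval F x U f = 0}"

definition ideal_pow :: "'s ring \<Rightarrow> 's set \<Rightarrow> nat \<Rightarrow> 's set" where
  "ideal_pow A I n = ((\<lambda>J. ideal_prod A I J) ^^ n) (carrier A)"

text \<open>The completion along the section \<open>x\<close> is \<open>R[[u, v]] / (uv)\<close>. Here \<open>u n\<close> and \<open>v n\<close> represent
  \<open>u\<close> and \<open>v\<close> modulo the \<open>n\<close>-th power of the ideal \<open>I\<close> of the section; the last condition says that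
  \<open>1, u, ..., u^(n-1), v, ..., v^(n-1)\<close> is an \<open>R\<close>-basis modulo that power.\<close>

definition ordinary_double_point ::
    "('p, 's, 'a, 'b, 'r::comm_ring_1) fam \<Rightarrow> ('a, 'b, 'p, 's) morph \<Rightarrow> bool" where
  "ordinary_double_point F x \<longleftrightarrow>
     (\<exists>U. affine_open (ftot F) U \<and> im F x \<subseteq> U) \<and>
     (\<forall>U. affine_open (ftot F) U \<longrightarrow> im F x \<subseteq> U \<longrightarrow>
     (let A = sp_ring (ftot F) U; I = sec_ideal F x U in
       \<exists>u v. \<forall>n. u n \<in> I \<and> v n \<in> I \<and>
         u (Suc n) \<ominus>\<^bsub>A\<^esub> u n \<in> ideal_pow A I n \<and> v (Suc n) \<ominus>\<^bsub>A\<^esub> v n \<in> ideal_pow A I n \<and>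
         u n \<otimes>\<^bsub>A\<^esub> v n \<in> ideal_pow A I n \<and>
         (\<forall>f\<in>carrier A. \<exists>!(a, b). (\<forall>i\<ge>n. a i = 0 \<and> b i = 0) \<and> b 0 = 0 \<and>
            f \<ominus>\<^bsub>A\<^esub> ((\<Oplus>\<^bsub>A\<^esub>i\<in>{..<n}. fscal F U (a i) \<otimes>\<^bsub>A\<^esub> u n [^]\<^bsub>A\<^esub> i) \<oplus>\<^bsub>A\<^esub>
                   (\<Oplus>\<^bsub>A\<^esub>i\<in>{..<n}. fscal F U (b i) \<otimes>\<^bsub>A\<^esub> v n [^]\<^bsub>A\<^esub> i)) \<in> ideal_pow A I n)))"

text \<open>A formal parameter \<open>t\<close> along a section \<open>x\<close> is given by the identification of the completion
  along \<open>x\<close> with \<open>R[[t]]\<close>: \<open>E U f\<close> is the expansion in \<open>t\<close> of a function \<open>f\<close> on a neighbourhood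
  \<open>U\<close> of \<open>x\<close>, and \<open>E U\<close> is an isomorphism modulo every power of the ideal of \<open>x\<close>.\<close>

definition formal_parameter ::
    "('p, 's, 'a, 'b, 'r::comm_ring_1) fam \<Rightarrow> ('a, 'b, 'p, 's) morph \<Rightarrow>
     ('p set \<Rightarrow> 's \<Rightarrow> 'r fps) \<Rightarrow> bool" where
  "formal_parameter F x E \<longleftrightarrow> (\<forall>U. openin (sp_top (ftot F)) U \<longrightarrow> im F x \<subseteq> U \<longrightarrow>
     E U \<in> Ring.ring_hom (sp_ring (ftot F) U) ring_of_type_algebra \<and>
     (\<forall>r. E U (fscal F U r) = fps_const r) \<and>
     (\<forall>f\<in>sects (ftot F) U. fps_nth (E U f) 0 = sval F x U f) \<and>
     (\<forall>V. openin (sp_top (ftot F)) V \<longrightarrow> im F x \<subseteq> V \<longrightarrow> V \<subseteq> U \<longrightarrow>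
        (\<forall>f\<in>sects (ftot F) U. E V (sp_res (ftot F) U V f) = E U f)) \<and>
     (affine_open (ftot F) U \<longrightarrow>
        (\<forall>n. (\<forall>s. \<exists>f\<in>sects (ftot F) U. \<forall>m<n. fps_nth (E U f) m = fps_nth s m) \<and>
             (\<forall>f\<in>sects (ftot F) U. (\<forall>m<n. fps_nth (E U f) m = 0) \<longrightarrow>
                f \<in> ideal_pow (sp_ring (ftot F) U) (sec_ideal F x U) n))))"

text \<open>Laurent expansion along \<open>x\<close> of a function \<open>f\<close> on \<open>V\<close>, where \<open>V\<close> contains a punctured
  neighbourhood \<open>U - x\<close>: there \<open>f = h/g\<close> with \<open>g, h\<close> functions on \<open>U\<close> and \<open>g\<close> invertible off \<open>x\<close>.\<close>

definition laurent ::
    "('p, 's, 'a, 'b, 'r::comm_ring_1) fam \<Rightarrow> ('a, 'b, 'p, 's) morph \<Rightarrow>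
     ('p set \<Rightarrow> 's \<Rightarrow> 'r fps) \<Rightarrow> 'p set \<Rightarrow> 's \<Rightarrow> 'r fls" where
  "laurent F x E V f = (THE G. \<exists>U g h. let X = ftot F; W = U - im F x in
     openin (sp_top X) U \<and> im F x \<subseteq> U \<and> openin (sp_top X) W \<and> W \<subseteq> V \<and>
     g \<in> sects X U \<and> h \<in> sects X U \<and> (\<forall>y\<in>W. inv_at X U g y) \<and>
     sp_res X U W g \<otimes>\<^bsub>sp_ring X W\<^esub> sp_res X V W f = sp_res X U W h \<and>
     fps_to_fls (E U g) * G = fps_to_fls (E U h))"


section \<open>The nodal family\<close>

definition prime_chain :: "'r ring \<Rightarrow> nat \<Rightarrow> bool" where
  "prime_chain A n \<longleftrightarrow>
     (\<exists>p. (\<forall>i\<le>n. primeideal (p i) A) \<and> (\<forall>i<n. p i \<subset> p (Suc i)))"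

definition regular_local_ring :: "'r ring \<Rightarrow> bool" where
  "regular_local_ring A \<longleftrightarrow> cring A \<and> noetherian_ring A \<and> (\<exists>!M. maximalideal M A) \<and>
     (\<exists>d S. prime_chain A d \<and> \<not> prime_chain A (Suc d) \<and>
        S \<subseteq> carrier A \<and> finite S \<and> card S = d \<and> maximalideal (genideal A S) A)"

text \<open>That the fibres are curves is contained in the last two conditions.\<close>

definition nodal_family ::
    "('p, 's, 'a, 'b, 'r::comm_ring_1) fam \<Rightarrow> ('a, 'b, 'p, 's) morph \<Rightarrow> bool" where
  "nodal_family F x \<longleftrightarrow> spec_fam F \<and> proper F \<and> flat F \<and>
     (\<forall>s\<in>pts (fbase F). connectedin (sp_top (ftot F)) {p \<in> pts (ftot F). mpt (fproj F) p = s}) \<and>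
     is_section F x \<and> ordinary_double_point F x \<and>
     (\<forall>p\<in>pts (ftot F) - im F x. smooth1_at F p)"

definition finite_morphism ::
    "('p, 's) rspace \<Rightarrow> ('q, 't) rspace \<Rightarrow> ('p, 's, 'q, 't) morph \<Rightarrow> bool" where
  "finite_morphism X Y f \<longleftrightarrow> morphism X Y f \<and>
     (\<forall>V. affine_open Y V \<longrightarrow> affine_open X (mpre X f V) \<and>
        (let A = sp_ring X (mpre X f V) in
          \<exists>G. finite G \<and> G \<subseteq> carrier A \<and>
            (\<forall>h\<in>carrier A. \<exists>c. (\<forall>g\<in>G. c g \<in> sects Y V) \<and>
               h = (\<Oplus>\<^bsub>A\<^esub>g\<in>G. mpb f V (c g) \<otimes>\<^bsub>A\<^esub> g))))"

definition iso_over ::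
    "('p, 's) rspace \<Rightarrow> ('q, 't) rspace \<Rightarrow> ('p, 's, 'q, 't) morph \<Rightarrow> 'q set \<Rightarrow> bool" where
  "iso_over X Y f V \<longleftrightarrow> openin (sp_top Y) V \<and>
     homeomorphic_map (subtopology (sp_top X) (mpre X f V)) (subtopology (sp_top Y) V) (mpt f) \<and>
     (\<forall>W. openin (sp_top Y) W \<longrightarrow> W \<subseteq> V \<longrightarrow> bij_betw (mpb f W) (sects Y W) (sects X (mpre X f W)))"

text \<open>The partial normalization \<open>\<nu>\<close> of the nodal family \<open>F\<close> along \<open>x0\<close>, together with the marked
  sections \<open>x\<close> of its total space: \<open>Inl i\<close> indexes the sections that make up \<open>\<Sigma>\<^sub>o\<close>, and
  \<open>Inr True\<close>, \<open>Inr False\<close> index the lifts \<open>x\<^sub>+\<close>, \<open>x\<^sub>-\<close> of \<open>x0\<close>.\<close>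

definition marked_normalization ::
    "('p, 's, 'a, 'b, 'r::comm_ring_1) fam \<Rightarrow> ('a, 'b, 'p, 's) morph \<Rightarrow>
     ('q, 't, 'a, 'b, 'r) fam \<Rightarrow> ('q, 't, 'p, 's) morph \<Rightarrow>
     ('i::finite + bool \<Rightarrow> ('a, 'b, 'q, 't) morph) \<Rightarrow> bool" where
  "marked_normalization F x0 G \<nu> x \<longleftrightarrow>
     spec_fam G \<and> fbase G = fbase F \<and> fcoord G = fcoord F \<and>
     finite_morphism (ftot G) (ftot F) \<nu> \<and>
     mor_eq (ftot G) (fbase F) (mcomp (ftot F) (fproj F) \<nu>) (fproj G) \<and>
     iso_over (ftot G) (ftot F) \<nu> (pts (ftot F) - im F x0) \<and>
     (\<forall>q\<in>pts (ftot G). smooth1_at G q) \<and>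
     (\<forall>j. is_section G (x j)) \<and>
     (\<forall>s. mor_eq (fbase F) (ftot F) (mcomp (ftot G) \<nu> (x (Inr s))) x0) \<and>
     (\<forall>j k. j \<noteq> k \<longrightarrow> im G (x j) \<inter> im G (x k) = {}) \<and>
     (\<forall>i. mpt \<nu> ` im G (x (Inl i)) \<inter> im F x0 = {}) \<and>
     affine_open (ftot F) (pts (ftot F) - (\<Union>i. mpt \<nu> ` im G (x (Inl i))))"

definition punctured :: "('q, 't, 'a, 'b, 'r) fam \<Rightarrow> ('j \<Rightarrow> ('a, 'b, 'q, 't) morph) \<Rightarrow> 'q set" where
  "punctured G x = pts (ftot G) - (\<Union>j. im G (x j))"

text \<open>The image of the algebra of regular functions on the complement of the marked sections in
  the direct sum of the rings of Laurent series.\<close>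

definition expansions ::
    "('q, 't, 'a, 'b, 'r::comm_ring_1) fam \<Rightarrow> ('j \<Rightarrow> ('a, 'b, 'q, 't) morph) \<Rightarrow>
     ('j \<Rightarrow> 'q set \<Rightarrow> 't \<Rightarrow> 'r fps) \<Rightarrow> ('j \<Rightarrow> 'r fls) set" where
  "expansions G x E =
     {(\<lambda>j. laurent G (x j) (E j) (punctured G x) f) |f. f \<in> sects (ftot G) (punctured G x)}"


section \<open>The smoothing\<close>

text \<open>The smoothing is the algebraization of a formal scheme on the space underlying the nodal
  family. A function of the latter over an open set is a series
  \<open>f = (\<Sum>n. f n * \<tau>^n)\<close> whose coefficients are functions off \<open>x\<^sub>+\<close> and \<open>x\<^sub>-\<close>, such that, if the
  open set contains the node, the expansion of \<open>f\<close> at \<open>x\<^sub>+\<close> is \<open>(\<Sum>i j. c i j * u^i * v^j)\<close> with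
  \<open>(u, v) = (t\<^sub>+, \<tau>/t\<^sub>+)\<close> and its expansion at \<open>x\<^sub>-\<close> is given by the same \<open>c\<close> with
  \<open>(u, v) = (\<tau>/t\<^sub>-, t\<^sub>-)\<close>. Thus \<open>u^i * v^j\<close> is \<open>t\<^sub>+^(i-j) * \<tau>^j\<close> in the first chart and
  \<open>t\<^sub>-^(j-i) * \<tau>^i\<close> in the second.\<close>

definition glued_at_node :: "(nat \<Rightarrow> 'r::zero fls) \<Rightarrow> (nat \<Rightarrow> 'r fls) \<Rightarrow> bool" where
  "glued_at_node a b \<longleftrightarrow> (\<exists>c :: nat \<Rightarrow> nat \<Rightarrow> 'r. \<forall>n m.
     fls_nth (a n) m = (if 0 \<le> m + int n then c (nat (m + int n)) n else 0) \<and>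
     fls_nth (b n) m = (if 0 \<le> m + int n then c n (nat (m + int n)) else 0))"

definition off_node ::
    "('q, 't, 'a, 'b, 'r) fam \<Rightarrow> ('q, 't, 'p, 's) morph \<Rightarrow>
     ('i + bool \<Rightarrow> ('a, 'b, 'q, 't) morph) \<Rightarrow> 'p set \<Rightarrow> 'q set" where
  "off_node G \<nu> x U = mpre (ftot G) \<nu> U - (\<Union>s. im G (x (Inr s)))"

definition formal_functions ::
    "('p, 's, 'a, 'b, 'r::comm_ring_1) fam \<Rightarrow> ('a, 'b, 'p, 's) morph \<Rightarrow>
     ('q, 't, 'a, 'b, 'r) fam \<Rightarrow> ('q, 't, 'p, 's) morph \<Rightarrow>
     ('i + bool \<Rightarrow> ('a, 'b, 'q, 't) morph) \<Rightarrow> ('i + bool \<Rightarrow> 'q set \<Rightarrow> 't \<Rightarrow> 'r fps) \<Rightarrow>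
     'p set \<Rightarrow> (nat \<Rightarrow> 't) set" where
  "formal_functions F x0 G \<nu> x E U = {f. (\<forall>n. f n \<in> sects (ftot G) (off_node G \<nu> x U)) \<and>
     (im F x0 \<subseteq> U \<longrightarrow>
        glued_at_node
          (\<lambda>n. laurent G (x (Inr True)) (E (Inr True)) (off_node G \<nu> x U) (f n))
          (\<lambda>n. laurent G (x (Inr False)) (E (Inr False)) (off_node G \<nu> x U) (f n)))}"

text \<open>\<open>C\<close> is a proper flat scheme over \<open>Spec R[[\<tau>]]\<close>; \<open>\<theta>\<close> is the homeomorphism of the nodal family
  onto the locus \<open>\<tau> = 0\<close> and \<open>\<kappa>\<close> the expansion in \<open>\<tau>\<close>, which identifies the formal completion of
  \<open>C\<close> along that locus with the formal scheme above (it suffices to consider open sets that contain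
  the node or are disjoint from it); \<open>\<sigma>\<close> is the extension of the sections in \<open>\<Sigma>\<^sub>o\<close>.\<close>

definition smoothing ::
    "('p, 's, 'a, 'b, 'r::comm_ring_1) fam \<Rightarrow> ('a, 'b, 'p, 's) morph \<Rightarrow>
     ('q, 't, 'a, 'b, 'r) fam \<Rightarrow> ('q, 't, 'p, 's) morph \<Rightarrow>
     ('i + bool \<Rightarrow> ('a, 'b, 'q, 't) morph) \<Rightarrow> ('i + bool \<Rightarrow> 'q set \<Rightarrow> 't \<Rightarrow> 'r fps) \<Rightarrow>
     ('u, 'v, 'c, 'd, 'r fps) fam \<Rightarrow> ('p \<Rightarrow> 'u) \<Rightarrow> ('u set \<Rightarrow> 'v \<Rightarrow> nat \<Rightarrow> 't) \<Rightarrow>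
     ('i \<Rightarrow> ('c, 'd, 'u, 'v) morph) \<Rightarrow> bool" where
  "smoothing F x0 G \<nu> x E C \<theta> \<kappa> \<sigma> \<longleftrightarrow>
     (let X = ftot C; T = sp_top X; P = pts (ftot F);
          U0 = (\<lambda>U. {p \<in> P. \<theta> p \<in> U});
          adm = (\<lambda>U. openin T U \<and> (im F x0 \<subseteq> U0 U \<or> im F x0 \<inter> U0 U = {}));
          B = (\<lambda>U. sp_ring (ftot G) (off_node G \<nu> x (U0 U)))
      in
     spec_fam C \<and> proper C \<and> flat C \<and>
     homeomorphic_map (sp_top (ftot F))
       (subtopology T {p \<in> pts X. \<not> inv_at X (pts X) (fscal C (pts X) fps_X) p}) \<theta> \<and>
     (\<forall>U. adm U \<longrightarrow>
        (\<forall>f\<in>sects X U. \<kappa> U f \<in> formal_functions F x0 G \<nu> x E (U0 U)) \<and>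
        (\<forall>f\<in>sects X U. \<forall>g\<in>sects X U. \<forall>n.
           \<kappa> U (f \<oplus>\<^bsub>sp_ring X U\<^esub> g) n = \<kappa> U f n \<oplus>\<^bsub>B U\<^esub> \<kappa> U g n \<and>
           \<kappa> U (f \<otimes>\<^bsub>sp_ring X U\<^esub> g) n = (\<Oplus>\<^bsub>B U\<^esub>k\<in>{..n}. \<kappa> U f k \<otimes>\<^bsub>B U\<^esub> \<kappa> U g (n - k))) \<and>
        (\<forall>r n. \<kappa> U (fscal C U r) n = fscal G (off_node G \<nu> x (U0 U)) (fps_nth r n)) \<and>
        (\<forall>V. adm V \<longrightarrow> V \<subseteq> U \<longrightarrow> (\<forall>f\<in>sects X U. \<forall>n. \<kappa> V (sp_res X U V f) n =
           sp_res (ftot G) (off_node G \<nu> x (U0 U)) (off_node G \<nu> x (U0 V)) (\<kappa> U f n))) \<and>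
        (affine_open X U \<longrightarrow> (\<forall>n.
           (\<forall>g\<in>formal_functions F x0 G \<nu> x E (U0 U). \<exists>f\<in>sects X U. \<forall>k\<le>n. \<kappa> U f k = g k) \<and>
           (\<forall>f\<in>sects X U. (\<forall>k\<le>n. \<kappa> U f k = \<zero>\<^bsub>B U\<^esub>) \<longrightarrow>
              (\<exists>h\<in>sects X U. f = fscal C U (fps_X ^ Suc n) \<otimes>\<^bsub>sp_ring X U\<^esub> h))))) \<and>
     (\<forall>i. is_section C (\<sigma> i) \<and>
        (\<forall>U. openin T U \<longrightarrow> (im C (\<sigma> i) \<subseteq> U \<longleftrightarrow> mpt \<nu> ` im G (x (Inl i)) \<subseteq> U0 U)) \<and>
        (\<forall>U. adm U \<longrightarrow> im C (\<sigma> i) \<subseteq> U \<longrightarrow> (\<forall>f\<in>sects X U. \<forall>n.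
           fps_nth (sval C (\<sigma> i) U f) n = sval G (x (Inl i)) (off_node G \<nu> x (U0 U)) (\<kappa> U f n)))))"

text \<open>The expansion along the extended sections of a function on their complement in \<open>C\<close>; its
  coefficients are power series in \<open>\<tau>\<close>.\<close>

definition smoothing_expansion ::
    "('q, 't, 'a, 'b, 'r::comm_ring_1) fam \<Rightarrow> ('i + bool \<Rightarrow> ('a, 'b, 'q, 't) morph) \<Rightarrow>
     ('i + bool \<Rightarrow> 'q set \<Rightarrow> 't \<Rightarrow> 'r fps) \<Rightarrow>
     ('u, 'v, 'c, 'd, 'r fps) fam \<Rightarrow> ('u set \<Rightarrow> 'v \<Rightarrow> nat \<Rightarrow> 't) \<Rightarrow>
     ('i \<Rightarrow> ('c, 'd, 'u, 'v) morph) \<Rightarrow> 'v \<Rightarrow> 'i \<Rightarrow> 'r fps fls" where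
  "smoothing_expansion G x E C \<kappa> \<sigma> f i = (THE H. \<forall>m n. fps_nth (fls_nth H m) n =
     fls_nth (laurent G (x (Inl i)) (E (Inl i)) (punctured G x) (\<kappa> (punctured C \<sigma>) f n)) m)"


section \<open>The Lie algebra and its representations\<close>

text \<open>The last three fields are a Cartan subalgebra, a system of positive roots and a generator of
  the highest root space. Roots are functions that vanish off the Cartan subalgebra.\<close>

record 'g lie_data =
  lscale :: "complex \<Rightarrow> 'g \<Rightarrow> 'g"
  lbrk :: "'g \<Rightarrow> 'g \<Rightarrow> 'g"
  lform :: "'g \<Rightarrow> 'g \<Rightarrow> complex"
  lcartan :: "'g set"
  lpos :: "('g \<Rightarrow> complex) set"
  lhigh :: "'g"

definition simple_lie_algebra :: "('g::ab_group_add) lie_data \<Rightarrow> bool" where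
  "simple_lie_algebra L \<longleftrightarrow> vector_space (lscale L) \<and>
     (\<exists>B. finite B \<and> Modules.module.span (lscale L) B = UNIV) \<and>
     (\<forall>x. Vector_Spaces.linear (lscale L) (lscale L) (lbrk L x)) \<and>
     (\<forall>x. lbrk L x x = 0) \<and>
     (\<forall>x y z. lbrk L x (lbrk L y z) + lbrk L y (lbrk L z x) + lbrk L z (lbrk L x y) = 0) \<and>
     (\<forall>y. Vector_Spaces.linear (lscale L) (lscale L) (\<lambda>x. lbrk L x y)) \<and>
     (\<exists>x y. lbrk L x y \<noteq> 0) \<and>
     (\<forall>I. Modules.module.subspace (lscale L) I \<longrightarrow> (\<forall>x. \<forall>y\<in>I. lbrk L x y \<in> I) \<longrightarrow>
        I = {0} \<or> I = UNIV)"

definition root_space :: "('g::ab_group_add) lie_data \<Rightarrow> ('g \<Rightarrow> complex) \<Rightarrow> 'g set" where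
  "root_space L \<alpha> = {y. \<forall>h\<in>lcartan L. lbrk L h y = lscale L (\<alpha> h) y}"

definition roots :: "('g::ab_group_add) lie_data \<Rightarrow> ('g \<Rightarrow> complex) set" where
  "roots L = {\<alpha>. \<alpha> \<noteq> (\<lambda>_. 0) \<and> (\<forall>x. x \<notin> lcartan L \<longrightarrow> \<alpha> x = 0) \<and> root_space L \<alpha> \<noteq> {0}}"

definition cartan_subalgebra :: "('g::ab_group_add) lie_data \<Rightarrow> bool" where
  "cartan_subalgebra L \<longleftrightarrow> Modules.module.subspace (lscale L) (lcartan L) \<and>
     root_space L (\<lambda>_. 0) = lcartan L \<and>
     Modules.module.span (lscale L) (lcartan L \<union> (\<Union>\<alpha>\<in>roots L. root_space L \<alpha>)) = UNIV"

definition positive_system :: "('g::ab_group_add) lie_data \<Rightarrow> bool" where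
  "positive_system L \<longleftrightarrow> lpos L \<subseteq> roots L \<and>
     (\<forall>\<alpha>\<in>roots L. (\<alpha> \<in> lpos L) \<noteq> ((\<lambda>x. - \<alpha> x) \<in> lpos L)) \<and>
     (\<forall>\<alpha>\<in>lpos L. \<forall>\<beta>\<in>lpos L. (\<lambda>x. \<alpha> x + \<beta> x) \<in> roots L \<longrightarrow> (\<lambda>x. \<alpha> x + \<beta> x) \<in> lpos L)"

definition highest_root_vector :: "('g::ab_group_add) lie_data \<Rightarrow> bool" where
  "highest_root_vector L \<longleftrightarrow> lhigh L \<noteq> 0 \<and>
     (\<exists>\<theta>\<in>lpos L. lhigh L \<in> root_space L \<theta> \<and> (\<forall>\<alpha>\<in>lpos L. (\<lambda>x. \<theta> x + \<alpha> x) \<notin> roots L))"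

text \<open>The value of the dual form on \<open>(\<alpha>, \<alpha>)\<close>.\<close>

definition root_norm :: "('g::ab_group_add) lie_data \<Rightarrow> ('g \<Rightarrow> complex) \<Rightarrow> complex" where
  "root_norm L \<alpha> = \<alpha> (THE t. t \<in> lcartan L \<and> (\<forall>h\<in>lcartan L. lform L t h = \<alpha> h))"

definition normalized_form :: "('g::ab_group_add) lie_data \<Rightarrow> bool" where
  "normalized_form L \<longleftrightarrow>
     (\<forall>x. Vector_Spaces.linear (lscale L) (*) (lform L x)) \<and>
     (\<forall>x y. lform L x y = lform L y x) \<and>
     (\<forall>x y z. lform L (lbrk L x y) z = lform L x (lbrk L y z)) \<and>
     (\<forall>\<alpha>\<in>roots L. (\<forall>\<beta>\<in>roots L. Re (root_norm L \<beta>) \<le> Re (root_norm L \<alpha>)) \<longrightarrow>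
        root_norm L \<alpha> = 2)"

definition orthonormal_basis :: "('g::ab_group_add) lie_data \<Rightarrow> ('k::finite \<Rightarrow> 'g) \<Rightarrow> bool" where
  "orthonormal_basis L X \<longleftrightarrow> Modules.module.span (lscale L) (range X) = UNIV \<and>
     (\<forall>i j. lform L (X i) (X j) = (if i = j then 1 else 0))"

text \<open>A representation on \<open>\<complex>\<^sup>n\<close>, given by matrices.\<close>

type_synonym 'g rep = "nat \<times> ('g \<Rightarrow> complex mat)"

definition is_rep :: "('g::ab_group_add) lie_data \<Rightarrow> 'g rep \<Rightarrow> bool" where
  "is_rep L V \<longleftrightarrow> (case V of (n, \<rho>) \<Rightarrow>
     (\<forall>x. \<rho> x \<in> carrier_mat n n) \<and> (\<forall>x y. \<rho> (x + y) = \<rho> x + \<rho> y) \<and>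
     (\<forall>a x. \<rho> (lscale L a x) = a \<cdot>\<^sub>m \<rho> x) \<and>
     (\<forall>x y. \<rho> (lbrk L x y) = \<rho> x * \<rho> y - \<rho> y * \<rho> x))"

definition irreducible_rep :: "('g::ab_group_add) lie_data \<Rightarrow> 'g rep \<Rightarrow> bool" where
  "irreducible_rep L V \<longleftrightarrow> is_rep L V \<and> (case V of (n, \<rho>) \<Rightarrow> 0 < n \<and>
     (\<forall>W \<subseteq> carrier_vec n. 0\<^sub>v n \<in> W \<longrightarrow> (\<forall>v\<in>W. \<forall>w\<in>W. v + w \<in> W) \<longrightarrow>
        (\<forall>a. \<forall>v\<in>W. a \<cdot>\<^sub>v v \<in> W) \<longrightarrow> (\<forall>x. \<forall>v\<in>W. \<rho> x *\<^sub>v v \<in> W) \<longrightarrow>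
        W = {0\<^sub>v n} \<or> W = carrier_vec n))"

definition rep_iso :: "'g rep \<Rightarrow> 'g rep \<Rightarrow> bool" where
  "rep_iso V W \<longleftrightarrow> fst V = fst W \<and>
     (\<exists>P \<in> carrier_mat (fst V) (fst V). invertible_mat P \<and> (\<forall>x. P * snd V x = snd W x * P))"

definition dual_rep :: "'g rep \<Rightarrow> 'g rep" where
  "dual_rep V = (fst V, \<lambda>x. - transpose_mat (snd V x))"

definition rep_class :: "('g::ab_group_add) lie_data \<Rightarrow> 'g rep \<Rightarrow> 'g rep set" where
  "rep_class L V = {W. is_rep L W \<and> rep_iso V W}"

definition dual_class :: "('g::ab_group_add) lie_data \<Rightarrow> 'g rep set \<Rightarrow> 'g rep set" where
  "dual_class L \<mu> = (\<Union>V\<in>\<mu>. rep_class L (dual_rep V))"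

definition level :: "'g lie_data \<Rightarrow> 'g rep \<Rightarrow> nat" where
  "level L V = (LEAST m. snd V (lhigh L) ^\<^sub>m Suc m = 0\<^sub>m (fst V) (fst V))"

definition level_classes :: "('g::ab_group_add) lie_data \<Rightarrow> nat \<Rightarrow> 'g rep set set" where
  "level_classes L l = {rep_class L V |V. irreducible_rep L V \<and> level L V \<le> l}"

definition highest_weight_vector ::
    "('g::ab_group_add) lie_data \<Rightarrow> 'g rep \<Rightarrow> complex vec \<Rightarrow> bool" where
  "highest_weight_vector L V v \<longleftrightarrow> v \<in> carrier_vec (fst V) \<and> v \<noteq> 0\<^sub>v (fst V) \<and>
     (\<forall>\<alpha>\<in>lpos L. \<forall>x\<in>root_space L \<alpha>. snd V x *\<^sub>v v = 0\<^sub>v (fst V))"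

definition casimir :: "('k::finite \<Rightarrow> 'g) \<Rightarrow> 'g rep \<Rightarrow> complex" where
  "casimir X V = (THE c.
     mat (fst V) (fst V) (\<lambda>(i, j). \<Sum>k\<in>UNIV. (snd V (X k) * snd V (X k)) $$ (i, j)) =
     c \<cdot>\<^sub>m 1\<^sub>m (fst V))"

definition equivariant_duality ::
    "'g rep \<Rightarrow> 'g rep \<Rightarrow> (complex vec \<Rightarrow> complex vec \<Rightarrow> complex) \<Rightarrow> bool" where
  "equivariant_duality V W b \<longleftrightarrow>
     (\<forall>v\<in>carrier_vec (fst V). \<forall>v'\<in>carrier_vec (fst V). \<forall>w\<in>carrier_vec (fst W). \<forall>a.
        b (v + v') w = b v w + b v' w \<and> b (a \<cdot>\<^sub>v v) w = a * b v w) \<and>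
     (\<forall>v\<in>carrier_vec (fst V). \<forall>w\<in>carrier_vec (fst W). \<forall>w'\<in>carrier_vec (fst W). \<forall>a.
        b v (w + w') = b v w + b v w' \<and> b v (a \<cdot>\<^sub>v w) = a * b v w) \<and>
     (\<forall>x. \<forall>v\<in>carrier_vec (fst V). \<forall>w\<in>carrier_vec (fst W).
        b (snd V x *\<^sub>v v) w + b v (snd W x *\<^sub>v w) = 0) \<and>
     (\<forall>v\<in>carrier_vec (fst V). (\<forall>w\<in>carrier_vec (fst W). b v w = 0) \<longrightarrow> v = 0\<^sub>v (fst V)) \<and>
     (\<forall>w\<in>carrier_vec (fst W). (\<forall>v\<in>carrier_vec (fst V). b v w = 0) \<longrightarrow> w = 0\<^sub>v (fst W))"


section \<open>Representations of the affine Lie algebra and spaces of covacua\<close>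

text \<open>A module is presented as the free module on a set of words modulo a submodule of relations,
  so that an equation in it appears as membership of a difference in that submodule. The word
  \<open>([(x\<^sub>1, f\<^sub>1), ..., (x\<^sub>k, f\<^sub>k)], v)\<close> stands for \<open>x\<^sub>1 f\<^sub>1 \<circ> ... \<circ> x\<^sub>k f\<^sub>k v\<close>, and a family of words
  indexed by the sections stands for the tensor product of its members.\<close>

type_synonym ('g, 'r) word = "('g \<times> 'r fls) list \<times> complex vec"

definition smul :: "'r::comm_ring_1 \<Rightarrow> ('w \<Rightarrow>\<^sub>0 'r) \<Rightarrow> ('w \<Rightarrow>\<^sub>0 'r)" where
  "smul r z = Poly_Mapping.map ((*) r) z"

abbreviation bas :: "'w \<Rightarrow> ('w \<Rightarrow>\<^sub>0 'r::comm_ring_1)" where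
  "bas w \<equiv> Poly_Mapping.single w 1"

abbreviation submod :: "('w \<Rightarrow>\<^sub>0 'r::comm_ring_1) set \<Rightarrow> ('w \<Rightarrow>\<^sub>0 'r) set" where
  "submod S \<equiv> Modules.module.span smul S"

definition lin_ext ::
    "('w \<Rightarrow> ('z \<Rightarrow>\<^sub>0 'r)) \<Rightarrow> ('w \<Rightarrow>\<^sub>0 'r::comm_ring_1) \<Rightarrow> ('z \<Rightarrow>\<^sub>0 'r)" where
  "lin_ext h z = (\<Sum>w\<in>Poly_Mapping.keys z. smul (Poly_Mapping.lookup z w) (h w))"

text \<open>The relations of \<open>H\<^sub>\<ell>(V)\<close>; \<open>e\<close> is the structure map of the base ring as an algebra over \<open>\<complex>\<close>.
  Rule \<open>off\<close> discards words whose last entry is not in \<open>V\<close>, and the next six express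
  multilinearity.\<close>

inductive_set vacuum_rels ::
    "('g::ab_group_add) lie_data \<Rightarrow> nat \<Rightarrow> (complex \<Rightarrow> 'r::comm_ring_1) \<Rightarrow> 'g rep \<Rightarrow>
     (('g, 'r) word \<Rightarrow>\<^sub>0 'r) set"
  for L l e V where
  off: "v \<notin> carrier_vec (fst V) \<Longrightarrow> bas (p, v) \<in> vacuum_rels L l e V"
| vadd: "v \<in> carrier_vec (fst V) \<Longrightarrow> w \<in> carrier_vec (fst V) \<Longrightarrow>
    bas (p, v + w) - bas (p, v) - bas (p, w) \<in> vacuum_rels L l e V"
| vscale: "v \<in> carrier_vec (fst V) \<Longrightarrow>
    bas (p, a \<cdot>\<^sub>v v) - smul (e a) (bas (p, v)) \<in> vacuum_rels L l e V"
| gadd: "bas (p @ (x + y, f) # q, v) - bas (p @ (x, f) # q, v) - bas (p @ (y, f) # q, v)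
    \<in> vacuum_rels L l e V"
| gscale: "bas (p @ (lscale L a x, f) # q, v) - smul (e a) (bas (p @ (x, f) # q, v))
    \<in> vacuum_rels L l e V"
| fadd: "bas (p @ (x, f + h) # q, v) - bas (p @ (x, f) # q, v) - bas (p @ (x, h) # q, v)
    \<in> vacuum_rels L l e V"
| fscale: "bas (p @ (x, fls_const r * f) # q, v) - smul r (bas (p @ (x, f) # q, v))
    \<in> vacuum_rels L l e V"
| comm: "bas (p @ (x, f) # (y, h) # q, v) - bas (p @ (y, h) # (x, f) # q, v)
      - bas (p @ (lbrk L x y, f * h) # q, v)
      - smul (of_nat l * e (lform L x y) * fls_residue (h * fls_deriv f)) (bas (p @ q, v))
    \<in> vacuum_rels L l e V"
| vacuum: "v \<in> carrier_vec (fst V) \<Longrightarrow>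
    bas (p @ [(x, fps_to_fls f)], v) - smul (fps_nth f 0) (bas (p, snd V x *\<^sub>v v))
    \<in> vacuum_rels L l e V"
| integrable: "highest_weight_vector L V v \<Longrightarrow>
    bas (p @ replicate (1 + l - level L V) (lhigh L, fls_X_intpow (-1)), v)
    \<in> vacuum_rels L l e V"

text \<open>The relations of the tensor product of the \<open>H\<^sub>\<ell>(V j)\<close>.\<close>

definition H_rels ::
    "('g::ab_group_add) lie_data \<Rightarrow> nat \<Rightarrow> (complex \<Rightarrow> 'r::comm_ring_1) \<Rightarrow> ('j::finite \<Rightarrow> 'g rep) \<Rightarrow>
     (('j \<Rightarrow> ('g, 'r) word) \<Rightarrow>\<^sub>0 'r) set" where
  "H_rels L l e V =
     submod (\<Union>j w. lin_ext (\<lambda>a. bas (w(j := a))) ` vacuum_rels L l e (V j))"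

text \<open>The operator \<open>x f\<close> in the factor \<open>j\<close>.\<close>

definition act :: "'j \<Rightarrow> 'g \<times> 'r fls \<Rightarrow> (('j \<Rightarrow> ('g, 'r::comm_ring_1) word) \<Rightarrow>\<^sub>0 'r) \<Rightarrow>
     (('j \<Rightarrow> ('g, 'r) word) \<Rightarrow>\<^sub>0 'r)" where
  "act j a = lin_ext (\<lambda>w. bas (w(j := (a # fst (w j), snd (w j)))))"

text \<open>The relations of the coinvariants for the action of \<open>\<gg> \<otimes> A\<close>, where \<open>A\<close> is given by its image
  in the direct sum of the rings of Laurent series.\<close>

definition covacua_rels ::
    "('g::ab_group_add) lie_data \<Rightarrow> nat \<Rightarrow> (complex \<Rightarrow> 'r::comm_ring_1) \<Rightarrow> ('j::finite \<Rightarrow> 'g rep) \<Rightarrow>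
     ('j \<Rightarrow> 'r fls) set \<Rightarrow> (('j \<Rightarrow> ('g, 'r) word) \<Rightarrow>\<^sub>0 'r) set" where
  "covacua_rels L l e V A =
     submod (H_rels L l e V \<union> {\<Sum>j\<in>UNIV. act j (x, f j) z |x f z. f \<in> A})"


section \<open>The glueing tensors\<close>

definition extended_pairing ::
    "('g::ab_group_add) lie_data \<Rightarrow> nat \<Rightarrow> (complex \<Rightarrow> 'r::comm_ring_1) \<Rightarrow> 'g rep \<Rightarrow> 'g rep \<Rightarrow>
     (complex vec \<Rightarrow> complex vec \<Rightarrow> complex) \<Rightarrow>
     ((('g, 'r) word \<Rightarrow>\<^sub>0 'r) \<Rightarrow> (('g, 'r) word \<Rightarrow>\<^sub>0 'r) \<Rightarrow> 'r) \<Rightarrow> bool" where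
  "extended_pairing L l e V W b \<beta> \<longleftrightarrow>
     (\<forall>u u' w. \<beta> (u + u') w = \<beta> u w + \<beta> u' w) \<and> (\<forall>r u w. \<beta> (smul r u) w = r * \<beta> u w) \<and>
     (\<forall>u w w'. \<beta> u (w + w') = \<beta> u w + \<beta> u w') \<and> (\<forall>r u w. \<beta> u (smul r w) = r * \<beta> u w) \<and>
     (\<forall>u\<in>submod (vacuum_rels L l e V). \<forall>w. \<beta> u w = 0) \<and>
     (\<forall>u. \<forall>w\<in>submod (vacuum_rels L l e W). \<beta> u w = 0) \<and>
     (\<forall>v\<in>carrier_vec (fst V). \<forall>w\<in>carrier_vec (fst W). \<beta> (bas ([], v)) (bas ([], w)) = e (b v w)) \<and>
     (\<forall>x n p v q w.
        \<beta> (bas ((x, fls_X_intpow n) # p, v)) (bas (q, w)) +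
        \<beta> (bas (p, v)) (bas ((x, fls_X_intpow (- n)) # q, w)) = 0)"

text \<open>Representatives of the elements of degree \<open>-d\<close> of \<open>H\<^sub>\<ell>(V)\<close>.\<close>

definition degree_part :: "nat \<Rightarrow> (('g, 'r::comm_ring_1) word \<Rightarrow>\<^sub>0 'r) set" where
  "degree_part d = submod {bas (map (\<lambda>(x, n). (x, fls_X_intpow n)) p, v) |p v.
     sum_list (map snd p) = - int d}"

text \<open>The list \<open>\<epsilon>\<close> of pairs stands for the sum of the tensors of its members; the last two
  conditions say that this tensor is the transpose inverse of the pairing in degree \<open>-d\<close>.\<close>

definition glueing_tensor ::
    "('g::ab_group_add) lie_data \<Rightarrow> nat \<Rightarrow> (complex \<Rightarrow> 'r::comm_ring_1) \<Rightarrow> 'g rep \<Rightarrow> 'g rep \<Rightarrow>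
     ((('g, 'r) word \<Rightarrow>\<^sub>0 'r) \<Rightarrow> (('g, 'r) word \<Rightarrow>\<^sub>0 'r) \<Rightarrow> 'r) \<Rightarrow> nat \<Rightarrow>
     ((('g, 'r) word \<Rightarrow>\<^sub>0 'r) \<times> (('g, 'r) word \<Rightarrow>\<^sub>0 'r)) list \<Rightarrow> bool" where
  "glueing_tensor L l e V W \<beta> d \<epsilon> \<longleftrightarrow>
     set \<epsilon> \<subseteq> degree_part d \<times> degree_part d \<and>
     (\<forall>u\<in>degree_part d.
        u - (\<Sum>(a, b)\<leftarrow>\<epsilon>. smul (\<beta> u b) a) \<in> submod (vacuum_rels L l e V)) \<and>
     (\<forall>u\<in>degree_part d.
        u - (\<Sum>(a, b)\<leftarrow>\<epsilon>. smul (\<beta> a u) b) \<in> submod (vacuum_rels L l e W))"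

definition normalization_reps :: "('i \<Rightarrow> 'g rep) \<Rightarrow> 'g rep \<Rightarrow> 'g rep \<Rightarrow> 'i + bool \<Rightarrow> 'g rep" where
  "normalization_reps V Vp Vm = case_sum V (\<lambda>s. if s then Vp else Vm)"

text \<open>\<open>w \<otimes> a \<otimes> b\<close>, with \<open>a\<close> placed at \<open>x\<^sub>+\<close> and \<open>b\<close> at \<open>x\<^sub>-\<close>.\<close>

definition tensor3 ::
    "('i \<Rightarrow> ('g, 'r) word) \<Rightarrow> (('g, 'r) word \<Rightarrow>\<^sub>0 'r) \<Rightarrow> (('g, 'r) word \<Rightarrow>\<^sub>0 'r::comm_ring_1) \<Rightarrow>
     (('i + bool \<Rightarrow> ('g, 'r) word) \<Rightarrow>\<^sub>0 'r)" where
  "tensor3 w a b = lin_ext (\<lambda>p. lin_ext (\<lambda>q. bas (case_sum w (\<lambda>s. if s then p else q))) b) a"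

definition const_fls :: "'r::comm_ring_1 fls \<Rightarrow> 'r fps fls" where
  "const_fls f = Abs_fls (\<lambda>n. fps_const (fls_nth f n))"

definition const_word :: "('g, 'r::comm_ring_1) word \<Rightarrow> ('g, 'r fps) word" where
  "const_word w = (map (\<lambda>(x, f). (x, const_fls f)) (fst w), snd w)"

text \<open>\<open>\<Phi>\<close> represents the isomorphism of the space of covacua with relations \<open>N\<close> onto the direct sum
  over \<open>\<mu> \<in> P\<close> of the modules of power series in \<open>\<tau>\<close> with coefficients in the space of covacua with
  relations \<open>M \<mu>\<close>; the last condition determines it, since the words with coefficients constant in
  \<open>\<tau>\<close> generate the source.\<close>

definition glueing_decomposition ::
    "'m set \<Rightarrow> (('i \<Rightarrow> ('g, 'r::comm_ring_1 fps) word) \<Rightarrow>\<^sub>0 'r fps) set \<Rightarrow>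
     ('m \<Rightarrow> (('i + bool \<Rightarrow> ('g, 'r) word) \<Rightarrow>\<^sub>0 'r) set) \<Rightarrow>
     ('m \<Rightarrow> nat \<Rightarrow> ((('g, 'r) word \<Rightarrow>\<^sub>0 'r) \<times> (('g, 'r) word \<Rightarrow>\<^sub>0 'r)) list) \<Rightarrow>
     ((('i \<Rightarrow> ('g, 'r fps) word) \<Rightarrow>\<^sub>0 'r fps) \<Rightarrow> 'm \<Rightarrow> nat \<Rightarrow>
        (('i + bool \<Rightarrow> ('g, 'r) word) \<Rightarrow>\<^sub>0 'r)) \<Rightarrow> bool" where
  "glueing_decomposition P N M \<epsilon> \<Phi> \<longleftrightarrow>
     (\<forall>\<mu>\<in>P. \<forall>d. \<forall>u v. \<Phi> (u + v) \<mu> d - (\<Phi> u \<mu> d + \<Phi> v \<mu> d) \<in> M \<mu>) \<and>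
     (\<forall>\<mu>\<in>P. \<forall>d. \<forall>r u.
        \<Phi> (smul r u) \<mu> d - (\<Sum>k\<le>d. smul (fps_nth r k) (\<Phi> u \<mu> (d - k))) \<in> M \<mu>) \<and>
     (\<forall>u. (\<forall>\<mu>\<in>P. \<forall>d. \<Phi> u \<mu> d \<in> M \<mu>) \<longleftrightarrow> u \<in> N) \<and>
     (\<forall>u. finite {\<mu> \<in> P. \<exists>d. \<Phi> u \<mu> d \<notin> M \<mu>}) \<and>
     (\<forall>\<phi>. finite {\<mu> \<in> P. \<exists>d. \<phi> \<mu> d \<notin> M \<mu>} \<longrightarrow>
        (\<exists>u. \<forall>\<mu>\<in>P. \<forall>d. \<Phi> u \<mu> d - \<phi> \<mu> d \<in> M \<mu>)) \<and>
     (\<forall>\<mu>\<in>P. \<forall>d w.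
        \<Phi> (bas (\<lambda>i. const_word (w i))) \<mu> d - (\<Sum>(a, b)\<leftarrow>\<epsilon> \<mu> d. tensor3 w a b) \<in> M \<mu>)"


section \<open>The WZW connection\<close>

text \<open>The derivation \<open>\<tau> d/d\<tau>\<close> of the base ring, and its coefficientwise extensions.\<close>

definition euler :: "'r::comm_ring_1 fps \<Rightarrow> 'r fps" where
  "euler r = fps_X * fps_deriv r"

definition euler_fls :: "'r::comm_ring_1 fps fls \<Rightarrow> 'r fps fls" where
  "euler_fls f = Abs_fls (\<lambda>n. euler (fls_nth f n))"

definition D_hor ::
    "(('j::finite \<Rightarrow> ('g, 'r::comm_ring_1 fps) word) \<Rightarrow>\<^sub>0 'r fps) \<Rightarrow>
     (('j \<Rightarrow> ('g, 'r fps) word) \<Rightarrow>\<^sub>0 'r fps)" where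
  "D_hor z = (\<Sum>w\<in>Poly_Mapping.keys z. Poly_Mapping.single w (euler (Poly_Mapping.lookup z w))) +
     lin_ext (\<lambda>w. \<Sum>j\<in>UNIV. \<Sum>k<length (fst (w j)).
       bas (w(j := ((fst (w j))[k := map_prod id euler_fls (fst (w j) ! k)], snd (w j))))) z"

text \<open>A derivation of \<open>A\<close> over \<open>\<tau> d/d\<tau>\<close>, with vertical part \<open>(g i) d/dt\<^sub>i\<close> in the factor \<open>i\<close>.\<close>

definition wzw_derivation ::
    "('u, 'v, 'c, 'd, 'r::comm_ring_1 fps) fam \<Rightarrow> 'u set \<Rightarrow> ('v \<Rightarrow> 'i \<Rightarrow> 'r fps fls) \<Rightarrow>
     ('v \<Rightarrow> 'v) \<Rightarrow> ('i \<Rightarrow> 'r fps fls) \<Rightarrow> bool" where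
  "wzw_derivation C U ex D g \<longleftrightarrow> (let A = sp_ring (ftot C) U in
     (\<forall>f\<in>carrier A. D f \<in> carrier A) \<and>
     (\<forall>f\<in>carrier A. \<forall>h\<in>carrier A. D (f \<oplus>\<^bsub>A\<^esub> h) = D f \<oplus>\<^bsub>A\<^esub> D h \<and>
        D (f \<otimes>\<^bsub>A\<^esub> h) = (D f \<otimes>\<^bsub>A\<^esub> h) \<oplus>\<^bsub>A\<^esub> (f \<otimes>\<^bsub>A\<^esub> D h)) \<and>
     (\<forall>r. D (fscal C U r) = fscal C U (euler r)) \<and>
     (\<forall>f\<in>carrier A. \<forall>i. ex (D f) i = euler_fls (ex f i) + g i * fls_deriv (ex f i)))"

text \<open>The terms \<open>-m \<le> a, b \<le> m\<close> of the operator of \<open>g d/dt\<close> in the factor \<open>j\<close>; every vector is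
  annihilated by all but finitely many terms.\<close>

definition sugawara_trunc ::
    "(complex \<Rightarrow> 'r::comm_ring_1) \<Rightarrow> ('k::finite \<Rightarrow> 'g) \<Rightarrow> 'j \<Rightarrow> 'r fls \<Rightarrow> int \<Rightarrow>
     (('j \<Rightarrow> ('g, 'r) word) \<Rightarrow>\<^sub>0 'r) \<Rightarrow> (('j \<Rightarrow> ('g, 'r) word) \<Rightarrow>\<^sub>0 'r)" where
  "sugawara_trunc e X j g m z = (\<Sum>a\<in>{-m..m}. \<Sum>b\<in>{-m..m}. \<Sum>k\<in>UNIV.
     smul (e (1 / 2) * fls_nth g (a + b + 1))
       (act j (X k, fls_X_intpow (min a b)) (act j (X k, fls_X_intpow (max a b)) z)))"

definition sugawara ::
    "(('j \<Rightarrow> ('g, 'r) word) \<Rightarrow>\<^sub>0 'r) set \<Rightarrow> (complex \<Rightarrow> 'r::comm_ring_1) \<Rightarrow> ('k::finite \<Rightarrow> 'g) \<Rightarrow>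
     'j \<Rightarrow> 'r fls \<Rightarrow> (('j \<Rightarrow> ('g, 'r) word) \<Rightarrow>\<^sub>0 'r) \<Rightarrow> (('j \<Rightarrow> ('g, 'r) word) \<Rightarrow>\<^sub>0 'r) \<Rightarrow> bool" where
  "sugawara N e X j g u y \<longleftrightarrow> (\<exists>m0. \<forall>m\<ge>m0. y - sugawara_trunc e X j g m u \<in> N)"

text \<open>\<open>\<D>\<close> represents the operator induced on the space of covacua by \<open>D\<^sub>h\<^sub>o\<^sub>r\<close> and the vertical part
  \<open>g\<close>, plus the scalar \<open>s\<close>; \<open>c = \<ell> + h\<close>, and \<open>NH\<close>, \<open>N\<close> are the relations before and after
  taking coinvariants.\<close>

definition wzw_connection ::
    "(complex \<Rightarrow> 'r::comm_ring_1) \<Rightarrow> ('k::finite \<Rightarrow> 'g) \<Rightarrow> complex \<Rightarrow>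
     (('i::finite \<Rightarrow> ('g, 'r fps) word) \<Rightarrow>\<^sub>0 'r fps) set \<Rightarrow>
     (('i \<Rightarrow> ('g, 'r fps) word) \<Rightarrow>\<^sub>0 'r fps) set \<Rightarrow>
     ('i \<Rightarrow> 'r fps fls) \<Rightarrow> 'r fps \<Rightarrow>
     ((('i \<Rightarrow> ('g, 'r fps) word) \<Rightarrow>\<^sub>0 'r fps) \<Rightarrow> (('i \<Rightarrow> ('g, 'r fps) word) \<Rightarrow>\<^sub>0 'r fps)) \<Rightarrow> bool"
  where
  "wzw_connection e X c NH N g s \<D> \<longleftrightarrow>
     (\<forall>u. \<exists>y. (\<forall>i. sugawara NH (\<lambda>a. fps_const (e a)) X i (g i) u (y i)) \<and>
        \<D> u - (D_hor u - smul (fps_const (e (1 / c))) (\<Sum>i\<in>UNIV. y i) + smul s u) \<in> N)"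

text \<open>\<open>\<D>\<close> acts in the \<open>\<mu>\<close>-summand as \<open>\<tau> d/d\<tau> + k \<mu>\<close>.\<close>

definition acts_in_summands ::
    "(complex \<Rightarrow> 'r::comm_ring_1) \<Rightarrow> 'm set \<Rightarrow> ('m \<Rightarrow> ('z \<Rightarrow>\<^sub>0 'r) set) \<Rightarrow>
     (('w \<Rightarrow>\<^sub>0 'r fps) \<Rightarrow> 'm \<Rightarrow> nat \<Rightarrow> ('z \<Rightarrow>\<^sub>0 'r)) \<Rightarrow>
     (('w \<Rightarrow>\<^sub>0 'r fps) \<Rightarrow> ('w \<Rightarrow>\<^sub>0 'r fps)) \<Rightarrow> ('m \<Rightarrow> complex) \<Rightarrow> bool" where
  "acts_in_summands e P M \<Phi> \<D> k \<longleftrightarrow>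
     (\<forall>\<mu>\<in>P. \<forall>u d. \<Phi> (\<D> u) \<mu> d - (smul (of_nat d) (\<Phi> u \<mu> d) + smul (e (k \<mu>)) (\<Phi> u \<mu> d)) \<in> M \<mu>)"


section \<open>Multivalued sections and monodromy\<close>

text \<open>A finitely supported \<open>s\<close> stands for the multivalued section
  \<open>\<Sum>\<alpha> k. \<tau>^\<alpha> * (log \<tau>)^k * s (\<alpha>, k)\<close>, with \<open>s (\<alpha>, k)\<close> in the free module of which the space of
  covacua is the quotient by \<open>N\<close>. The relations \<open>\<tau>^(\<alpha>+1) * u = \<tau>^\<alpha> * (\<tau> * u)\<close> also make \<open>\<tau>\<close>
  invertible.\<close>

type_synonym ('w, 'r) multivalued = "(complex \<times> nat) \<Rightarrow>\<^sub>0 ('w \<Rightarrow>\<^sub>0 'r fps)"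

definition mv_rels ::
    "('w \<Rightarrow>\<^sub>0 'r::comm_ring_1 fps) set \<Rightarrow> ('w, 'r) multivalued set" where
  "mv_rels N = Modules.module.span (\<lambda>r. Poly_Mapping.map (smul r))
     ({Poly_Mapping.single (\<alpha>, k) u |\<alpha> k u. u \<in> N} \<union>
      {Poly_Mapping.single (\<alpha> + 1, k) u - Poly_Mapping.single (\<alpha>, k) (smul fps_X u) |\<alpha> k u. True})"

definition mv_nabla ::
    "(complex \<Rightarrow> 'r::comm_ring_1) \<Rightarrow> (('w \<Rightarrow>\<^sub>0 'r fps) \<Rightarrow> ('w \<Rightarrow>\<^sub>0 'r fps)) \<Rightarrow>
     ('w, 'r) multivalued \<Rightarrow> ('w, 'r) multivalued" where
  "mv_nabla e \<D> s = (\<Sum>(\<alpha>, k)\<in>Poly_Mapping.keys s. let u = Poly_Mapping.lookup s (\<alpha>, k) in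
     Poly_Mapping.single (\<alpha>, k) (\<D> u + smul (fps_const (e \<alpha>)) u) +
     Poly_Mapping.single (\<alpha>, k - 1) (smul (of_nat k) u))"

definition flat_section ::
    "(complex \<Rightarrow> 'r::comm_ring_1) \<Rightarrow> ('w \<Rightarrow>\<^sub>0 'r fps) set \<Rightarrow>
     (('w \<Rightarrow>\<^sub>0 'r fps) \<Rightarrow> ('w \<Rightarrow>\<^sub>0 'r fps)) \<Rightarrow> ('w, 'r) multivalued \<Rightarrow> bool" where
  "flat_section e N \<D> s \<longleftrightarrow> mv_nabla e \<D> s \<in> mv_rels N"

definition mv_scale :: "(complex \<Rightarrow> 'r::comm_ring_1) \<Rightarrow> complex \<Rightarrow> ('w, 'r) multivalued \<Rightarrow>
     ('w, 'r) multivalued" where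
  "mv_scale e a = Poly_Mapping.map (smul (fps_const (e a)))"

text \<open>A counterclockwise turn replaces \<open>\<tau>^\<alpha>\<close> by \<open>exp (2 \<pi> i \<alpha>) * \<tau>^\<alpha>\<close> and \<open>log \<tau>\<close> by
  \<open>log \<tau> + 2 \<pi> i\<close>.\<close>

definition monodromy ::
    "(complex \<Rightarrow> 'r::comm_ring_1) \<Rightarrow> ('w, 'r) multivalued \<Rightarrow> ('w, 'r) multivalued" where
  "monodromy e s = (\<Sum>(\<alpha>, k)\<in>Poly_Mapping.keys s. \<Sum>j\<le>k.
     Poly_Mapping.single (\<alpha>, j)
       (smul (fps_const (e (exp (2 * of_real pi * \<i> * \<alpha>) * of_nat (k choose j) *
            (2 * of_real pi * \<i>) ^ (k - j))))
          (Poly_Mapping.lookup s (\<alpha>, k))))"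

definition in_summand ::
    "'m set \<Rightarrow> ('m \<Rightarrow> ('z \<Rightarrow>\<^sub>0 'r::comm_ring_1) set) \<Rightarrow>
     (('w \<Rightarrow>\<^sub>0 'r fps) \<Rightarrow> 'm \<Rightarrow> nat \<Rightarrow> ('z \<Rightarrow>\<^sub>0 'r)) \<Rightarrow> 'm \<Rightarrow> ('w, 'r) multivalued \<Rightarrow> bool" where
  "in_summand P M \<Phi> \<mu> s \<longleftrightarrow>
     (\<forall>p. \<forall>\<rho>\<in>P - {\<mu>}. \<forall>d. \<Phi> (Poly_Mapping.lookup s p) \<rho> d \<in> M \<rho>)"

end

theory Submission
  imports Defs
begin

text \<open>
  In the summand of \<open>\<mu>\<close> the connection is \<open>\<tau> d/d\<tau> + c\<^sub>\<mu> / (2 (\<ell> + h))\<close>. Comparing coefficients of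
  \<open>\<tau>^\<gamma> (log \<tau>)^k\<close>, a flat section can only contain the term \<open>\<tau>^\<gamma>\<close> with
  \<open>\<gamma> = - c\<^sub>\<mu> / (2 (\<ell> + h))\<close>, on which the monodromy is the scalar \<open>exp (2 \<pi> i \<gamma>)\<close>.

  That this scalar is a root of unity, of order bounded independently of \<open>\<mu>\<close>, means that the numbers
  \<open>c\<^sub>\<mu> / (\<ell> + h)\<close> have a common denominator. In a basis \<open>Y\<close> of weight vectors, with dual basis \<open>Y'\<close> and
  \<open>t\<^sub>Y = [Y, Y']\<close>, the ladder argument of \<open>sl\<^sub>2\<close>-theory gives \<open>2 \<eta>(t\<^sub>Y) \<in> \<int> (t\<^sub>Y, t\<^sub>Y)\<close> for every weight
  \<open>\<eta>\<close> of a finite dimensional representation. Since \<open>2 h (x, y) = \<Sum>\<^sub>Y wt\<^sub>Y(x) wt\<^sub>Y(y)\<close> on the Cartan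
  subalgebra, the number \<open>8 h / (t\<^sub>Y, t\<^sub>Y)\<close> is a positive integer; the normalization \<open>(t\<^sub>Y, t\<^sub>Y) = 2\<close> for
  long roots makes all these numbers rational. Finally, on a highest weight vector of weight \<open>\<eta>\<close>,
  \<open>c = (\<Sum>\<^sub>Y \<eta>(t\<^sub>Y)\<^sup>2) / (2 h) + \<Sum> \<eta>(t\<^sub>Y)\<close>, the second sum being over the positive \<open>Y\<close>.
\<close>

section \<open>Coefficients of multivalued sections\<close>

text \<open>Multivalued sections form a quotient in which \<tau>^(\<alpha>+1) u and \<tau>^\<alpha>
  (\<tau> u) agree, so a section has no canonical expression and the coefficient of \<tau>^\<gamma>
  has to be given a meaning. It is read off through \<open>\<Phi>\<close>, collects the
  contributions of all exponents \<alpha> with \<gamma> - \<alpha> a natural number, and matters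
  only modulo \<open>M \<mu>\<close>. All these coefficients vanish modulo \<open>M\<close> exactly
  when the section is a relation, which turns flatness and monodromy into coefficientwise
  statements. The order must serve all \<mu> at once. It comes from one denominator that depends
  only on the Lie algebra and on \<open>l\<close>, so the classes need not be counted. In the
  formula for c, positive means that the weight of Y has positive real part at a fixed regular
  element of the Cartan subalgebra. The formula is the classical (\<eta>, \<eta> + 2\<rho>), with
  (\<eta>, \<eta>) rewritten as a sum over root vectors so that only the integers of the ladder
  argument enter. Since \<open>casimir\<close> is a definite description, the Casimir matrix has to
  be shown to be scalar in every member of every class.\<close>

lemma lookup_smul [simp]: "Poly_Mapping.lookup (smul r z) w = r * Poly_Mapping.lookup z w"
  by (simp add: smul_def Poly_Mapping.map.rep_eq when_def)

interpretation smul: Modules.module "smul :: 'r::comm_ring_1 \<Rightarrow> ('w \<Rightarrow>\<^sub>0 'r) \<Rightarrow> ('w \<Rightarrow>\<^sub>0 'r)"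
  by unfold_locales (auto intro!: poly_mapping_eqI simp: lookup_add algebra_simps)

lemma lookup_mv_smul [simp]:
  "Poly_Mapping.lookup (Poly_Mapping.map (smul r) s) p = smul r (Poly_Mapping.lookup s p)"
  by (simp add: Poly_Mapping.map.rep_eq when_def)

interpretation mv: Modules.module
  "\<lambda>r :: 'r::comm_ring_1 fps. Poly_Mapping.map (smul r) :: ('w, 'r) multivalued \<Rightarrow> ('w, 'r) multivalued"
  by unfold_locales
    (auto intro!: poly_mapping_eqI simp: lookup_add smul.scale_right_distrib smul.scale_left_distrib)

lemma poly_mapping_sum_singles:
  "z = (\<Sum>p\<in>Poly_Mapping.keys z. Poly_Mapping.single p (Poly_Mapping.lookup z p))"
proof (rule poly_mapping_eqI)
  fix q
  have "(\<Sum>p\<in>Poly_Mapping.keys z. Poly_Mapping.lookup z p when p = q) = Poly_Mapping.lookup z q"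
    by (cases "q \<in> Poly_Mapping.keys z") (auto simp: when_def in_keys_iff)
  then show "Poly_Mapping.lookup z q = Poly_Mapping.lookup
      (\<Sum>p\<in>Poly_Mapping.keys z. Poly_Mapping.single p (Poly_Mapping.lookup z p)) q"
    by (simp add: lookup_sum lookup_single)
qed

text \<open>All exponents that contribute to the coefficient of \<tau>^\<gamma> differ from \<gamma>
  by integers, so a full turn multiplies them by the same factor.\<close>

lemma exp_shift_of_nat:
  fixes \<alpha> :: complex
  shows "exp (2 * of_real pi * \<i> * (\<alpha> + of_nat d)) = exp (2 * of_real pi * \<i> * \<alpha>)"
proof -
  have "exp (2 * of_real pi * \<i> * of_nat d) = 1"
    using exp_two_pi_i by (simp add: exp_of_nat2_mult)
  then show ?thesis by (simp add: ring_distribs exp_add)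
qed

text \<open>The algebraic content of the glueing decomposition. The last assumption lets membership
  in \<open>N\<close> be tested summand by summand and degree by degree.\<close>

locale summands =
  fixes e :: "complex \<Rightarrow> 'r::comm_ring_1" and P :: "'m set"
    and N :: "('w \<Rightarrow>\<^sub>0 'r fps) set" and M :: "'m \<Rightarrow> ('z \<Rightarrow>\<^sub>0 'r) set"
    and \<Phi> :: "('w \<Rightarrow>\<^sub>0 'r fps) \<Rightarrow> 'm \<Rightarrow> nat \<Rightarrow> ('z \<Rightarrow>\<^sub>0 'r)"
  assumes e_add: "e (a + b) = e a + e b" and e_mult: "e (a * b) = e a * e b" and e_1: "e 1 = 1"
    and sub_M: "\<mu> \<in> P \<Longrightarrow> smul.subspace (M \<mu>)"
    and \<Phi>_add: "\<mu> \<in> P \<Longrightarrow> \<Phi> (u + v) \<mu> d - (\<Phi> u \<mu> d + \<Phi> v \<mu> d) \<in> M \<mu>"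
    and \<Phi>_smul: "\<mu> \<in> P \<Longrightarrow>
      \<Phi> (smul r u) \<mu> d - (\<Sum>k\<le>d. smul (fps_nth r k) (\<Phi> u \<mu> (d - k))) \<in> M \<mu>"
    and kernel: "(\<forall>\<mu>\<in>P. \<forall>d. \<Phi> u \<mu> d \<in> M \<mu>) \<longleftrightarrow> u \<in> N"
begin

lemma e_0: "e 0 = 0"
  using e_add[of 0 0] by simp

lemma e_of_nat: "e (of_nat n) = of_nat n"
  by (induction n) (simp_all add: e_0 e_1 e_add)

text \<open>\<open>\<Phi>\<close> is linear only modulo \<open>M \<mu>\<close>, so computations in a
  summand are chains of congruences.\<close>

definition cong :: "'m \<Rightarrow> ('z \<Rightarrow>\<^sub>0 'r) \<Rightarrow> ('z \<Rightarrow>\<^sub>0 'r) \<Rightarrow> bool" where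
  "cong \<mu> x y \<longleftrightarrow> x - y \<in> M \<mu>"

context
  fixes \<mu> assumes \<mu>: "\<mu> \<in> P"
begin

lemma cong_refl [simp]: "cong \<mu> x x"
  using smul.subspace_0[OF sub_M[OF \<mu>]] by (simp add: cong_def)

lemma cong_sym: "cong \<mu> x y \<Longrightarrow> cong \<mu> y x"
  using smul.subspace_neg[OF sub_M[OF \<mu>], of "x - y"] by (simp add: cong_def)

lemma cong_trans: "cong \<mu> x y \<Longrightarrow> cong \<mu> y z \<Longrightarrow> cong \<mu> x z"
  using smul.subspace_add[OF sub_M[OF \<mu>], of "x - y" "y - z"] by (simp add: cong_def)

lemma cong_add: "cong \<mu> x y \<Longrightarrow> cong \<mu> x' y' \<Longrightarrow> cong \<mu> (x + x') (y + y')"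
  using smul.subspace_add[OF sub_M[OF \<mu>], of "x - y" "x' - y'"]
  by (simp add: cong_def algebra_simps)

lemma cong_smul: "cong \<mu> x y \<Longrightarrow> cong \<mu> (smul r x) (smul r y)"
  using smul.subspace_scale[OF sub_M[OF \<mu>], of "x - y" r]
  by (simp add: cong_def smul.scale_right_diff_distrib)

lemma cong_sum: "(\<And>i. i \<in> I \<Longrightarrow> cong \<mu> (f i) (h i)) \<Longrightarrow> cong \<mu> (sum f I) (sum h I)"
  by (induction I rule: infinite_finite_induct) (auto intro: cong_add)

lemma cong_0_iff: "cong \<mu> x 0 \<longleftrightarrow> x \<in> M \<mu>"
  by (simp add: cong_def)

lemma cong_mem: "cong \<mu> x y \<Longrightarrow> x \<in> M \<mu> \<longleftrightarrow> y \<in> M \<mu>"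
proof -
  assume *: "cong \<mu> x y"
  show "x \<in> M \<mu> \<longleftrightarrow> y \<in> M \<mu>"
    unfolding cong_0_iff[symmetric] using cong_trans[OF *, of 0] cong_trans[OF cong_sym[OF *], of 0] by blast
qed

lemma \<Phi>_0: "\<Phi> 0 \<mu> d \<in> M \<mu>"
  using \<Phi>_add[OF \<mu>, of 0 0 d] smul.subspace_neg[OF sub_M[OF \<mu>], of "- \<Phi> 0 \<mu> d"]
  by simp

end

text \<open>Since \<open>u\<close> is the series \<open>\<Sum>d. \<Phi> u \<mu> d * \<tau>^d\<close> in the summand \<open>\<mu>\<close>, the next two definitions
  extract the coefficients of \<open>\<tau>^\<gamma>\<close> in \<open>\<tau>^\<alpha> * u\<close> and of \<open>\<tau>^\<gamma> * (log \<tau>)^k\<close> in a multivalued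
  section.\<close>

definition coeff1 :: "complex \<Rightarrow> 'm \<Rightarrow> complex \<Rightarrow> ('w \<Rightarrow>\<^sub>0 'r fps) \<Rightarrow> ('z \<Rightarrow>\<^sub>0 'r)" where
  "coeff1 \<gamma> \<mu> \<alpha> u = (if \<gamma> - \<alpha> \<in> \<nat> then \<Phi> u \<mu> (nat \<lfloor>Re (\<gamma> - \<alpha>)\<rfloor>) else 0)"

definition mv_coeff :: "complex \<Rightarrow> nat \<Rightarrow> 'm \<Rightarrow> ('w, 'r) multivalued \<Rightarrow> ('z \<Rightarrow>\<^sub>0 'r)" where
  "mv_coeff \<gamma> k \<mu> s = (\<Sum>p\<in>Poly_Mapping.keys s.
     if snd p = k then coeff1 \<gamma> \<mu> (fst p) (Poly_Mapping.lookup s p) else 0)"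

lemma coeff1_shift [simp]: "coeff1 (\<alpha> + of_nat d) \<mu> \<alpha> u = \<Phi> u \<mu> d"
  by (simp add: coeff1_def)

lemma coeff1_cases:
  obtains d where "\<gamma> = \<alpha> + of_nat d" | "\<gamma> - \<alpha> \<notin> \<nat>" "\<And>\<mu> u. coeff1 \<gamma> \<mu> \<alpha> u = 0"
proof (cases "\<gamma> - \<alpha> \<in> \<nat>")
  case True
  then obtain d where "\<gamma> - \<alpha> = of_nat d" by (elim Nats_cases)
  then show ?thesis using that(1)[of d] by (simp add: algebra_simps)
qed (auto simp: coeff1_def intro: that(2))

context
  fixes \<mu> assumes \<mu>: "\<mu> \<in> P"
begin

lemma coeff1_add: "cong \<mu> (coeff1 \<gamma> \<mu> \<alpha> (u + v)) (coeff1 \<gamma> \<mu> \<alpha> u + coeff1 \<gamma> \<mu> \<alpha> v)"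
  using \<Phi>_add[OF \<mu>] by (simp add: coeff1_def cong_def smul.subspace_0[OF sub_M[OF \<mu>]])

lemma coeff1_0: "cong \<mu> (coeff1 \<gamma> \<mu> \<alpha> 0) 0"
  using \<Phi>_0[OF \<mu>] by (simp add: coeff1_def cong_def smul.subspace_0[OF sub_M[OF \<mu>]])

text \<open>This is the Cauchy product in degree d. Terms with i > d vanish because \<gamma> - i
  then lies below \<alpha>. The upper limit n may exceed d, so that one n can serve all exponents of
  a multivalued section.\<close>

lemma coeff1_smul:
  assumes "\<And>d. \<gamma> = \<alpha> + of_nat d \<Longrightarrow> d \<le> n"
  shows "cong \<mu> (coeff1 \<gamma> \<mu> \<alpha> (smul r u))
    (\<Sum>i\<le>n. smul (fps_nth r i) (coeff1 (\<gamma> - of_nat i) \<mu> \<alpha> u))"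
proof (cases rule: coeff1_cases[of \<gamma> \<alpha>])
  case (1 d)
  have "coeff1 (\<gamma> - of_nat i) \<mu> \<alpha> u = (if i \<le> d then \<Phi> u \<mu> (d - i) else 0)" for i
  proof (cases "i \<le> d")
    case True
    then have "\<gamma> - of_nat i = \<alpha> + of_nat (d - i)" by (simp add: 1 of_nat_diff)
    then show ?thesis using True by (simp only: coeff1_shift if_True)
  next
    case False
    have "of_nat d - of_nat i \<notin> (\<nat> :: complex set)"
    proof
      assume "of_nat d - of_nat i \<in> (\<nat> :: complex set)"
      then obtain j where "of_nat d - of_nat i = (of_nat j :: complex)" by (elim Nats_cases)
      then have "(of_nat d :: complex) = of_nat (j + i)" by (simp add: algebra_simps)
      then show False using False by (simp only: of_nat_eq_iff)
    qed
    then show ?thesis using False by (simp add: coeff1_def 1)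
  qed
  then have "(\<Sum>i\<le>n. smul (fps_nth r i) (coeff1 (\<gamma> - of_nat i) \<mu> \<alpha> u)) =
      (\<Sum>i\<le>d. smul (fps_nth r i) (\<Phi> u \<mu> (d - i)))"
    using assms[OF 1] by (intro sum.mono_neutral_cong_right) auto
  then show ?thesis using \<Phi>_smul[OF \<mu>] by (simp add: 1 cong_def)
next
  case 2
  have "coeff1 (\<gamma> - of_nat i) \<mu> \<alpha> u = 0" for i
  proof (cases rule: coeff1_cases[of "\<gamma> - of_nat i" \<alpha>])
    case (1 d)
    then have "\<gamma> - \<alpha> = of_nat (d + i)" by (simp add: algebra_simps)
    with 2(1) show ?thesis by (metis of_nat_in_Nats)
  qed
  then show ?thesis using 2(2) by (simp add: \<mu>)
qed

lemma coeff1_smul_const: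
  "cong \<mu> (coeff1 \<gamma> \<mu> \<alpha> (smul (fps_const r) u)) (smul r (coeff1 \<gamma> \<mu> \<alpha> u))"
proof -
  define n where "n = nat \<lfloor>Re (\<gamma> - \<alpha>)\<rfloor>"
  have "(\<Sum>i\<le>n. smul (fps_nth (fps_const r) i) (coeff1 (\<gamma> - of_nat i) \<mu> \<alpha> u)) =
      smul r (coeff1 \<gamma> \<mu> \<alpha> u)"
    by (subst sum.remove[of _ 0]) auto
  moreover have "cong \<mu> (coeff1 \<gamma> \<mu> \<alpha> (smul (fps_const r) u))
      (\<Sum>i\<le>n. smul (fps_nth (fps_const r) i) (coeff1 (\<gamma> - of_nat i) \<mu> \<alpha> u))"
    by (rule coeff1_smul) (simp add: n_def)
  ultimately show ?thesis by simp
qed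

text \<open>This congruence makes the coefficients compatible with the relation between
  \<tau>^(\<alpha>+1) u and \<tau>^\<alpha> (\<tau> u).\<close>

lemma coeff1_smul_X: "cong \<mu> (coeff1 \<gamma> \<mu> \<alpha> (smul fps_X u)) (coeff1 \<gamma> \<mu> (\<alpha> + 1) u)"
proof -
  \<comment> \<open>The \<open>Suc\<close> keeps index 1, the only one where \<open>fps_X\<close>
    has a nonzero coefficient, inside the range of summation.\<close>
  define n where "n = Suc (nat \<lfloor>Re (\<gamma> - \<alpha>)\<rfloor>)"
  have "(\<Sum>i\<le>n. smul (fps_nth fps_X i) (coeff1 (\<gamma> - of_nat i) \<mu> \<alpha> u)) = coeff1 (\<gamma> - 1) \<mu> \<alpha> u"
    by (subst sum.remove[of _ 1]) (auto simp: n_def fps_X_def)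
  moreover have "cong \<mu> (coeff1 \<gamma> \<mu> \<alpha> (smul fps_X u))
      (\<Sum>i\<le>n. smul (fps_nth fps_X i) (coeff1 (\<gamma> - of_nat i) \<mu> \<alpha> u))"
    by (rule coeff1_smul) (simp add: n_def)
  moreover have "coeff1 (\<gamma> - 1) \<mu> \<alpha> u = coeff1 \<gamma> \<mu> (\<alpha> + 1) u"
    by (simp add: coeff1_def algebra_simps)
  ultimately show ?thesis by simp
qed

text \<open>Only a congruence: outside the support the summands are values of \<open>\<Phi>\<close>
  at 0, which lie in \<open>M \<mu>\<close> but need not be 0. A common index set is what allows
  sections to be added.\<close>

lemma mv_coeff_superset:
  assumes "finite A" "Poly_Mapping.keys s \<subseteq> A"
  shows "cong \<mu> (mv_coeff \<gamma> k \<mu> s)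
    (\<Sum>p\<in>A. if snd p = k then coeff1 \<gamma> \<mu> (fst p) (Poly_Mapping.lookup s p) else 0)"
proof -
  let ?f = "\<lambda>p. if snd p = k then coeff1 \<gamma> \<mu> (fst p) (Poly_Mapping.lookup s p) else 0"
  have "sum ?f A = sum ?f (Poly_Mapping.keys s) + sum ?f (A - Poly_Mapping.keys s)"
    using sum.subset_diff[OF assms(2,1), of ?f] by (simp only: add.commute)
  moreover have "cong \<mu> (sum ?f (A - Poly_Mapping.keys s)) (\<Sum>p\<in>A - Poly_Mapping.keys s. 0)"
    by (rule cong_sum[OF \<mu>]) (auto simp: in_keys_iff coeff1_0 \<mu>)
  ultimately have "cong \<mu> (sum ?f A) (mv_coeff \<gamma> k \<mu> s)"
    using cong_add[OF \<mu> cong_refl[OF \<mu>], of "sum ?f (A - Poly_Mapping.keys s)" 0 "mv_coeff \<gamma> k \<mu> s"]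
    by (simp add: mv_coeff_def)
  then show ?thesis by (rule cong_sym[OF \<mu>])
qed

lemma mv_coeff_0 [simp]: "mv_coeff \<gamma> k \<mu> 0 = 0"
  by (simp add: mv_coeff_def)

lemma mv_coeff_add: "cong \<mu> (mv_coeff \<gamma> k \<mu> (s + t)) (mv_coeff \<gamma> k \<mu> s + mv_coeff \<gamma> k \<mu> t)"
proof -
  let ?A = "Poly_Mapping.keys s \<union> Poly_Mapping.keys t"
  let ?S = "\<lambda>s. \<Sum>p\<in>?A. if snd p = k then coeff1 \<gamma> \<mu> (fst p) (Poly_Mapping.lookup s p) else 0"
  have "cong \<mu> (?S (s + t)) (\<Sum>p\<in>?A.
      (if snd p = k then coeff1 \<gamma> \<mu> (fst p) (Poly_Mapping.lookup s p) else 0) +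
      (if snd p = k then coeff1 \<gamma> \<mu> (fst p) (Poly_Mapping.lookup t p) else 0))"
    by (rule cong_sum[OF \<mu>]) (auto simp: lookup_add coeff1_add \<mu>)
  then have "cong \<mu> (?S (s + t)) (?S s + ?S t)"
    by (simp add: sum.distrib)
  moreover have "cong \<mu> (mv_coeff \<gamma> k \<mu> (s + t)) (?S (s + t))"
    by (rule mv_coeff_superset) (simp_all add: Poly_Mapping.keys_add)
  moreover have "cong \<mu> (?S s + ?S t) (mv_coeff \<gamma> k \<mu> s + mv_coeff \<gamma> k \<mu> t)"
    by (intro cong_add cong_sym[OF \<mu> mv_coeff_superset] \<mu>) auto
  ultimately show ?thesis using cong_trans[OF \<mu>] by blast
qed

lemma mv_coeff_sum: "cong \<mu> (mv_coeff \<gamma> k \<mu> (\<Sum>i\<in>I. f i)) (\<Sum>i\<in>I. mv_coeff \<gamma> k \<mu> (f i))"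
proof (induction I rule: infinite_finite_induct)
  case (insert i I)
  then show ?case
    using cong_trans[OF \<mu> mv_coeff_add cong_add[OF \<mu> cong_refl[OF \<mu>] insert.IH]] by simp
qed (auto simp: \<mu>)

lemma mv_coeff_single:
  "cong \<mu> (mv_coeff \<gamma> k \<mu> (Poly_Mapping.single (\<alpha>, j) u)) (if j = k then coeff1 \<gamma> \<mu> \<alpha> u else 0)"
  using mv_coeff_superset[of "{(\<alpha>, j)}" "Poly_Mapping.single (\<alpha>, j) u" \<gamma> k]
  by (cases "j = k") auto

lemma mv_coeff_smul:
  "\<exists>n. cong \<mu> (mv_coeff \<gamma> k \<mu> (Poly_Mapping.map (smul r) s))
     (\<Sum>i\<le>n. smul (fps_nth r i) (mv_coeff (\<gamma> - of_nat i) k \<mu> s))"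
proof -
  note [trans] = cong_trans[OF \<mu>]
  let ?K = "Poly_Mapping.keys s"
  have keys: "Poly_Mapping.keys (Poly_Mapping.map (smul r) s) \<subseteq> ?K"
    by (auto simp: in_keys_iff)
  \<comment> \<open>A bound for the degrees at which exponents of the support can meet \<gamma>;
    \<open>insert 0\<close> covers the empty support.\<close>
  define n where "n = Max (insert 0 ((\<lambda>p. nat \<lfloor>Re (\<gamma> - fst p)\<rfloor>) ` ?K))"
  have n: "d \<le> n" if "p \<in> ?K" "\<gamma> = fst p + of_nat d" for p d
    using that unfolding n_def by (intro Max_ge) (force simp: image_iff)+
  have "cong \<mu> (mv_coeff \<gamma> k \<mu> (Poly_Mapping.map (smul r) s))
      (\<Sum>p\<in>?K. if snd p = k then coeff1 \<gamma> \<mu> (fst p) (smul r (Poly_Mapping.lookup s p)) else 0)"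
    using mv_coeff_superset[of ?K "Poly_Mapping.map (smul r) s" \<gamma> k] keys
    by (simp cong: if_cong)
  also have "cong \<mu> (\<Sum>p\<in>?K. if snd p = k then coeff1 \<gamma> \<mu> (fst p) (smul r (Poly_Mapping.lookup s p)) else 0)
      (\<Sum>p\<in>?K. if snd p = k then
        \<Sum>i\<le>n. smul (fps_nth r i) (coeff1 (\<gamma> - of_nat i) \<mu> (fst p) (Poly_Mapping.lookup s p)) else 0)"
    using n by (intro cong_sum \<mu>) (auto intro!: coeff1_smul simp: \<mu>)
  also have "(\<Sum>p\<in>?K. if snd p = k then
        \<Sum>i\<le>n. smul (fps_nth r i) (coeff1 (\<gamma> - of_nat i) \<mu> (fst p) (Poly_Mapping.lookup s p)) else 0) =
      (\<Sum>p\<in>?K. \<Sum>i\<le>n. smul (fps_nth r i) (if snd p = k then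
         coeff1 (\<gamma> - of_nat i) \<mu> (fst p) (Poly_Mapping.lookup s p) else 0))"
    by (intro sum.cong) auto
  also have "\<dots> = (\<Sum>i\<le>n. smul (fps_nth r i) (mv_coeff (\<gamma> - of_nat i) k \<mu> s))"
    by (subst sum.swap) (simp add: mv_coeff_def smul.scale_sum_right)
  finally show ?thesis by blast
qed

text \<open>Coefficients are well defined on the quotient: each kind of generator has coefficients
  in \<open>M \<mu>\<close>, by \<open>kernel\<close> and by \<open>coeff1_smul_X\<close>.\<close>

lemma mv_rels_imp_coeff:
  fixes s :: "('w, 'r) multivalued"
  assumes "s \<in> mv_rels N"
  shows "mv_coeff \<gamma> k \<mu> s \<in> M \<mu>"
proof -
  note sub = sub_M[OF \<mu>]
  \<comment> \<open>The claim must hold for all \<gamma> at once, since scaling by a power series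
    mixes the coefficients at \<gamma> - i.\<close>
  have "\<forall>\<gamma>. mv_coeff \<gamma> k \<mu> s \<in> M \<mu>"
    using assms unfolding mv_rels_def
  proof (rule mv.span_induct)
    show "mv.subspace {s. \<forall>\<gamma>. mv_coeff \<gamma> k \<mu> s \<in> M \<mu>}"
    proof (rule mv.subspaceI)
      show "0 \<in> {s. \<forall>\<gamma>. mv_coeff \<gamma> k \<mu> s \<in> M \<mu>}"
        using smul.subspace_0[OF sub] by simp
    next
      fix s t assume "s \<in> {s. \<forall>\<gamma>. mv_coeff \<gamma> k \<mu> s \<in> M \<mu>}" "t \<in> {s. \<forall>\<gamma>. mv_coeff \<gamma> k \<mu> s \<in> M \<mu>}"
      then show "s + t \<in> {s. \<forall>\<gamma>. mv_coeff \<gamma> k \<mu> s \<in> M \<mu>}"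
        using smul.subspace_add[OF sub] cong_mem[OF \<mu> mv_coeff_add] by simp
    next
      fix r :: "'r fps" and s assume s: "s \<in> {s. \<forall>\<gamma>. mv_coeff \<gamma> k \<mu> s \<in> M \<mu>}"
      have "mv_coeff \<gamma> k \<mu> (Poly_Mapping.map (smul r) s) \<in> M \<mu>" for \<gamma>
      proof -
        obtain n where n: "cong \<mu> (mv_coeff \<gamma> k \<mu> (Poly_Mapping.map (smul r) s))
            (\<Sum>i\<le>n. smul (fps_nth r i) (mv_coeff (\<gamma> - of_nat i) k \<mu> s))"
          using mv_coeff_smul by blast
        show ?thesis
          using s unfolding cong_mem[OF \<mu> n]
          by (auto intro!: smul.subspace_sum[OF sub] smul.subspace_scale[OF sub])
      qed
      then show "Poly_Mapping.map (smul r) s \<in> {s. \<forall>\<gamma>. mv_coeff \<gamma> k \<mu> s \<in> M \<mu>}"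
        by simp
    qed
  next
    fix s :: "('w, 'r) multivalued"
    assume "s \<in> {Poly_Mapping.single (\<alpha>, k) u |\<alpha> k u. u \<in> N} \<union>
      {Poly_Mapping.single (\<alpha> + 1, k) u - Poly_Mapping.single (\<alpha>, k) (smul fps_X u) |\<alpha> k u. True}"
    then consider \<alpha> j u where "s = Poly_Mapping.single (\<alpha>, j) u" "u \<in> N"
      | \<alpha> j u where "s = Poly_Mapping.single (\<alpha> + 1, j) u - Poly_Mapping.single (\<alpha>, j) (smul fps_X u)"
      by blast
    then show "\<forall>\<gamma>. mv_coeff \<gamma> k \<mu> s \<in> M \<mu>"
    proof cases
      case 1
      then have "coeff1 \<gamma> \<mu> \<alpha> u \<in> M \<mu>" for \<gamma>
        using kernel[of u] \<mu> smul.subspace_0[OF sub] by (simp add: coeff1_def)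
      then show ?thesis
        using cong_mem[OF \<mu> mv_coeff_single] smul.subspace_0[OF sub] 1 by simp
    next
      case 2
      show ?thesis
      proof
        fix \<gamma>
        let ?s = "Poly_Mapping.single (\<alpha>, j) (smul fps_X u)"
        \<comment> \<open>Additivity is applied to \<open>s + ?s\<close>, which is a single term,
          and the contribution of \<open>?s\<close> is cancelled afterwards.\<close>
        have "cong \<mu> (mv_coeff \<gamma> k \<mu> (s + ?s)) (mv_coeff \<gamma> k \<mu> s + mv_coeff \<gamma> k \<mu> ?s)"
          by (rule mv_coeff_add)
        moreover have "cong \<mu> (mv_coeff \<gamma> k \<mu> (s + ?s)) (mv_coeff \<gamma> k \<mu> ?s)"
        proof -
          have "s + ?s = Poly_Mapping.single (\<alpha> + 1, j) u" by (simp add: 2)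
          then have "cong \<mu> (mv_coeff \<gamma> k \<mu> (s + ?s)) (if j = k then coeff1 \<gamma> \<mu> (\<alpha> + 1) u else 0)"
            using mv_coeff_single by simp
          moreover
          have "cong \<mu> (if j = k then coeff1 \<gamma> \<mu> \<alpha> (smul fps_X u) else 0)
              (if j = k then coeff1 \<gamma> \<mu> (\<alpha> + 1) u else 0)"
            using coeff1_smul_X \<mu> by simp
          then have "cong \<mu> (mv_coeff \<gamma> k \<mu> ?s) (if j = k then coeff1 \<gamma> \<mu> (\<alpha> + 1) u else 0)"
            by (rule cong_trans[OF \<mu> mv_coeff_single])
          ultimately show ?thesis
            using cong_trans[OF \<mu> _ cong_sym[OF \<mu>]] by blast
        qed
        ultimately have "cong \<mu> (mv_coeff \<gamma> k \<mu> s + mv_coeff \<gamma> k \<mu> ?s) (mv_coeff \<gamma> k \<mu> ?s)"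
          by (rule cong_trans[OF \<mu> cong_sym[OF \<mu>]])
        then show "mv_coeff \<gamma> k \<mu> s \<in> M \<mu>" by (simp add: cong_def)
      qed
    qed
  qed
  then show ?thesis by simp
qed

end

lemma mv_rels_add: "s \<in> mv_rels N \<Longrightarrow> t \<in> mv_rels N \<Longrightarrow> s + t \<in> mv_rels N"
  unfolding mv_rels_def by (rule mv.span_add)

lemma mv_rels_shift:
  "Poly_Mapping.single (\<alpha> + of_nat n, k) u - Poly_Mapping.single (\<alpha>, k) (smul (fps_X ^ n) u) \<in> mv_rels N"
proof (induction n arbitrary: u)
  case (Suc n)
  have "Poly_Mapping.single (\<alpha> + of_nat n + 1, k) u -
      Poly_Mapping.single (\<alpha> + of_nat n, k) (smul fps_X u) \<in> mv_rels N"
    unfolding mv_rels_def by (rule mv.span_base) blast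
  moreover have "smul (fps_X ^ n) (smul fps_X u) = smul (fps_X ^ Suc n) u"
    by (simp add: mult.commute)
  moreover have "\<alpha> + of_nat n + 1 = \<alpha> + of_nat (Suc n)" by simp
  ultimately have "(Poly_Mapping.single (\<alpha> + of_nat (Suc n), k) u -
        Poly_Mapping.single (\<alpha> + of_nat n, k) (smul fps_X u)) +
      (Poly_Mapping.single (\<alpha> + of_nat n, k) (smul fps_X u) -
        Poly_Mapping.single (\<alpha>, k) (smul (fps_X ^ Suc n) u)) \<in> mv_rels N"
    using mv_rels_add[OF _ Suc.IH[of "smul fps_X u"]] by (simp only:)
  then show ?case by simp
qed (simp add: mv_rels_def mv.span_zero)

text \<open>Two exponents with the same power of the logarithm that differ by a positive integer can
  be merged modulo the relations, which shrinks the support. Once no such pair is left, each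
  coefficient sees a single term, and \<open>kernel\<close> puts that term into
  \<open>N\<close>.\<close>

lemma coeff_imp_mv_rels:
  assumes "\<And>\<gamma> k \<mu>. \<mu> \<in> P \<Longrightarrow> mv_coeff \<gamma> k \<mu> s \<in> M \<mu>"
  shows "s \<in> mv_rels N"
  using assms
proof (induction "card (Poly_Mapping.keys s)" arbitrary: s rule: less_induct)
  case less
  let ?K = "Poly_Mapping.keys s"
  show ?case
  proof (cases "\<exists>\<alpha> k n. 0 < n \<and> (\<alpha>, k) \<in> ?K \<and> (\<alpha> + of_nat n, k) \<in> ?K")
    case True
    then obtain \<alpha> k n where n: "0 < n" "(\<alpha>, k) \<in> ?K" "(\<alpha> + of_nat n, k) \<in> ?K" by blast
    define u where "u = Poly_Mapping.lookup s (\<alpha> + of_nat n, k)"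
    \<comment> \<open>This relation moves the term at the larger exponent onto the smaller one. Its
      own coefficients lie in \<open>M \<mu>\<close>, so the hypothesis passes to
      \<open>s - t\<close>.\<close>
    define t where "t = Poly_Mapping.single (\<alpha> + of_nat n, k) u -
      Poly_Mapping.single (\<alpha>, k) (smul (fps_X ^ n) u)"
    have t: "t \<in> mv_rels N" unfolding t_def by (rule mv_rels_shift)
    have ne: "\<alpha> \<noteq> \<alpha> + of_nat n" using n(1) by simp
    have "Poly_Mapping.keys (s - t) \<subseteq> ?K - {(\<alpha> + of_nat n, k)}"
      using n(2) ne
      by (auto simp: in_keys_iff lookup_minus t_def lookup_single u_def when_def split: if_splits)
    then have "card (Poly_Mapping.keys (s - t)) < card ?K"
      using n(3) by (meson card_Diff1_less card_mono finite_Diff finite_keys le_less_trans)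
    moreover have "mv_coeff \<gamma> k \<mu> (s - t) \<in> M \<mu>" if \<mu>: "\<mu> \<in> P" for \<gamma> k \<mu>
    proof -
      have "mv_coeff \<gamma> k \<mu> (s - t) + mv_coeff \<gamma> k \<mu> t \<in> M \<mu>"
        using cong_mem[OF \<mu> mv_coeff_add[OF \<mu>, of _ _ "s - t" t]] less.prems[OF \<mu>] by simp
      then show ?thesis
        using smul.subspace_diff[OF sub_M[OF \<mu>] _ mv_rels_imp_coeff[OF \<mu> t, of \<gamma> k]]
        by (metis add_diff_cancel_right')
    qed
    ultimately have "s - t \<in> mv_rels N" by (rule less.hyps)
    then have "s - t + t \<in> mv_rels N" using t by (rule mv_rels_add)
    then show ?thesis by simp
  next
    case False
    have "Poly_Mapping.lookup s (\<alpha>, k) \<in> N" if p: "(\<alpha>, k) \<in> ?K" for \<alpha> k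
    proof -
      have "\<Phi> (Poly_Mapping.lookup s (\<alpha>, k)) \<mu> d \<in> M \<mu>" if \<mu>: "\<mu> \<in> P" for \<mu> d
      proof -
        \<comment> \<open>Another exponent \<beta> could contribute to \<tau>^(\<alpha>+d) only if
          it differed from \<alpha> by an integer, and such pairs are excluded here.\<close>
        have "(if snd q = k then coeff1 (\<alpha> + of_nat d) \<mu> (fst q) (Poly_Mapping.lookup s q) else 0) = 0"
          if q: "q \<in> ?K - {(\<alpha>, k)}" for q
        proof (cases "snd q = k")
          case True
          then obtain \<beta> where \<beta>: "q = (\<beta>, k)" "\<beta> \<noteq> \<alpha>" "(\<beta>, k) \<in> ?K" using q by (cases q) auto
          show ?thesis
          proof (cases rule: coeff1_cases[of "\<alpha> + of_nat d" \<beta>])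
            case (1 j)
            show ?thesis
            proof (cases "d \<le> j")
              case True
              then have "\<alpha> = \<beta> + of_nat (j - d)" using 1 by (simp add: of_nat_diff algebra_simps)
              then show ?thesis using \<beta> p False by (metis add.right_neutral gr0I of_nat_0)
            next
              case d: False
              then have "\<beta> = \<alpha> + of_nat (d - j)" using 1 by (simp add: of_nat_diff algebra_simps)
              then show ?thesis using \<beta> p False d by (metis zero_less_diff not_le)
            qed
          next
            case 2
            then show ?thesis by (simp add: \<beta>)
          qed
        qed simp
        then have "mv_coeff (\<alpha> + of_nat d) k \<mu> s = \<Phi> (Poly_Mapping.lookup s (\<alpha>, k)) \<mu> d"
          unfolding mv_coeff_def by (subst sum.remove[OF _ p]) auto
        then show ?thesis using less.prems[OF \<mu>] by metis
      qed
      then show ?thesis using kernel by blast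
    qed
    then have "Poly_Mapping.single p (Poly_Mapping.lookup s p) \<in> mv_rels N" if "p \<in> ?K" for p
      using that unfolding mv_rels_def by (cases p, intro mv.span_base) blast
    then show ?thesis
      by (subst poly_mapping_sum_singles) (auto simp: mv_rels_def intro: mv.span_sum)
  qed
qed

end

section \<open>Flat multivalued sections and their monodromy\<close>

locale summand_connection = summands e P N M \<Phi>
  for e :: "complex \<Rightarrow> 'r::comm_ring_1" and P :: "'m set"
    and N :: "('w \<Rightarrow>\<^sub>0 'r fps) set" and M :: "'m \<Rightarrow> ('z \<Rightarrow>\<^sub>0 'r) set"
    and \<Phi> :: "('w \<Rightarrow>\<^sub>0 'r fps) \<Rightarrow> 'm \<Rightarrow> nat \<Rightarrow> ('z \<Rightarrow>\<^sub>0 'r)" +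
  fixes \<D> :: "('w \<Rightarrow>\<^sub>0 'r fps) \<Rightarrow> ('w \<Rightarrow>\<^sub>0 'r fps)" and \<chi> :: "'m \<Rightarrow> complex"
  assumes acts: "acts_in_summands e P M \<Phi> \<D> \<chi>"
begin

context
  fixes \<mu> assumes \<mu>: "\<mu> \<in> P"
begin

text \<open>The power \<tau>^\<alpha> contributes \<alpha>, the degree in \<tau> contributes d, and
  \<alpha> + d = \<gamma>. The resulting factor no longer depends on \<alpha>.\<close>

lemma coeff1_nabla:
  "cong \<mu> (coeff1 \<gamma> \<mu> \<alpha> (\<D> u + smul (fps_const (e \<alpha>)) u)) (smul (e (\<gamma> + \<chi> \<mu>)) (coeff1 \<gamma> \<mu> \<alpha> u))"
proof (cases rule: coeff1_cases[of \<gamma> \<alpha>])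
  case (1 d)
  note [trans] = cong_trans[OF \<mu>]
  have "cong \<mu> (\<Phi> (\<D> u + smul (fps_const (e \<alpha>)) u) \<mu> d) (\<Phi> (\<D> u) \<mu> d + \<Phi> (smul (fps_const (e \<alpha>)) u) \<mu> d)"
    using \<Phi>_add[OF \<mu>] by (simp add: cong_def)
  also have "cong \<mu> \<dots> ((smul (of_nat d) (\<Phi> u \<mu> d) + smul (e (\<chi> \<mu>)) (\<Phi> u \<mu> d)) + smul (e \<alpha>) (\<Phi> u \<mu> d))"
    using acts coeff1_smul_const[OF \<mu>, of "\<alpha> + of_nat d" \<alpha>] \<mu>
    by (intro cong_add[OF \<mu>]) (auto simp: acts_in_summands_def cong_def)
  also have "\<dots> = smul (e (\<gamma> + \<chi> \<mu>)) (\<Phi> u \<mu> d)"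
    by (simp add: 1 e_add e_of_nat smul.scale_left_distrib)
  finally show ?thesis by (simp add: 1)
qed (simp add: \<mu>)

text \<open>The second summand comes from differentiating (log \<tau>)^(k+1).\<close>

lemma mv_coeff_nabla:
  "cong \<mu> (mv_coeff \<gamma> k \<mu> (mv_nabla e \<D> s))
    (smul (e (\<gamma> + \<chi> \<mu>)) (mv_coeff \<gamma> k \<mu> s) + smul (of_nat (Suc k)) (mv_coeff \<gamma> (Suc k) \<mu> s))"
proof -
  note [trans] = cong_trans[OF \<mu>]
  let ?K = "Poly_Mapping.keys s"
  let ?u = "\<lambda>p. Poly_Mapping.lookup s p"
  let ?f = "\<lambda>p. Poly_Mapping.single p (\<D> (?u p) + smul (fps_const (e (fst p))) (?u p)) +
     Poly_Mapping.single (fst p, snd p - 1) (smul (of_nat (snd p)) (?u p))"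
  let ?c = "\<lambda>p. coeff1 \<gamma> \<mu> (fst p) (?u p)"
  have "mv_nabla e \<D> s = (\<Sum>p\<in>?K. ?f p)"
    by (simp add: mv_nabla_def case_prod_unfold Let_def)
  then have "cong \<mu> (mv_coeff \<gamma> k \<mu> (mv_nabla e \<D> s)) (\<Sum>p\<in>?K. mv_coeff \<gamma> k \<mu> (?f p))"
    using mv_coeff_sum[OF \<mu>] by simp
  also have "cong \<mu> \<dots> (\<Sum>p\<in>?K.
     (if snd p = k then smul (e (\<gamma> + \<chi> \<mu>)) (?c p) else 0) +
     (if snd p = Suc k then smul (of_nat (Suc k)) (?c p) else 0))"
  proof (rule cong_sum[OF \<mu>])
    fix p assume "p \<in> ?K"
    obtain \<alpha> j where p: "p = (\<alpha>, j)" by (cases p)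
    have "cong \<mu> (mv_coeff \<gamma> k \<mu> (?f p))
       (mv_coeff \<gamma> k \<mu> (Poly_Mapping.single (\<alpha>, j) (\<D> (?u p) + smul (fps_const (e \<alpha>)) (?u p))) +
        mv_coeff \<gamma> k \<mu> (Poly_Mapping.single (\<alpha>, j - 1) (smul (of_nat j) (?u p))))"
      using mv_coeff_add[OF \<mu>] by (simp add: p)
    also have "cong \<mu> \<dots> ((if j = k then coeff1 \<gamma> \<mu> \<alpha> (\<D> (?u p) + smul (fps_const (e \<alpha>)) (?u p)) else 0) +
       (if j - 1 = k then coeff1 \<gamma> \<mu> \<alpha> (smul (of_nat j) (?u p)) else 0))"
      by (intro cong_add[OF \<mu>] mv_coeff_single[OF \<mu>])
    also have "cong \<mu> \<dots> ((if j = k then smul (e (\<gamma> + \<chi> \<mu>)) (?c p) else 0) +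
       (if j = Suc k then smul (of_nat (Suc k)) (?c p) else 0))"
    proof (rule cong_add[OF \<mu>])
      show "cong \<mu> (if j = k then coeff1 \<gamma> \<mu> \<alpha> (\<D> (?u p) + smul (fps_const (e \<alpha>)) (?u p)) else 0)
          (if j = k then smul (e (\<gamma> + \<chi> \<mu>)) (?c p) else 0)"
        using coeff1_nabla cong_refl[OF \<mu>] by (simp add: p)
      have "cong \<mu> (coeff1 \<gamma> \<mu> \<alpha> (smul (of_nat j) (?u p))) (smul (of_nat j) (?c p))"
        using coeff1_smul_const[OF \<mu>, of \<gamma> \<alpha> "of_nat j" "?u p"] by (simp add: p fps_of_nat)
      \<comment> \<open>For j = 0 truncated subtraction leaves the term at logarithmic degree 0, but
        its factor is then 0.\<close>
      then show "cong \<mu> (if j - 1 = k then coeff1 \<gamma> \<mu> \<alpha> (smul (of_nat j) (?u p)) else 0)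
          (if j = Suc k then smul (of_nat (Suc k)) (?c p) else 0)"
        using cong_refl[OF \<mu>] by (cases j) (auto simp: coeff1_0 \<mu>)
    qed
    finally show "cong \<mu> (mv_coeff \<gamma> k \<mu> (?f p)) ((if snd p = k then smul (e (\<gamma> + \<chi> \<mu>)) (?c p) else 0) +
       (if snd p = Suc k then smul (of_nat (Suc k)) (?c p) else 0))"
      by (simp add: p)
  qed
  also have "(\<Sum>p\<in>?K. (if snd p = k then smul (e (\<gamma> + \<chi> \<mu>)) (?c p) else 0) +
     (if snd p = Suc k then smul (of_nat (Suc k)) (?c p) else 0)) =
     smul (e (\<gamma> + \<chi> \<mu>)) (mv_coeff \<gamma> k \<mu> s) + smul (of_nat (Suc k)) (mv_coeff \<gamma> (Suc k) \<mu> s)"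
    unfolding mv_coeff_def sum.distrib smul.scale_sum_right
    by (intro arg_cong2[where f = "(+)"] sum.cong) auto
  finally show ?thesis .
qed

text \<open>The base is only a commutative ring, but nonzero complex scalars become units in
  it.\<close>

lemma mem_of_scale_unit:
  assumes "smul (e a) z \<in> M \<mu>" "a \<noteq> 0"
  shows "z \<in> M \<mu>"
proof -
  have "smul (e (1 / a)) (smul (e a) z) = smul (e (1 / a * a)) z"
    by (simp only: e_mult smul.scale_scale)
  then show ?thesis
    using assms smul.subspace_scale[OF sub_M[OF \<mu>] assms(1), of "e (1 / a)"] by (simp add: e_1)
qed

lemma mv_coeff_eventually_0: "\<exists>n. \<forall>k\<ge>n. mv_coeff \<gamma> k \<mu> s = 0"
proof (intro exI allI impI)
  fix k assume k: "Suc (Max (insert 0 (snd ` Poly_Mapping.keys s))) \<le> k"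
  have "snd p \<noteq> k" if "p \<in> Poly_Mapping.keys s" for p
  proof -
    have "snd p \<le> Max (insert 0 (snd ` Poly_Mapping.keys s))"
      by (intro Max_ge) (use that in auto)
    then show ?thesis using k by simp
  qed
  then show "mv_coeff \<gamma> k \<mu> s = 0"
    unfolding mv_coeff_def by (intro sum.neutral) auto
qed

text \<open>Flatness couples the coefficients at k and k + 1. If \<gamma> + \<chi> = 0, the
  recursion forces every coefficient with a positive power of the logarithm into
  \<open>M \<mu>\<close>. Otherwise one descends from the highest power, dividing by \<gamma> +
  \<chi>.\<close>

lemma flat_section_coeff:
  assumes "flat_section e N \<D> s" and "\<gamma> \<noteq> - \<chi> \<mu> \<or> k \<noteq> 0"
  shows "mv_coeff \<gamma> k \<mu> s \<in> M \<mu>"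
proof -
  note sub = sub_M[OF \<mu>]
  have rec: "smul (e (\<gamma> + \<chi> \<mu>)) (mv_coeff \<gamma> k \<mu> s) +
      smul (e (of_nat (Suc k))) (mv_coeff \<gamma> (Suc k) \<mu> s) \<in> M \<mu>" for k
  proof -
    have "mv_coeff \<gamma> k \<mu> (mv_nabla e \<D> s) \<in> M \<mu>"
      using assms(1) unfolding flat_section_def by (rule mv_rels_imp_coeff[OF \<mu>])
    then show ?thesis unfolding cong_mem[OF \<mu> mv_coeff_nabla] e_of_nat .
  qed
  show ?thesis
  proof (cases "\<gamma> = - \<chi> \<mu>")
    case True
    with assms(2) obtain j where j: "k = Suc j" by (cases k) auto
    have "smul (e (of_nat k)) (mv_coeff \<gamma> k \<mu> s) \<in> M \<mu>"
      using rec[of j] by (simp add: j True e_0 del: of_nat_Suc)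
    then show ?thesis by (rule mem_of_scale_unit) (simp add: j del: of_nat_Suc)
  next
    case False
    obtain n where n: "\<And>k. n \<le> k \<Longrightarrow> mv_coeff \<gamma> k \<mu> s = 0"
      using mv_coeff_eventually_0 by blast
    \<comment> \<open>With truncated subtraction the case m = 0 covers all k from n on, where the
      coefficients are 0.\<close>
    have "\<forall>k. n - k = m \<longrightarrow> mv_coeff \<gamma> k \<mu> s \<in> M \<mu>" for m
    proof (induction m)
      case 0
      then show ?case using n smul.subspace_0[OF sub] by auto
    next
      case (Suc m)
      have "mv_coeff \<gamma> k \<mu> s \<in> M \<mu>" if "n - k = Suc m" for k
      proof -
        have "mv_coeff \<gamma> (Suc k) \<mu> s \<in> M \<mu>" using Suc that by simp
        then have "smul (e (\<gamma> + \<chi> \<mu>)) (mv_coeff \<gamma> k \<mu> s) \<in> M \<mu>"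
          using smul.subspace_diff[OF sub rec[of k]
            smul.subspace_scale[OF sub, of _ "e (of_nat (Suc k))"], of "mv_coeff \<gamma> (Suc k) \<mu> s"] by simp
        then show ?thesis by (rule mem_of_scale_unit) (use False in \<open>simp add: add_eq_0_iff2\<close>)
      qed
      then show ?case by blast
    qed
    then show ?thesis by blast
  qed
qed

text \<open>The monodromy is triangular in the powers of the logarithm. Under the hypothesis only
  the power 0 survives, and there it is multiplication by the phase of \<gamma>.\<close>

lemma mv_coeff_monodromy:
  assumes coeff: "\<And>\<gamma> k. \<gamma> \<noteq> - \<chi> \<mu> \<or> k \<noteq> 0 \<Longrightarrow> mv_coeff \<gamma> k \<mu> s \<in> M \<mu>"
  shows "cong \<mu> (mv_coeff \<gamma> j \<mu> (monodromy e s))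
    (smul (e (exp (2 * of_real pi * \<i> * \<gamma>))) (mv_coeff \<gamma> j \<mu> s))"
proof -
  note sub = sub_M[OF \<mu>]
  note [trans] = cong_trans[OF \<mu>]
  let ?K = "Poly_Mapping.keys s"
  let ?c = "\<lambda>p. coeff1 \<gamma> \<mu> (fst p) (Poly_Mapping.lookup s p)"
  let ?b = "\<lambda>k j. of_nat (k choose j) * (2 * of_real pi * \<i>) ^ (k - j) :: complex"
  let ?f = "\<lambda>p i. Poly_Mapping.single (fst p, i)
      (smul (fps_const (e (exp (2 * of_real pi * \<i> * fst p) * ?b (snd p) i))) (Poly_Mapping.lookup s p))"
  define w where "w k = (if j \<le> k then e (exp (2 * of_real pi * \<i> * \<gamma>) * ?b k j) else 0)" for k
  define n where "n = Max (insert 0 (snd ` ?K))"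
  have n: "snd p \<le> n" if "p \<in> ?K" for p
    unfolding n_def by (intro Max_ge) (use that in auto)
  have "monodromy e s = (\<Sum>p\<in>?K. \<Sum>i\<le>snd p. ?f p i)"
    by (simp add: monodromy_def case_prod_unfold mult.assoc)
  then have "cong \<mu> (mv_coeff \<gamma> j \<mu> (monodromy e s)) (\<Sum>p\<in>?K. mv_coeff \<gamma> j \<mu> (\<Sum>i\<le>snd p. ?f p i))"
    using mv_coeff_sum[OF \<mu>] by simp
  also have "cong \<mu> \<dots> (\<Sum>p\<in>?K. smul (w (snd p)) (?c p))"
  proof (rule cong_sum[OF \<mu>])
    fix p assume "p \<in> ?K"
    have "cong \<mu> (mv_coeff \<gamma> j \<mu> (\<Sum>i\<le>snd p. ?f p i)) (\<Sum>i\<le>snd p. mv_coeff \<gamma> j \<mu> (?f p i))"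
      by (rule mv_coeff_sum[OF \<mu>])
    also have "cong \<mu> \<dots> (\<Sum>i\<le>snd p. if i = j then smul (w (snd p)) (?c p) else 0)"
    proof (rule cong_sum[OF \<mu>])
      fix i assume i: "i \<in> {..snd p}"
      have "cong \<mu> (mv_coeff \<gamma> j \<mu> (?f p i)) (if i = j then coeff1 \<gamma> \<mu> (fst p)
          (smul (fps_const (e (exp (2 * of_real pi * \<i> * fst p) * ?b (snd p) i))) (Poly_Mapping.lookup s p)) else 0)"
        by (rule mv_coeff_single[OF \<mu>])
      also have "cong \<mu> \<dots> (if i = j then
          smul (e (exp (2 * of_real pi * \<i> * fst p) * ?b (snd p) i)) (?c p) else 0)"
        using coeff1_smul_const[OF \<mu>] cong_refl[OF \<mu>] by simp
      \<comment> \<open>If the term contributes at all, its exponent differs from \<gamma> by an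
        integer, so its phase is that of \<gamma>.\<close>
      also have "\<dots> = (if i = j then smul (w (snd p)) (?c p) else 0)"
      proof (cases rule: coeff1_cases[of \<gamma> "fst p"])
        case (1 d)
        then show ?thesis using i by (auto simp: w_def exp_shift_of_nat)
      qed simp
      finally show "cong \<mu> (mv_coeff \<gamma> j \<mu> (?f p i)) (if i = j then smul (w (snd p)) (?c p) else 0)" .
    qed
    also have "(\<Sum>i\<le>snd p. if i = j then smul (w (snd p)) (?c p) else 0) = smul (w (snd p)) (?c p)"
      by (auto simp: w_def)
    finally show "cong \<mu> (mv_coeff \<gamma> j \<mu> (\<Sum>i\<le>snd p. ?f p i)) (smul (w (snd p)) (?c p))" .
  qed
  also have "(\<Sum>p\<in>?K. smul (w (snd p)) (?c p)) =
      (\<Sum>p\<in>?K. \<Sum>k\<le>n. if snd p = k then smul (w k) (?c p) else 0)"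
    by (intro sum.cong refl) (simp add: n)
  also have "\<dots> = (\<Sum>k\<le>n. smul (w k) (mv_coeff \<gamma> k \<mu> s))"
    unfolding mv_coeff_def smul.scale_sum_right
    by (subst sum.swap) (intro sum.cong refl, auto)
  also have "cong \<mu> \<dots> (\<Sum>k\<le>n. if k = 0 then smul (w 0) (mv_coeff \<gamma> 0 \<mu> s) else 0)"
    using coeff smul.subspace_scale[OF sub] cong_refl[OF \<mu>]
    by (intro cong_sum[OF \<mu>]) (auto simp: cong_0_iff \<mu>)
  also have "\<dots> = smul (w 0) (mv_coeff \<gamma> 0 \<mu> s)"
    by simp
  \<comment> \<open>For j > 0 the left side is 0 because \<open>w 0\<close> is 0, and the right side
    lies in \<open>M \<mu>\<close> by hypothesis.\<close>
  also have "cong \<mu> \<dots> (smul (e (exp (2 * of_real pi * \<i> * \<gamma>))) (mv_coeff \<gamma> j \<mu> s))"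
  proof (cases "j = 0")
    case False
    then have "smul (e (exp (2 * of_real pi * \<i> * \<gamma>))) (mv_coeff \<gamma> j \<mu> s) \<in> M \<mu>"
      by (intro smul.subspace_scale[OF sub] coeff) simp
    then show ?thesis
      using False smul.subspace_neg[OF sub] by (simp add: w_def cong_def)
  qed (simp add: w_def \<mu>)
  finally show ?thesis .
qed

text \<open>One turn only rescales the coefficients modulo \<open>M \<mu>\<close>, so the vanishing
  hypothesis is inherited and the previous lemma can be iterated.\<close>

lemma mv_coeff_monodromy_funpow:
  assumes coeff: "\<And>\<gamma> k. \<gamma> \<noteq> - \<chi> \<mu> \<or> k \<noteq> 0 \<Longrightarrow> mv_coeff \<gamma> k \<mu> s \<in> M \<mu>"
  shows "cong \<mu> (mv_coeff \<gamma> j \<mu> ((monodromy e ^^ n) s))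
    (smul (e (exp (2 * of_real pi * \<i> * \<gamma>) ^ n)) (mv_coeff \<gamma> j \<mu> s))"
proof (induction n arbitrary: \<gamma> j)
  case (Suc n)
  note [trans] = cong_trans[OF \<mu>]
  let ?q = "exp (2 * of_real pi * \<i> * \<gamma>)"
  have "mv_coeff \<gamma> k \<mu> ((monodromy e ^^ n) s) \<in> M \<mu>" if "\<gamma> \<noteq> - \<chi> \<mu> \<or> k \<noteq> 0" for \<gamma> k
    using cong_mem[OF \<mu> Suc] smul.subspace_scale[OF sub_M[OF \<mu>] coeff[OF that]] by simp
  then have "cong \<mu> (mv_coeff \<gamma> j \<mu> (monodromy e ((monodromy e ^^ n) s)))
      (smul (e ?q) (mv_coeff \<gamma> j \<mu> ((monodromy e ^^ n) s)))"
    by (rule mv_coeff_monodromy)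
  also have "cong \<mu> \<dots> (smul (e ?q) (smul (e (?q ^ n)) (mv_coeff \<gamma> j \<mu> s)))"
    by (intro cong_smul[OF \<mu>] Suc)
  finally show ?case by (simp add: e_mult)
qed (simp add: e_1 \<mu>)

lemma mv_coeff_diff: "cong \<mu> (mv_coeff \<gamma> k \<mu> (s - t)) (mv_coeff \<gamma> k \<mu> s - mv_coeff \<gamma> k \<mu> t)"
proof -
  have "cong \<mu> (mv_coeff \<gamma> k \<mu> s) (mv_coeff \<gamma> k \<mu> (s - t) + mv_coeff \<gamma> k \<mu> t)"
    using mv_coeff_add[OF \<mu>, of \<gamma> k "s - t" t] by simp
  then have "cong \<mu> (mv_coeff \<gamma> k \<mu> s - mv_coeff \<gamma> k \<mu> t) (mv_coeff \<gamma> k \<mu> (s - t))"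
    by (simp add: cong_def algebra_simps)
  then show ?thesis by (rule cong_sym[OF \<mu>])
qed

end

text \<open>A flat section may have components in many summands, with different phases. The
  comparison is made in each summand separately, and the common n makes every phase trivial.\<close>

theorem monodromy_finite_order:
  assumes "flat_section e N \<D> s" and n: "\<And>\<mu>. \<mu> \<in> P \<Longrightarrow> exp (- (2 * of_real pi * \<i> * \<chi> \<mu>)) ^ n = 1"
  shows "(monodromy e ^^ n) s - s \<in> mv_rels N"
proof (rule coeff_imp_mv_rels)
  fix \<gamma> k \<mu> assume \<mu>: "\<mu> \<in> P"
  note coeff = flat_section_coeff[OF \<mu> assms(1)]
  have *: "cong \<mu> (mv_coeff \<gamma> k \<mu> ((monodromy e ^^ n) s))
      (smul (e (exp (2 * of_real pi * \<i> * \<gamma>) ^ n)) (mv_coeff \<gamma> k \<mu> s))"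
    by (rule mv_coeff_monodromy_funpow[OF \<mu> coeff])
  have "cong \<mu> (mv_coeff \<gamma> k \<mu> ((monodromy e ^^ n) s)) (mv_coeff \<gamma> k \<mu> s)"
  proof (cases "\<gamma> \<noteq> - \<chi> \<mu> \<or> k \<noteq> 0")
    case True
    then have "mv_coeff \<gamma> k \<mu> s \<in> M \<mu>" by (rule coeff)
    moreover have "mv_coeff \<gamma> k \<mu> ((monodromy e ^^ n) s) \<in> M \<mu>"
      unfolding cong_mem[OF \<mu> *] by (intro smul.subspace_scale[OF sub_M[OF \<mu>]] coeff True)
    ultimately show ?thesis by (simp add: cong_def smul.subspace_diff[OF sub_M[OF \<mu>]])
  next
    case False
    then show ?thesis using * n[OF \<mu>] by (simp add: e_1)
  qed
  then show "mv_coeff \<gamma> k \<mu> ((monodromy e ^^ n) s - s) \<in> M \<mu>"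
    unfolding cong_mem[OF \<mu> mv_coeff_diff[OF \<mu>]] by (simp add: cong_def)
qed

text \<open>In the other summands all coefficients lie in \<open>M\<close>, where any scalar will
  do. In the summand of \<mu> only the exponent -\<chi> \<mu> can survive, and its phase is the
  asserted scalar.\<close>

theorem monodromy_in_summand:
  assumes "flat_section e N \<D> s" and \<mu>: "\<mu> \<in> P" and "in_summand P M \<Phi> \<mu> s"
  shows "monodromy e s - mv_scale e (exp (- (2 * of_real pi * \<i> * \<chi> \<mu>))) s \<in> mv_rels N"
proof (rule coeff_imp_mv_rels)
  fix \<gamma> k \<rho> assume \<rho>: "\<rho> \<in> P"
  let ?z = "exp (- (2 * of_real pi * \<i> * \<chi> \<mu>))"
  let ?t = "mv_scale e ?z s"
  note coeff = flat_section_coeff[OF \<rho> assms(1)]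
  note sub = sub_M[OF \<rho>]
  have 1: "cong \<rho> (mv_coeff \<gamma> k \<rho> (monodromy e s))
      (smul (e (exp (2 * of_real pi * \<i> * \<gamma>))) (mv_coeff \<gamma> k \<rho> s))"
    by (rule mv_coeff_monodromy[OF \<rho> coeff])
  obtain n where n: "cong \<rho> (mv_coeff \<gamma> k \<rho> ?t)
      (\<Sum>i\<le>n. smul (fps_nth (fps_const (e ?z)) i) (mv_coeff (\<gamma> - of_nat i) k \<rho> s))"
    using mv_coeff_smul[OF \<rho>] unfolding mv_scale_def by blast
  have "(\<Sum>i\<le>n. smul (fps_nth (fps_const (e ?z)) i) (mv_coeff (\<gamma> - of_nat i) k \<rho> s)) =
      smul (e ?z) (mv_coeff \<gamma> k \<rho> s)"
    by (subst sum.remove[of _ 0]) auto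
  with n have 2: "cong \<rho> (mv_coeff \<gamma> k \<rho> ?t) (smul (e ?z) (mv_coeff \<gamma> k \<rho> s))"
    by simp
  have "cong \<rho> (mv_coeff \<gamma> k \<rho> (monodromy e s)) (mv_coeff \<gamma> k \<rho> ?t)"
  proof (cases "mv_coeff \<gamma> k \<rho> s \<in> M \<rho>")
    case True
    then show ?thesis
      using cong_mem[OF \<rho> 1] cong_mem[OF \<rho> 2] smul.subspace_scale[OF sub]
      by (simp add: cong_def smul.subspace_diff[OF sub])
  next
    case False
    have "\<rho> = \<mu>"
    proof (rule ccontr)
      assume "\<rho> \<noteq> \<mu>"
      then have "mv_coeff \<gamma> k \<rho> s \<in> M \<rho>"
        unfolding mv_coeff_def using assms(3) \<rho> smul.subspace_0[OF sub]
        by (intro smul.subspace_sum[OF sub]) (auto simp: in_summand_def coeff1_def)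
      with False show False ..
    qed
    moreover have "\<gamma> = - \<chi> \<rho>" using coeff False by blast
    ultimately have "exp (2 * of_real pi * \<i> * \<gamma>) = ?z" by simp
    then show ?thesis
      using cong_trans[OF \<rho> 1] cong_sym[OF \<rho> 2] by simp
  qed
  then show "mv_coeff \<gamma> k \<rho> (monodromy e s - ?t) \<in> M \<rho>"
    unfolding cong_mem[OF \<rho> mv_coeff_diff[OF \<rho>]] by (simp add: cong_def)
qed

end

section \<open>Eigenvectors\<close>

context vector_space
begin

lemma eigenvectors_independent:
  assumes T: "Vector_Spaces.linear scale scale T" and "finite A"
    and f: "\<And>a. a \<in> A \<Longrightarrow> f a \<noteq> 0 \<and> T (f a) = scale a (f a)"
    and "(\<Sum>a\<in>A. scale (c a) (f a)) = 0" and "a \<in> A"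
  shows "c a = 0"
  using assms(2-)
proof (induction A arbitrary: c a rule: finite_induct)
  case (insert x A)
  interpret T: Vector_Spaces.linear scale scale T by (rule T)
  have "T (\<Sum>a\<in>insert x A. scale (c a) (f a)) = (\<Sum>a\<in>insert x A. scale (c a) (scale a (f a)))"
    by (auto simp: T.sum T.scale insert.prems(1) intro!: sum.cong)
  moreover have "T (\<Sum>a\<in>insert x A. scale (c a) (f a)) = 0"
    by (simp only: insert.prems(2) T.zero)
  ultimately have *: "(\<Sum>a\<in>insert x A. scale (c a * a) (f a)) = 0" by simp
  \<comment> \<open>Applying T - x to the relation removes the term of x and multiplies each
    remaining coefficient by the nonzero number a - x.\<close>
  have "(\<Sum>a\<in>A. scale (c a * (a - x)) (f a)) = (\<Sum>a\<in>insert x A. scale (c a * (a - x)) (f a))"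
    using insert.hyps by simp
  also have "\<dots> = (\<Sum>a\<in>insert x A. scale (c a * a) (f a)) - scale x (\<Sum>a\<in>insert x A. scale (c a) (f a))"
    by (simp only: scale_sum_right sum_subtractf [symmetric] scale_scale scale_left_diff_distrib
        right_diff_distrib mult.commute)
  also have "\<dots> = 0"
    unfolding * insert.prems(2) by simp
  finally have "(\<Sum>a\<in>A. scale (c a * (a - x)) (f a)) = 0" .
  then have A: "c a * (a - x) = 0" if "a \<in> A" for a
    using insert.IH[of "\<lambda>a. c a * (a - x)" a] insert.prems(1) that by blast
  have cA: "c a = 0" if "a \<in> A" for a
    using A[OF that] insert.hyps that by auto
  then have "(\<Sum>a\<in>insert x A. scale (c a) (f a)) = scale (c x) (f x)"
    using insert.hyps by simp
  then have "c x = 0" using insert.prems(1,2) by simp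
  then show ?case using cA insert.prems(3) by auto
qed simp

text \<open>Both the termination of root strings and the existence of highest weights rest on this
  finiteness. The ambient space may be infinite dimensional; only F lies in a finite span.\<close>

lemma finite_eigenvalues:
  assumes T: "Vector_Spaces.linear scale scale T" and "finite B" "F \<subseteq> span B"
  shows "finite {a. \<exists>v\<in>F. v \<noteq> 0 \<and> T v = scale a v}"
proof (rule ccontr)
  assume "infinite {a. \<exists>v\<in>F. v \<noteq> 0 \<and> T v = scale a v}"
  from infinite_arbitrarily_large[OF this, of "Suc (card B)"]
  obtain A where A: "finite A" "card A = Suc (card B)" "A \<subseteq> {a. \<exists>v\<in>F. v \<noteq> 0 \<and> T v = scale a v}"
    by blast
  then have "\<forall>a\<in>A. \<exists>v. v \<in> F \<and> v \<noteq> 0 \<and> T v = scale a v" by blast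
  then obtain f where f: "\<And>a. a \<in> A \<Longrightarrow> f a \<in> F \<and> f a \<noteq> 0 \<and> T (f a) = scale a (f a)"
    using bchoice[of A "\<lambda>a v. v \<in> F \<and> v \<noteq> 0 \<and> T v = scale a v"] by auto
  have inj: "inj_on f A"
  proof (rule inj_onI)
    fix a b assume ab: "a \<in> A" "b \<in> A" "f a = f b"
    then have "scale a (f a) = scale b (f a)" using f[OF ab(1)] f[OF ab(2)] ab(3) by metis
    then show "a = b" using f[OF ab(1)] scale_cancel_right by blast
  qed
  have "independent (f ` A)"
  proof
    assume "dependent (f ` A)"
    then obtain u where u: "\<exists>a\<in>A. u (f a) \<noteq> 0" "(\<Sum>v\<in>f ` A. scale (u v) v) = 0"
      using A(1) by (auto simp: dependent_finite)
    from u(2) have "(\<Sum>a\<in>A. scale (u (f a)) (f a)) = 0"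
      by (simp add: sum.reindex[OF inj])
    then show False
      using eigenvectors_independent[OF T A(1) conjunct2[OF f], where c = "\<lambda>a. u (f a)"] u(1) by blast
  qed
  moreover have "f ` A \<subseteq> span B" using f assms(3) by auto
  ultimately have "card (f ` A) \<le> card B"
    using independent_span_bound[OF assms(2)] by blast
  then show False using A(2) card_image[OF inj] by simp
qed

end

section \<open>Existence of eigenvectors through polynomials in an operator\<close>

definition poly_op :: "(complex \<Rightarrow> 'v \<Rightarrow> 'v::ab_group_add) \<Rightarrow> ('v \<Rightarrow> 'v) \<Rightarrow> complex poly \<Rightarrow> 'v \<Rightarrow> 'v" where
  "poly_op s T p v = (\<Sum>i\<le>Polynomial.degree p. s (Polynomial.coeff p i) ((T ^^ i) v))"

context
  fixes s :: "complex \<Rightarrow> 'v::ab_group_add \<Rightarrow> 'v" and T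
  assumes T: "Vector_Spaces.linear s s T"
begin

interpretation T: Vector_Spaces.linear s s T by (rule T)

lemma poly_op_eq:
  assumes "Polynomial.degree p \<le> n"
  shows "poly_op s T p v = (\<Sum>i\<le>n. s (Polynomial.coeff p i) ((T ^^ i) v))"
  unfolding poly_op_def using assms
  by (intro sum.mono_neutral_left) (auto simp: coeff_eq_0)

lemma poly_op_linear_factor:
  "poly_op s T ([:- a, 1:] * q) v = T (poly_op s T q v) - s a (poly_op s T q v)"
proof -
  define n where "n = Polynomial.degree q"
  let ?c = "Polynomial.coeff"
  have "Polynomial.degree ([:- a, 1:] * q) \<le> Suc n"
    using degree_mult_le[of "[:- a, 1:]" q] by (simp add: n_def)
  then have "poly_op s T ([:- a, 1:] * q) v = (\<Sum>i\<le>Suc n. s (?c ([:- a, 1:] * q) i) ((T ^^ i) v))"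
    by (rule poly_op_eq)
  also have "\<dots> = (\<Sum>i\<le>Suc n. s (?c (pCons 0 q) i) ((T ^^ i) v)) - (\<Sum>i\<le>Suc n. s a (s (?c q i) ((T ^^ i) v)))"
    by (simp only: sum_subtractf [symmetric] T.vs1.scale_scale T.vs1.scale_left_diff_distrib [symmetric])
      (simp add: algebra_simps)
  also have "(\<Sum>i\<le>Suc n. s a (s (?c q i) ((T ^^ i) v))) = s a (poly_op s T q v)"
    by (subst poly_op_eq[of q "Suc n"]) (simp_all add: n_def T.vs1.scale_sum_right T.vs1.scale_right_distrib)
  also have "(\<Sum>i\<le>Suc n. s (?c (pCons 0 q) i) ((T ^^ i) v)) = (\<Sum>i\<le>n. s (?c q i) (T ((T ^^ i) v)))"
    by (subst sum.atMost_Suc_shift) simp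
  also have "\<dots> = T (poly_op s T q v)"
    by (simp add: poly_op_def n_def T.sum T.scale)
  finally show ?thesis .
qed

lemma poly_op_annihilator:
  assumes "finite B" "F \<subseteq> T.vs1.span B" "v \<in> F" and inv: "\<And>w. w \<in> F \<Longrightarrow> T w \<in> F"
  shows "\<exists>p. p \<noteq> 0 \<and> poly_op s T p v = 0"
proof -
  define n where "n = card B"
  let ?f = "\<lambda>i. (T ^^ i) v"
  have F: "?f i \<in> F" for i using assms(3) inv by (induction i) auto
  show ?thesis
  \<comment> \<open>Linear dependence is a property of sets and does not see repetitions. If two
    powers of T agree on v, the difference of the two monomials annihilates v; otherwise n + 1
    distinct vectors in a span of n vectors are dependent.\<close>
  proof (cases "inj_on ?f {..n}")
    case False
    then obtain i j where ij: "i \<noteq> j" "?f i = ?f j" by (auto simp: inj_on_def)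
    let ?p = "monom 1 i - monom (1 :: complex) j"
    have "Polynomial.degree ?p \<le> max i j"
      by (intro degree_diff_le) (auto intro: order.trans[OF degree_monom_le])
    then have "poly_op s T ?p v = (\<Sum>k\<le>max i j. s (Polynomial.coeff ?p k) (?f k))"
      by (rule poly_op_eq)
    also have "\<dots> = (\<Sum>k\<le>max i j. (if k = i then ?f k else 0) - (if k = j then ?f k else 0))"
      by (intro sum.cong) (auto simp: T.vs1.scale_left_diff_distrib)
    also have "\<dots> = 0" using ij by (simp add: sum_subtractf)
    finally have "poly_op s T ?p v = 0" .
    moreover have "Polynomial.coeff ?p i \<noteq> 0" using ij by simp
    ultimately show ?thesis by (metis coeff_0)
  next
    case True
    have "\<not> T.vs1.independent (?f ` {..n})"
    proof
      assume "T.vs1.independent (?f ` {..n})"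
      then have "card (?f ` {..n}) \<le> card B"
        using T.vs1.independent_span_bound[OF assms(1)] F assms(2) by blast
      then show False using card_image[OF True] by (simp add: n_def)
    qed
    then obtain u where u: "\<exists>i\<le>n. u (?f i) \<noteq> 0" "(\<Sum>w\<in>?f ` {..n}. s (u w) w) = 0"
      by (auto simp: T.vs1.dependent_finite)
    define p where "p = (\<Sum>i\<le>n. monom (u (?f i)) i)"
    have c: "Polynomial.coeff p i = (if i \<le> n then u (?f i) else 0)" for i
      by (auto simp: p_def coeff_sum)
    then have "Polynomial.degree p \<le> n" by (intro degree_le) auto
    then have "poly_op s T p v = (\<Sum>i\<le>n. s (u (?f i)) (?f i))"
      by (subst poly_op_eq) (auto simp: c)
    also have "\<dots> = 0" using u(2) by (simp add: sum.reindex[OF True])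
    finally show ?thesis using u(1) c by (metis coeff_0)
  qed
qed

text \<open>Split a linear factor [:- a, 1:] off an annihilating polynomial of minimal degree. By
  minimality the cofactor does not annihilate v, and its value at v is an eigenvector for a.\<close>

lemma eigenvector_exists:
  assumes "finite B" "F \<subseteq> T.vs1.span B" "v \<in> F" "v \<noteq> 0"
    and inv: "\<And>w. w \<in> F \<Longrightarrow> T w \<in> F" and sub: "T.vs1.subspace F"
  shows "\<exists>w\<in>F. \<exists>a. w \<noteq> 0 \<and> T w = s a w"
proof -
  let ?Q = "\<lambda>p. p \<noteq> 0 \<and> poly_op s T p v = 0"
  obtain p where p: "?Q p" "\<And>q. ?Q q \<Longrightarrow> Polynomial.degree p \<le> Polynomial.degree q"
    using exists_least_lemma[of "\<lambda>n. \<exists>p. ?Q p \<and> Polynomial.degree p = n"]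
      poly_op_annihilator[OF assms(1-3) inv] ex_has_least_nat[of ?Q _ Polynomial.degree] by metis
  have "Polynomial.degree p \<noteq> 0"
  proof
    assume "Polynomial.degree p = 0"
    then obtain c where "p = [:c:]" by (rule degree_eq_zeroE)
    then show False using p(1) assms(4) by (auto simp: poly_op_def)
  qed
  then obtain a where "poly p a = 0"
    using fundamental_theorem_of_algebra[of p] by (auto simp: constant_degree)
  then obtain q where q: "p = [:- a, 1:] * q" using poly_eq_0_iff_dvd by (metis dvdE)
  then have q0: "q \<noteq> 0" using p(1) by auto
  then have "Polynomial.degree p = Suc (Polynomial.degree q)"
    unfolding q by (subst degree_mult_eq) auto
  then have "poly_op s T q v \<noteq> 0" using p(2)[of q] q0 by auto
  moreover have "T (poly_op s T q v) = s a (poly_op s T q v)"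
    using p(1) poly_op_linear_factor[of a q v] q by simp
  moreover have "(T ^^ i) v \<in> F" for i using assms(3) inv by (induction i) auto
  then have "poly_op s T q v \<in> F"
    unfolding poly_op_def by (intro T.vs1.subspace_sum[OF sub] T.vs1.subspace_scale[OF sub])
  ultimately show ?thesis by blast
qed

end

lemma common_denominator:
  assumes "finite S" "S \<subseteq> (\<rat> :: complex set)"
  shows "\<exists>n>0. \<forall>q\<in>S. of_nat n * q \<in> \<int>"
  using assms
proof (induction S rule: finite_induct)
  case (insert q S)
  then obtain n where n: "n > 0" "\<forall>q\<in>S. of_nat n * q \<in> \<int>" by auto
  obtain a b :: int where ab: "q = of_int a / of_int b" "b > 0"
    using insert.prems by (auto elim: Rats_cases')
  have "of_nat (n * nat b) * q = of_int (int n * a)" using ab by simp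
  moreover have "of_nat (n * nat b) * r \<in> \<int>" if "r \<in> S" for r
  proof -
    have "of_nat (n * nat b) * r = of_nat (nat b) * (of_nat n * r)" by simp
    then show ?thesis using n(2) that by (metis Ints_mult Ints_of_nat)
  qed
  ultimately show ?case using n(1) ab(2)
    by (intro exI[of _ "n * nat b"]) (auto simp del: of_nat_mult)
qed auto

section \<open>Weights\<close>

text \<open>The representation proper is the invariant subspace F, spanned inside the type by
  finitely many vectors. This form covers the adjoint representation, where F is everything, as well
  as representations by matrices, whose dimension is not encoded in a type.\<close>

locale lie_rep = vector_space s
  for s :: "complex \<Rightarrow> 'v::ab_group_add \<Rightarrow> 'v" +
  fixes L :: "('g::ab_group_add) lie_data" and \<rho> :: "'g \<Rightarrow> 'v \<Rightarrow> 'v" and F G :: "'v set"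
  assumes finite_G: "finite G" and F_span: "F \<subseteq> span G" and F_sub: "subspace F"
    and \<rho>_linear: "Vector_Spaces.linear s s (\<rho> x)"
    and \<rho>_add: "\<rho> (x + y) v = \<rho> x v + \<rho> y v"
    and \<rho>_scale: "\<rho> (lscale L a x) v = s a (\<rho> x v)"
    and \<rho>_brk: "\<rho> (lbrk L x y) v = \<rho> x (\<rho> y v) - \<rho> y (\<rho> x v)"
    and \<rho>_F: "v \<in> F \<Longrightarrow> \<rho> x v \<in> F"
begin

lemma \<rho>_add_right: "\<rho> x (v + w) = \<rho> x v + \<rho> x w"
  and \<rho>_diff_right: "\<rho> x (v - w) = \<rho> x v - \<rho> x w"
  and \<rho>_scale_right: "\<rho> x (s a v) = s a (\<rho> x v)"
  and \<rho>_0_right: "\<rho> x 0 = 0"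
  and \<rho>_sum_right: "\<rho> x (\<Sum>i\<in>I. f i) = (\<Sum>i\<in>I. \<rho> x (f i))"
proof -
  interpret \<rho>: Vector_Spaces.linear s s "\<rho> x" by (rule \<rho>_linear)
  show "\<rho> x (v + w) = \<rho> x v + \<rho> x w" "\<rho> x (v - w) = \<rho> x v - \<rho> x w"
    "\<rho> x (s a v) = s a (\<rho> x v)" "\<rho> x 0 = 0" "\<rho> x (\<Sum>i\<in>I. f i) = (\<Sum>i\<in>I. \<rho> x (f i))"
    by (simp_all add: \<rho>.add \<rho>.diff \<rho>.scale \<rho>.zero \<rho>.sum)
qed

lemma \<rho>_0: "\<rho> 0 v = 0"
  using \<rho>_add[of 0 0 v] by simp

lemma \<rho>_sum: "\<rho> (\<Sum>i\<in>I. f i) v = (\<Sum>i\<in>I. \<rho> (f i) v)"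
  by (induction I rule: infinite_finite_induct) (simp_all add: \<rho>_0 \<rho>_add)

definition weight_space :: "('g \<Rightarrow> complex) \<Rightarrow> 'v set" where
  "weight_space \<eta> = {v \<in> F. \<forall>h\<in>lcartan L. \<rho> h v = s (\<eta> h) v}"

lemma weight_space_raise:
  assumes "x \<in> root_space L \<alpha>" "v \<in> weight_space \<eta>"
  shows "\<rho> x v \<in> weight_space (\<lambda>h. \<eta> h + \<alpha> h)"
proof -
  have "\<rho> h (\<rho> x v) = s (\<eta> h + \<alpha> h) (\<rho> x v)" if h: "h \<in> lcartan L" for h
  proof -
    have "\<rho> h (\<rho> x v) = \<rho> (lbrk L h x) v + \<rho> x (\<rho> h v)" by (simp add: \<rho>_brk)
    then show ?thesis
      using assms h
      by (simp add: root_space_def weight_space_def \<rho>_scale \<rho>_scale_right scale_left_distrib add.commute)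
  qed
  then show ?thesis using assms(2) by (simp add: weight_space_def \<rho>_F)
qed

lemma weight_space_raise_funpow:
  assumes "x \<in> root_space L \<alpha>" "v \<in> weight_space \<eta>"
  shows "(\<rho> x ^^ n) v \<in> weight_space (\<lambda>h. \<eta> h + of_nat n * \<alpha> h)"
proof (induction n)
  case (Suc n)
  then show ?case using weight_space_raise[OF assms(1) Suc] by (simp add: algebra_simps)
qed (use assms in simp)

text \<open>Otherwise \<eta> h + n \<alpha> h would be an eigenvalue of \<open>\<rho> h\<close> for
  every n.\<close>

lemma root_operator_nilpotent:
  assumes "x \<in> root_space L \<alpha>" "v \<in> weight_space \<eta>" "h \<in> lcartan L" "\<alpha> h \<noteq> 0"
  shows "\<exists>n. (\<rho> x ^^ n) v = 0"
proof (rule ccontr)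
  assume *: "\<nexists>n. (\<rho> x ^^ n) v = 0"
  have "range (\<lambda>n. \<eta> h + of_nat n * \<alpha> h) \<subseteq> {a. \<exists>v\<in>F. v \<noteq> 0 \<and> \<rho> h v = s a v}"
    using weight_space_raise_funpow[OF assms(1,2)] * assms(3)
    unfolding weight_space_def by blast
  moreover have "finite {a. \<exists>v\<in>F. v \<noteq> 0 \<and> \<rho> h v = s a v}"
    by (rule finite_eigenvalues[OF \<rho>_linear finite_G F_span])
  moreover have "inj (\<lambda>n. \<eta> h + of_nat n * \<alpha> h)"
    using assms(4) by (auto simp: inj_def)
  ultimately show False
    using finite_subset range_inj_infinite by blast
qed

text \<open>The ladder argument of \<open>sl\<^sub>2\<close>-theory, without normalizing \<open>[x, y]\<close>: if \<open>\<alpha> [x, y] = 0\<close>, it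
  shows that \<open>\<eta> [x, y] = 0\<close>, and otherwise that the weights of the coroot are integers.\<close>

lemma weight_integral:
  assumes x: "x \<in> root_space L \<alpha>" and y: "y \<in> root_space L (\<lambda>h. - \<alpha> h)"
    and t: "lbrk L x y \<in> lcartan L" and h: "h \<in> lcartan L" "\<alpha> h \<noteq> 0"
    and v: "v \<in> weight_space \<eta>" "v \<noteq> 0"
  shows "\<exists>n::int. 2 * \<eta> (lbrk L x y) = of_int n * \<alpha> (lbrk L x y)"
proof -
  let ?t = "lbrk L x y"
  define a where "a = \<alpha> ?t"
  define k where "k = (LEAST k. (\<rho> x ^^ k) v = 0)"
  have k: "(\<rho> x ^^ k) v = 0"
    unfolding k_def by (rule LeastI_ex) (rule root_operator_nilpotent[OF x v(1) h])
  then obtain k' where k': "k = Suc k'" using v(2) by (cases k) auto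
  \<comment> \<open>The last nonzero vector of the x-string through v; it plays the role of a
    highest weight vector.\<close>
  define w where "w = (\<rho> x ^^ k') v"
  have w: "w \<noteq> 0"
    unfolding w_def
    by (rule not_less_Least[where P = "\<lambda>k. (\<rho> x ^^ k) v = 0", folded k_def]) (simp add: k')
  have xw: "\<rho> x w = 0" using k by (simp add: w_def k')
  define \<mu> where "\<mu> = (\<lambda>h. \<eta> h + of_nat k' * \<alpha> h)"
  have ww: "w \<in> weight_space \<mu>"
    unfolding w_def \<mu>_def by (rule weight_space_raise_funpow[OF x v(1)])
  define m where "m = \<mu> ?t"
  \<comment> \<open>Moving x to the right past j copies of y produces one weight of [x, y] per copy,
    and each copy of y lowers that weight by a.\<close>
  define c where "c j = (\<Sum>i<j. m - of_nat i * a)" for j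
  have ladder: "\<rho> x ((\<rho> y ^^ Suc j) w) = s (c (Suc j)) ((\<rho> y ^^ j) w)" for j
  proof (induction j)
    case 0
    have "\<rho> x (\<rho> y w) = \<rho> ?t w" using xw by (simp add: \<rho>_brk \<rho>_0_right)
    then show ?case using ww t by (simp add: weight_space_def c_def m_def)
  next
    case (Suc j)
    have "\<rho> x ((\<rho> y ^^ Suc (Suc j)) w) =
        \<rho> ?t ((\<rho> y ^^ Suc j) w) + \<rho> y (\<rho> x ((\<rho> y ^^ Suc j) w))"
      by (simp add: \<rho>_brk)
    also have "\<rho> ?t ((\<rho> y ^^ Suc j) w) = s (m - of_nat (Suc j) * a) ((\<rho> y ^^ Suc j) w)"
      using weight_space_raise_funpow[OF y ww, of "Suc j"] t
      by (simp add: weight_space_def m_def a_def)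
    also have "\<rho> y (\<rho> x ((\<rho> y ^^ Suc j) w)) = s (c (Suc j)) ((\<rho> y ^^ Suc j) w)"
      by (simp only: Suc) (simp add: \<rho>_scale_right)
    also have "s (m - of_nat (Suc j) * a) ((\<rho> y ^^ Suc j) w) + s (c (Suc j)) ((\<rho> y ^^ Suc j) w) =
        s (c (Suc (Suc j))) ((\<rho> y ^^ Suc j) w)"
      by (simp only: scale_left_distrib [symmetric] c_def sum.lessThan_Suc[of _ "Suc j"] add.commute)
    finally show ?case .
  qed
  define j where "j = (LEAST j. (\<rho> y ^^ j) w = 0)"
  have "\<exists>j. (\<rho> y ^^ j) w = 0"
    by (rule root_operator_nilpotent[OF y ww h(1)]) (use h(2) in simp)
  then have j: "(\<rho> y ^^ j) w = 0" unfolding j_def by (rule LeastI_ex)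
  then obtain j' where j': "j = Suc j'" using w by (cases j) auto
  have "(\<rho> y ^^ j') w \<noteq> 0"
    by (rule not_less_Least[where P = "\<lambda>j. (\<rho> y ^^ j) w = 0", folded j_def]) (simp add: j')
  then have "c (Suc j') = 0" using ladder[of j'] j by (simp add: j' \<rho>_0_right)
  moreover have "2 * c (Suc j) = (1 + of_nat j) * (2 * m - a * of_nat j)" for j
    by (induction j) (simp_all add: c_def algebra_simps)
  ultimately have "(1 + of_nat j') * (2 * m - a * of_nat j') = 0"
    by (metis mult_zero_right)
  moreover have "(1 + of_nat j' :: complex) \<noteq> 0"
    by (metis of_nat_Suc of_nat_neq_0)
  ultimately have "2 * m = a * of_nat j'" by simp
  \<comment> \<open>Climbing k' steps to w raised the weight by k' a, so this amount is subtracted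
    from m = j' a / 2.\<close>
  then have "2 * \<eta> ?t = of_int (int j' - 2 * int k') * a"
    by (simp add: m_def \<mu>_def a_def algebra_simps)
  then show ?thesis unfolding a_def by blast
qed

end

section \<open>Simple Lie algebras\<close>

locale simple_lie =
  fixes L :: "('g::ab_group_add) lie_data" and X :: "'k::finite \<Rightarrow> 'g" and hv :: complex
  assumes simple: "simple_lie_algebra L" and cartan: "cartan_subalgebra L"
    and form: "normalized_form L" and orthonormal: "orthonormal_basis L X"
    and casimir_adjoint: "(\<Sum>k\<in>UNIV. lbrk L (X k) (lbrk L (X k) y)) = lscale L (2 * hv) y"
begin

sublocale g: vector_space "lscale L"
  using simple by (simp add: simple_lie_algebra_def)

lemma brk_linear: "Vector_Spaces.linear (lscale L) (lscale L) (lbrk L x)"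
  and brk_linear_left: "Vector_Spaces.linear (lscale L) (lscale L) (\<lambda>x. lbrk L x y)"
  and brk_self [simp]: "lbrk L x x = 0"
  using simple by (simp_all add: simple_lie_algebra_def)

lemma brk_add_right: "lbrk L x (y + z) = lbrk L x y + lbrk L x z"
  and brk_scale_right: "lbrk L x (lscale L a y) = lscale L a (lbrk L x y)"
  and brk_0_right [simp]: "lbrk L x 0 = 0"
  and brk_add_left: "lbrk L (x + y) z = lbrk L x z + lbrk L y z"
  and brk_scale_left: "lbrk L (lscale L a x) y = lscale L a (lbrk L x y)"
  and brk_0_left [simp]: "lbrk L 0 x = 0"
proof -
  interpret r: Vector_Spaces.linear "lscale L" "lscale L" "lbrk L x" for x by (rule brk_linear)
  interpret l: Vector_Spaces.linear "lscale L" "lscale L" "\<lambda>x. lbrk L x y" for y by (rule brk_linear_left)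
  show "lbrk L x (y + z) = lbrk L x y + lbrk L x z" "lbrk L x (lscale L a y) = lscale L a (lbrk L x y)"
    "lbrk L x 0 = 0" "lbrk L (x + y) z = lbrk L x z + lbrk L y z"
    "lbrk L (lscale L a x) y = lscale L a (lbrk L x y)" "lbrk L 0 x = 0"
    by (rule r.add r.scale r.zero l.add l.scale l.zero)+
qed

lemma brk_anti: "lbrk L x y = - lbrk L y x"
proof -
  have "lbrk L x y + lbrk L y x = lbrk L (x + y) (x + y)"
    by (simp only: brk_add_left brk_add_right) simp
  then have "lbrk L x y + lbrk L y x = 0" by simp
  then show ?thesis by (simp only: eq_neg_iff_add_eq_0)
qed

lemma brk_minus_right: "lbrk L x (- y) = - lbrk L x y"
  using brk_scale_right[of x "-1" y] by simp

lemma jacobi: "lbrk L (lbrk L x y) z = lbrk L x (lbrk L y z) - lbrk L y (lbrk L x z)"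
proof -
  have "lbrk L x (lbrk L y z) + lbrk L y (lbrk L z x) + lbrk L z (lbrk L x y) = 0"
    using simple by (simp add: simple_lie_algebra_def)
  moreover have "lbrk L y (lbrk L z x) = - lbrk L y (lbrk L x z)"
    by (subst brk_anti[of z x]) (rule brk_minus_right)
  moreover have "lbrk L z (lbrk L x y) = - lbrk L (lbrk L x y) z" by (rule brk_anti)
  ultimately show ?thesis by (simp add: algebra_simps)
qed

lemma form_sym: "lform L x y = lform L y x"
  and form_inv: "lform L (lbrk L x y) z = lform L x (lbrk L y z)"
  and form_linear: "Vector_Spaces.linear (lscale L) (*) (lform L x)"
  using form unfolding normalized_form_def by blast+

lemma form_add_right: "lform L x (y + z) = lform L x y + lform L x z"
  and form_scale_right: "lform L x (lscale L a y) = a * lform L x y"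
  and form_0_right [simp]: "lform L x 0 = 0"
  and form_sum_right: "lform L x (\<Sum>i\<in>I. f i) = (\<Sum>i\<in>I. lform L x (f i))"
proof -
  interpret Vector_Spaces.linear "lscale L" "(*)" "lform L x" by (rule form_linear)
  show "lform L x (y + z) = lform L x y + lform L x z" "lform L x (lscale L a y) = a * lform L x y"
    "lform L x 0 = 0" "lform L x (\<Sum>i\<in>I. f i) = (\<Sum>i\<in>I. lform L x (f i))"
    by (rule add scale zero sum)+
qed

lemma form_add_left: "lform L (x + y) z = lform L x z + lform L y z"
  using form_add_right[of z x y] by (simp only: form_sym[of z])

lemma form_scale_left: "lform L (lscale L a x) y = a * lform L x y"
  using form_scale_right[of y a x] by (simp only: form_sym[of y])

lemma form_0_left [simp]: "lform L 0 x = 0"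
  by (subst form_sym) (rule form_0_right)

lemma form_sum_left: "lform L (\<Sum>i\<in>I. f i) x = (\<Sum>i\<in>I. lform L (f i) x)"
  using form_sum_right[of x f I] by (simp only: form_sym[of x])

lemma form_expand: "(\<Sum>k\<in>UNIV. lscale L (lform L x (X k)) (X k)) = x"
proof (rule g.span_induct[of x "range X"])
  show "x \<in> g.span (range X)" using orthonormal by (simp add: orthonormal_basis_def)
  show "g.subspace {x. (\<Sum>k\<in>UNIV. lscale L (lform L x (X k)) (X k)) = x}"
    by (rule g.subspaceI) (simp_all add: form_add_left form_scale_left g.scale_left_distrib sum.distrib
        g.scale_scale [symmetric] g.scale_sum_right [symmetric] del: g.scale_scale)
  fix y assume "y \<in> range X"
  then obtain j where j: "y = X j" by blast
  have "(\<Sum>k\<in>UNIV. lscale L (lform L y (X k)) (X k)) = (\<Sum>k\<in>UNIV. if k = j then X j else 0)"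
    using orthonormal by (intro sum.cong) (auto simp: orthonormal_basis_def j)
  then show "(\<Sum>k\<in>UNIV. lscale L (lform L y (X k)) (X k)) = y" by (simp add: j)
qed

lemma form_nondegenerate:
  assumes "\<And>y. lform L x y = 0"
  shows "x = 0"
  using form_expand[of x] by (simp add: assms)

lemma cartan_subspace: "g.subspace (lcartan L)"
  and cartan_root_space: "root_space L (\<lambda>_. 0) = lcartan L"
  using cartan by (simp_all add: cartan_subalgebra_def)

lemma cartan_commute: "h \<in> lcartan L \<Longrightarrow> h' \<in> lcartan L \<Longrightarrow> lbrk L h h' = 0"
  using cartan_root_space unfolding root_space_def by fastforce

lemma cartanI: "(\<And>h. h \<in> lcartan L \<Longrightarrow> lbrk L h x = 0) \<Longrightarrow> x \<in> lcartan L"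
  using cartan_root_space unfolding root_space_def by fastforce

lemma ideal_trivial:
  "g.subspace I \<Longrightarrow> \<forall>x. \<forall>y\<in>I. lbrk L x y \<in> I \<Longrightarrow> I = {0} \<or> I = UNIV"
  and brk_nontrivial: "\<exists>x y. lbrk L x y \<noteq> 0"
  using simple by (simp_all only: simple_lie_algebra_def)

text \<open>The centre is an ideal, and it is not everything because some bracket is
  nonzero.\<close>

lemma center_trivial:
  assumes "\<And>y. lbrk L z y = 0"
  shows "z = 0"
proof -
  let ?I = "{z. \<forall>y. lbrk L z y = 0}"
  have "g.subspace ?I"
    by (rule g.subspaceI) (simp_all add: brk_add_left brk_scale_left)
  moreover have "lbrk L x y = 0" if "y \<in> ?I" for x y
    using that by (subst brk_anti) simp
  then have "\<forall>x. \<forall>y\<in>?I. lbrk L x y \<in> ?I" by simp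
  ultimately have "?I = {0} \<or> ?I = UNIV" by (rule ideal_trivial)
  moreover have "?I \<noteq> UNIV" using brk_nontrivial by blast
  ultimately show ?thesis using assms by blast
qed

text \<open>The roots become weights of a representation, so that the ladder argument applies to
  them.\<close>

sublocale ad: lie_rep "lscale L" L "lbrk L" UNIV "range X"
proof unfold_locales
  show "UNIV \<subseteq> g.span (range X)" using orthonormal by (simp add: orthonormal_basis_def)
qed (simp_all only: brk_add_left brk_scale_left brk_add_right brk_scale_right jacobi finite_imageI finite g.subspace_UNIV UNIV_I)

lemma weight_basis_exists:
  obtains B where "B \<subseteq> lcartan L \<union> (\<Union>\<alpha>\<in>roots L. root_space L \<alpha>)" "g.independent B" "g.span B = UNIV"
proof -
  obtain B where B: "B \<subseteq> lcartan L \<union> (\<Union>\<alpha>\<in>roots L. root_space L \<alpha>)" "g.independent B"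
    "lcartan L \<union> (\<Union>\<alpha>\<in>roots L. root_space L \<alpha>) \<subseteq> g.span B"
    using g.maximal_independent_subset by blast
  have "g.span (lcartan L \<union> (\<Union>\<alpha>\<in>roots L. root_space L \<alpha>)) \<subseteq> g.span B"
    using B(3) g.span_minimal g.subspace_span by blast
  then have "g.span B = UNIV" using cartan by (auto simp: cartan_subalgebra_def)
  with B that show ?thesis by blast
qed

end

section \<open>A basis of weight vectors, its dual basis and the trace form\<close>

locale weight_basis = simple_lie L X hv
  for L :: "('g::ab_group_add) lie_data" and X :: "'k::finite \<Rightarrow> 'g" and hv :: complex +
  fixes B :: "'g set"
  assumes B_weight: "B \<subseteq> lcartan L \<union> (\<Union>\<alpha>\<in>roots L. root_space L \<alpha>)"
    and B_indep: "g.independent B" and B_span: "g.span B = UNIV"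
begin

lemma finite_B: "finite B"
  using g.independent_span_bound[OF ad.finite_G B_indep] ad.F_span by blast

lemma B_nonzero: "Y \<in> B \<Longrightarrow> Y \<noteq> 0"
  using B_indep g.dependent_zero by blast

abbreviation coord :: "'g \<Rightarrow> 'g \<Rightarrow> complex" where
  "coord \<equiv> g.representation B"

lemma coord_expand: "(\<Sum>Y\<in>B. lscale L (coord x Y) Y) = x"
  using g.sum_representation_eq[OF B_indep _ finite_B] B_span by simp

lemma coord_sum: "coord (\<Sum>i\<in>I. f i) Y = (\<Sum>i\<in>I. coord (f i) Y)"
  using g.representation_sum[OF B_indep, of I f] B_span by simp

lemma coord_scale: "coord (lscale L a x) Y = a * coord x Y"
  using g.representation_scale[OF B_indep, of x a] B_span by simp

lemma coord_basis: "Y' \<in> B \<Longrightarrow> coord Y' Y = (if Y = Y' then 1 else 0)"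
  using g.representation_basis[OF B_indep] by simp

text \<open>Asking for 0 or a root prescribes the values off the Cartan subalgebra, so for nonzero
  \<open>Y\<close> the choice is unique.\<close>

definition wt :: "'g \<Rightarrow> 'g \<Rightarrow> complex" where
  "wt Y = (SOME \<alpha>. (\<alpha> = (\<lambda>_. 0) \<or> \<alpha> \<in> roots L) \<and> Y \<in> root_space L \<alpha>)"

text \<open>The vector that represents the coordinate functional of \<open>Y\<close> under the form,
  as \<open>form_dual\<close> shows.\<close>

definition dual :: "'g \<Rightarrow> 'g" where
  "dual Y = (\<Sum>k\<in>UNIV. lscale L (coord (X k) Y) (X k))"

text \<open>For a root vector this is the coroot up to a factor, scaled so that it represents
  \<open>wt Y\<close> under the form.\<close>

definition cor :: "'g \<Rightarrow> 'g" where
  "cor Y = lbrk L Y (dual Y)"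

text \<open>Several members may share a root; summing over basis vectors instead of roots counts
  multiplicities automatically.\<close>

definition root_basis :: "'g set" where
  "root_basis = {Y \<in> B. wt Y \<noteq> (\<lambda>_. 0)}"

lemma wt_props:
  assumes "Y \<in> B"
  shows "wt Y = (\<lambda>_. 0) \<or> wt Y \<in> roots L" "Y \<in> root_space L (wt Y)"
proof -
  have "\<exists>\<alpha>. (\<alpha> = (\<lambda>_. 0) \<or> \<alpha> \<in> roots L) \<and> Y \<in> root_space L \<alpha>"
    using assms B_weight cartan_root_space by auto
  then have "(wt Y = (\<lambda>_. 0) \<or> wt Y \<in> roots L) \<and> Y \<in> root_space L (wt Y)"
    unfolding wt_def by (rule someI_ex)
  then show "wt Y = (\<lambda>_. 0) \<or> wt Y \<in> roots L" "Y \<in> root_space L (wt Y)" by blast+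
qed

lemma brk_wt: "Y \<in> B \<Longrightarrow> h \<in> lcartan L \<Longrightarrow> lbrk L h Y = lscale L (wt Y h) Y"
  using wt_props(2) by (simp add: root_space_def)

lemma root_basisD:
  assumes "Y \<in> root_basis"
  shows "Y \<in> B" "\<exists>h\<in>lcartan L. wt Y h \<noteq> 0"
proof -
  show Y: "Y \<in> B" using assms by (simp add: root_basis_def)
  have "wt Y \<in> roots L" "wt Y \<noteq> (\<lambda>_. 0)" using wt_props[OF Y] assms by (auto simp: root_basis_def)
  then show "\<exists>h\<in>lcartan L. wt Y h \<noteq> 0" unfolding roots_def by (metis (mono_tags, lifting) ext mem_Collect_eq)
qed

lemma cartan_basis: "Y \<in> B \<Longrightarrow> Y \<notin> root_basis \<Longrightarrow> Y \<in> lcartan L \<and> wt Y h = 0"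
  using wt_props(2)[of Y] cartan_root_space by (auto simp: root_basis_def)

lemma brk_expand:
  assumes "h \<in> lcartan L"
  shows "lbrk L h x = (\<Sum>Y\<in>B. lscale L (coord x Y * wt Y h) Y)"
proof -
  have "lbrk L h x = lbrk L h (\<Sum>Y\<in>B. lscale L (coord x Y) Y)" by (simp only: coord_expand)
  also have "\<dots> = (\<Sum>Y\<in>B. lscale L (coord x Y * wt Y h) Y)"
    unfolding ad.\<rho>_sum_right using assms by (intro sum.cong) (simp_all add: brk_scale_right brk_wt)
  finally show ?thesis .
qed

lemma coord_brk:
  assumes "h \<in> lcartan L" "Y \<in> B"
  shows "coord (lbrk L h x) Y = wt Y h * coord x Y"
proof -
  have "coord (lbrk L h x) Y = (\<Sum>Y'\<in>B. if Y' = Y then coord x Y' * wt Y' h else 0)"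
    unfolding brk_expand[OF assms(1)] coord_sum
    by (intro sum.cong) (auto simp: coord_scale coord_basis)
  then show ?thesis using assms(2) finite_B by simp
qed

lemma form_dual: "lform L (dual Y) x = coord x Y"
proof -
  have "lform L (dual Y) x = (\<Sum>k\<in>UNIV. coord (lscale L (lform L x (X k)) (X k)) Y)"
    by (simp add: dual_def form_sum_left form_scale_left coord_scale form_sym[of x] mult.commute)
  also have "\<dots> = coord x Y" by (simp only: coord_sum [symmetric] form_expand)
  finally show ?thesis .
qed

text \<open>The operator of h is skew for the invariant form, so dual vectors have opposite
  weights.\<close>

lemma brk_dual:
  assumes "Y \<in> B" "h \<in> lcartan L"
  shows "lbrk L h (dual Y) = lscale L (- wt Y h) (dual Y)"
proof -
  have "lform L (lbrk L h (dual Y) + lscale L (wt Y h) (dual Y)) x = 0" for x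
  proof -
    have "lform L (lbrk L h (dual Y)) x = lform L (lscale L (- 1) (lbrk L (dual Y) h)) x"
      by (subst brk_anti) simp
    also have "\<dots> = - coord (lbrk L h x) Y"
      by (simp only: form_scale_left form_inv form_dual) simp
    also have "\<dots> = - (wt Y h * coord x Y)" by (simp only: coord_brk[OF assms(2,1)])
    finally show ?thesis by (simp add: form_add_left form_scale_left form_dual)
  qed
  then have "lbrk L h (dual Y) + lscale L (wt Y h) (dual Y) = 0" by (rule form_nondegenerate)
  then show ?thesis by (simp add: add_eq_0_iff2)
qed

lemma dual_root_space: "Y \<in> B \<Longrightarrow> dual Y \<in> root_space L (\<lambda>h. - wt Y h)"
  using brk_dual by (simp add: root_space_def)

lemma dual_cartan: "Y \<in> B \<Longrightarrow> Y \<notin> root_basis \<Longrightarrow> dual Y \<in> lcartan L"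
  by (rule cartanI) (simp add: brk_dual cartan_basis)

lemma cor_cartan:
  assumes "Y \<in> B"
  shows "cor Y \<in> lcartan L"
proof (rule cartanI)
  fix h assume h: "h \<in> lcartan L"
  have "lbrk L h (cor Y) = lbrk L (lbrk L h Y) (dual Y) + lbrk L Y (lbrk L h (dual Y))"
    unfolding cor_def by (subst jacobi) simp
  also have "\<dots> = lscale L (wt Y h) (cor Y) + lscale L (- wt Y h) (cor Y)"
    by (simp only: brk_wt[OF assms h] brk_dual[OF assms h] brk_scale_left brk_scale_right cor_def)
  finally show "lbrk L h (cor Y) = 0" by simp
qed

text \<open>By invariance ([Y, Y'], h) = (Y, [Y', h]), which is wt(h) times (Y, Y') = 1.\<close>

lemma form_cor:
  assumes "Y \<in> B" "h \<in> lcartan L"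
  shows "lform L (cor Y) h = wt Y h"
proof -
  have "lform L (cor Y) h = lform L Y (lscale L (- 1) (lbrk L h (dual Y)))"
    unfolding cor_def form_inv by (subst brk_anti) simp
  also have "\<dots> = wt Y h * lform L (dual Y) Y"
    unfolding brk_dual[OF assms] form_scale_right by (simp add: form_sym)
  finally show ?thesis using assms by (simp add: form_dual coord_basis)
qed

lemma wt_linear:
  assumes "Y \<in> B" "\<And>i. i \<in> I \<Longrightarrow> f i \<in> lcartan L"
  shows "wt Y (\<Sum>i\<in>I. lscale L (c i) (f i)) = (\<Sum>i\<in>I. c i * wt Y (f i))"
proof -
  have "(\<Sum>i\<in>I. lscale L (c i) (f i)) \<in> lcartan L"
    by (intro g.subspace_sum[OF cartan_subspace] g.subspace_scale[OF cartan_subspace] assms)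
  then have "wt Y (\<Sum>i\<in>I. lscale L (c i) (f i)) = lform L (cor Y) (\<Sum>i\<in>I. lscale L (c i) (f i))"
    by (simp add: form_cor assms(1))
  also have "\<dots> = (\<Sum>i\<in>I. c i * wt Y (f i))"
    unfolding form_sum_right by (intro sum.cong) (simp_all add: form_scale_right form_cor assms)
  finally show ?thesis .
qed

text \<open>Root vectors are orthogonal to the Cartan subalgebra, so a vector of the latter only has
  to be tested against the latter.\<close>

lemma form_cartan_nondegenerate:
  assumes "h \<in> lcartan L" "\<And>h'. h' \<in> lcartan L \<Longrightarrow> lform L h h' = 0"
  shows "h = 0"
proof (rule form_nondegenerate)
  fix x
  have "lform L h Y = 0" if Y: "Y \<in> B" for Y
  proof (cases "Y \<in> root_basis")
    case True
    then obtain h0 where h0: "h0 \<in> lcartan L" "wt Y h0 \<noteq> 0" using root_basisD by blast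
    have "wt Y h0 * lform L h Y = lform L h (lbrk L h0 Y)"
      by (simp add: brk_wt[OF Y h0(1)] form_scale_right)
    also have "\<dots> = 0" by (simp add: form_inv [symmetric] cartan_commute[OF assms(1) h0(1)])
    finally show ?thesis using h0 by simp
  qed (use Y assms cartan_basis in blast)
  then have "lform L h (\<Sum>Y\<in>B. lscale L (coord x Y) Y) = 0"
    by (simp add: form_sum_right form_scale_right)
  then show "lform L h x = 0" by (simp only: coord_expand)
qed

lemma cartan_expand:
  assumes h: "h \<in> lcartan L"
  shows "(\<Sum>Y\<in>B - root_basis. lscale L (coord h Y) Y) = h"
proof -
  have "coord h Y = 0" if Y: "Y \<in> root_basis" for Y
  proof -
    obtain h0 where h0: "h0 \<in> lcartan L" "wt Y h0 \<noteq> 0" using root_basisD[OF Y] by blast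
    have "coord (lbrk L h0 h) Y = 0"
      using coord_scale[of 0 0 Y] by (simp add: cartan_commute[OF h0(1) h])
    then show ?thesis using coord_brk[OF h0(1) root_basisD(1)[OF Y]] h0(2) by simp
  qed
  then have "(\<Sum>Y\<in>B - root_basis. lscale L (coord h Y) Y) = (\<Sum>Y\<in>B. lscale L (coord h Y) Y)"
    using finite_B by (intro sum.mono_neutral_left) auto
  then show ?thesis by (simp only: coord_expand)
qed

lemma weight_integral_basis:
  assumes "lie_rep s L \<rho> F G" "Y \<in> root_basis" "v \<in> lie_rep.weight_space s L \<rho> F \<eta>" "v \<noteq> 0"
  shows "\<exists>n::int. 2 * \<eta> (cor Y) = of_int n * wt Y (cor Y)"
proof -
  interpret V: lie_rep s L \<rho> F G by (rule assms(1))
  obtain h where h: "h \<in> lcartan L" "wt Y h \<noteq> 0" using root_basisD(2)[OF assms(2)] by blast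
  have Y: "Y \<in> B" using root_basisD(1)[OF assms(2)] .
  show ?thesis
    using V.weight_integral[OF wt_props(2)[OF Y] dual_root_space[OF Y] cor_cartan[OF Y, unfolded cor_def]
        h assms(3,4)]
    by (simp add: cor_def)
qed

lemma basis_weight_space: "Y \<in> B \<Longrightarrow> Y \<in> ad.weight_space (wt Y)"
  by (simp add: ad.weight_space_def brk_wt)

text \<open>If the root vanished at its own vector \<open>cor Y\<close>, the ladder argument would
  make all roots vanish there. Then \<open>cor Y\<close> would be central, hence 0, although it
  represents a nonzero functional.\<close>

lemma cor_self_nonzero:
  assumes Y: "Y \<in> root_basis"
  shows "wt Y (cor Y) \<noteq> 0"
proof
  assume 0: "wt Y (cor Y) = 0"
  have YB: "Y \<in> B" using root_basisD(1)[OF Y] .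
  have "wt Y' (cor Y) = 0" if Y': "Y' \<in> B" for Y'
    using weight_integral_basis[OF ad.lie_rep_axioms Y basis_weight_space[OF Y'] B_nonzero[OF Y']] 0
    by auto
  then have "lbrk L (cor Y) x = 0" for x
    by (simp add: brk_expand[OF cor_cartan[OF YB]])
  then have "cor Y = 0" by (rule center_trivial)
  then show False using form_cor[OF YB] root_basisD(2)[OF Y] by auto
qed

text \<open>The right side is the trace of the product of ad h and ad h'. Writing 2 hv as the
  adjoint Casimir and moving one factor across by invariance, one obtains this trace as a
  contraction of the basis with its dual.\<close>

lemma trace_form:
  assumes "h \<in> lcartan L" "h' \<in> lcartan L"
  shows "2 * hv * lform L h h' = (\<Sum>Y\<in>B. wt Y h * wt Y h')"
proof -
  have *: "lbrk L (lbrk L x h) h' = (\<Sum>Y\<in>B. lscale L (coord x Y * (wt Y h * wt Y h')) Y)" for x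
  proof -
    have "lbrk L (lbrk L x h) h' = - lbrk L h' (- lbrk L h x)"
      by (subst brk_anti[of "lbrk L x h"], subst brk_anti[of x]) (rule refl)
    also have "\<dots> = lbrk L h' (lbrk L h x)" by (simp add: brk_minus_right)
    also have "\<dots> = (\<Sum>Y\<in>B. lscale L (coord x Y * (wt Y h * wt Y h')) Y)"
      unfolding brk_expand[OF assms(2), of "lbrk L h x"]
      by (intro sum.cong) (simp_all add: coord_brk[OF assms(1)] mult_ac)
    finally show ?thesis .
  qed
  have "2 * hv * lform L h h' = (\<Sum>k\<in>UNIV. lform L (lbrk L (X k) (lbrk L (X k) h)) h')"
    by (simp only: form_scale_left [symmetric] casimir_adjoint [symmetric] form_sum_left)
  also have "\<dots> = (\<Sum>k\<in>UNIV. \<Sum>Y\<in>B. (wt Y h * wt Y h') * lform L (lscale L (coord (X k) Y) (X k)) Y)"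
    by (simp only: form_inv * form_sum_right form_scale_right form_scale_left mult_ac)
  also have "\<dots> = (\<Sum>Y\<in>B. (wt Y h * wt Y h') * lform L (dual Y) Y)"
    by (subst sum.swap) (simp only: dual_def form_sum_left sum_distrib_left)
  also have "\<dots> = (\<Sum>Y\<in>B. wt Y h * wt Y h')"
    by (intro sum.cong) (simp_all add: form_dual coord_basis)
  finally show ?thesis .
qed

text \<open>Evaluate the trace form at h = h' = \<open>cor Y\<close>. The factor 8 is the 2 of that
  formula times the 4 needed to double both weights, which are then integer multiples of
  \<open>wt Y (cor Y)\<close>.\<close>

lemma cor_norm:
  assumes Y: "Y \<in> root_basis"
  shows "\<exists>n>0. 8 * hv = of_int n * wt Y (cor Y)"
proof -
  let ?a = "wt Y (cor Y)"
  have YB: "Y \<in> B" using root_basisD(1)[OF Y] .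
  note H = cor_cartan[OF YB]
  have "\<forall>Y'\<in>B. \<exists>n::int. 2 * wt Y' (cor Y) = of_int n * ?a"
    using weight_integral_basis[OF ad.lie_rep_axioms Y basis_weight_space B_nonzero] by blast
  then obtain n where n: "\<And>Y'. Y' \<in> B \<Longrightarrow> 2 * wt Y' (cor Y) = of_int (n Y') * ?a"
    using bchoice[of B "\<lambda>Y' n. 2 * wt Y' (cor Y) = of_int n * ?a"] by auto
  \<comment> \<open>The summand of Y itself makes the sum of squares strictly positive.\<close>
  have "2 = (of_int (n Y) :: complex)"
    using n[OF YB] cor_self_nonzero[OF Y] by simp
  then have nY: "n Y = 2" by (metis of_int_eq_iff of_int_numeral)
  have "8 * hv * ?a = 4 * (2 * hv * lform L (cor Y) (cor Y))"
    by (simp add: form_cor[OF YB H])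
  also have "\<dots> = (\<Sum>Y'\<in>B. (2 * wt Y' (cor Y)) * (2 * wt Y' (cor Y)))"
    unfolding trace_form[OF H H] by (simp add: sum_distrib_left mult_ac)
  also have "\<dots> = (\<Sum>Y'\<in>B. of_int (n Y' * n Y') * (?a * ?a))"
    by (intro sum.cong) (simp_all add: n mult_ac)
  also have "\<dots> = of_int (\<Sum>Y'\<in>B. n Y' * n Y') * (?a * ?a)"
    by (simp only: of_int_sum sum_distrib_right)
  finally have "8 * hv = of_int (\<Sum>Y'\<in>B. n Y' * n Y') * ?a"
    using cor_self_nonzero[OF Y] by simp
  moreover have "(\<Sum>Y'\<in>B. n Y' * n Y') > 0"
    using YB nY by (intro sum_pos2[OF finite_B YB]) auto
  ultimately show ?thesis by blast
qed

lemma root_basis_nonempty: "root_basis \<noteq> {}"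
proof
  assume "root_basis = {}"
  then have "B \<subseteq> lcartan L" using cartan_basis by blast
  then have "g.span B \<subseteq> lcartan L" by (rule g.span_minimal[OF _ cartan_subspace])
  then show False using B_span cartan_commute brk_nontrivial by blast
qed

text \<open>Connects the normalization of the form, which speaks of all roots, with the computations
  in the basis; it also shows that there are finitely many roots.\<close>

lemma roots_eq: "roots L = wt ` root_basis"
proof
  show "wt ` root_basis \<subseteq> roots L"
    using wt_props(1) by (auto simp: root_basis_def)
  show "roots L \<subseteq> wt ` root_basis"
  proof
    fix \<alpha> assume \<alpha>: "\<alpha> \<in> roots L"
    have "0 \<in> root_space L \<alpha>" by (simp add: root_space_def)
    then obtain x where x: "x \<in> root_space L \<alpha>" "x \<noteq> 0" using \<alpha> unfolding roots_def by blast
    have "\<exists>Y\<in>B. coord x Y \<noteq> 0"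
    proof (rule ccontr)
      assume "\<not> (\<exists>Y\<in>B. coord x Y \<noteq> 0)"
      then have "(\<Sum>Y\<in>B. lscale L (coord x Y) Y) = 0" by simp
      then show False using x(2) by (simp only: coord_expand)
    qed
    then obtain Y where Y: "Y \<in> B" "coord x Y \<noteq> 0" by blast
    have "wt Y h = \<alpha> h" for h
    proof (cases "h \<in> lcartan L")
      case True
      then have "lbrk L h x = lscale L (\<alpha> h) x" using x(1) by (simp add: root_space_def)
      then have "\<alpha> h * coord x Y = wt Y h * coord x Y"
        using coord_brk[OF True Y(1), of x] by (simp only: coord_scale)
      then show ?thesis using Y(2) by simp
    next
      case False
      then show ?thesis using \<alpha> wt_props(1)[OF Y(1)] by (auto simp: roots_def)
    qed
    then have "wt Y = \<alpha>" by blast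
    moreover have "\<alpha> \<noteq> (\<lambda>_. 0)" using \<alpha> by (simp add: roots_def)
    ultimately show "\<alpha> \<in> wt ` root_basis" using Y(1) by (auto simp: root_basis_def)
  qed
qed

lemma root_norm_wt:
  assumes "Y \<in> B"
  shows "root_norm L (wt Y) = wt Y (cor Y)"
proof -
  have "(THE t. t \<in> lcartan L \<and> (\<forall>h\<in>lcartan L. lform L t h = wt Y h)) = cor Y"
  proof (rule the_equality)
    show "cor Y \<in> lcartan L \<and> (\<forall>h\<in>lcartan L. lform L (cor Y) h = wt Y h)"
      using cor_cartan form_cor assms by blast
  next
    fix t assume t: "t \<in> lcartan L \<and> (\<forall>h\<in>lcartan L. lform L t h = wt Y h)"
    have "t + lscale L (- 1) (cor Y) = 0"
    proof (rule form_cartan_nondegenerate)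
      show "t + lscale L (- 1) (cor Y) \<in> lcartan L"
        using t cor_cartan[OF assms]
        by (intro g.subspace_add[OF cartan_subspace] g.subspace_scale[OF cartan_subspace]) auto
      show "lform L (t + lscale L (- 1) (cor Y)) h = 0" if "h \<in> lcartan L" for h
        using t that by (simp only: form_add_left form_scale_left form_cor[OF assms]) simp
    qed
    then show "t = cor Y" by simp
  qed
  then show ?thesis by (simp add: root_norm_def)
qed

text \<open>By finiteness some root has a norm of maximal real part. The normalization gives it norm
  2, and \<open>cor_norm\<close> then reads 8 hv = 2 n.\<close>

lemma hv_rational: "hv \<in> \<rat>" "hv \<noteq> 0"
proof -
  have fin: "finite (root_norm L ` roots L)" "root_norm L ` roots L \<noteq> {}"
    using finite_B root_basis_nonempty by (auto simp: roots_eq root_basis_def)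
  then obtain \<alpha> where \<alpha>: "\<alpha> \<in> roots L" "Re (root_norm L \<alpha>) = Max (Re ` root_norm L ` roots L)"
    using Max_in[of "Re ` root_norm L ` roots L"] by fastforce
  then have "\<forall>\<beta>\<in>roots L. Re (root_norm L \<beta>) \<le> Re (root_norm L \<alpha>)"
    using fin(1) by simp
  then have 2: "root_norm L \<alpha> = 2" using form \<alpha>(1) unfolding normalized_form_def by blast
  obtain Y where Y: "Y \<in> root_basis" "\<alpha> = wt Y" using \<alpha>(1) unfolding roots_eq by blast
  obtain n where n: "n > 0" "8 * hv = of_int n * wt Y (cor Y)" using cor_norm[OF Y(1)] by blast
  have "wt Y (cor Y) = 2" using 2 root_norm_wt[OF root_basisD(1)[OF Y(1)]] Y(2) by simp
  then have hv: "hv = of_int n / 4" using n(2) by (simp add: field_simps)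
  show "hv \<in> \<rat>" unfolding hv by (intro Rats_divide Rats_of_int Rats_number_of)
  show "hv \<noteq> 0" using n(1) by (simp add: hv)
qed

lemma cor_self_rational:
  assumes "Y \<in> root_basis"
  shows "wt Y (cor Y) \<in> \<rat>"
proof -
  obtain n where n: "n > 0" "8 * hv = of_int n * wt Y (cor Y)" using cor_norm[OF assms] by blast
  then have "wt Y (cor Y) = 8 * hv / of_int n" by (simp add: field_simps)
  also have "\<dots> \<in> \<rat>" by (intro Rats_divide Rats_mult hv_rational Rats_of_int Rats_number_of)
  finally show ?thesis .
qed

lemma wt_cor_rational:
  assumes "Y \<in> B" "Y' \<in> root_basis"
  shows "wt Y (cor Y') \<in> \<rat>"
proof -
  obtain n :: int where "2 * wt Y (cor Y') = of_int n * wt Y' (cor Y')"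
    using weight_integral_basis[OF ad.lie_rep_axioms assms(2) basis_weight_space[OF assms(1)]
        B_nonzero[OF assms(1)]] by blast
  then have "wt Y (cor Y') = of_int n * wt Y' (cor Y') / 2" by (simp add: field_simps)
  also have "\<dots> \<in> \<rat>"
    by (intro Rats_divide Rats_mult cor_self_rational assms(2) Rats_of_int Rats_number_of)
  finally show ?thesis .
qed

lemma finite_root_basis: "finite root_basis"
  using finite_B by (simp add: root_basis_def)

text \<open>The element \<open>h\<close> decides which root vectors count as positive. It is sought
  among the combinations of the \<open>cor Y'\<close> with coefficients m^(ix Y'): the value of a
  root is then a nonzero polynomial in m, and some natural number avoids the zeros of these finitely
  many polynomials.\<close>

lemma regular_element: "\<exists>h\<in>lcartan L. \<forall>Y\<in>root_basis. Re (wt Y h) \<noteq> 0"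
proof -
  obtain ix :: "'g \<Rightarrow> nat" where ix: "inj_on ix root_basis"
    using finite_imp_inj_to_nat_seg[OF finite_root_basis] by blast
  define p where "p Y = (\<Sum>Y'\<in>root_basis. monom (wt Y (cor Y')) (ix Y'))" for Y
  have "p Y \<noteq> 0" if Y: "Y \<in> root_basis" for Y
  proof -
    have "Polynomial.coeff (p Y) (ix Y) = (\<Sum>Y'\<in>root_basis. if Y' = Y then wt Y (cor Y') else 0)"
      unfolding p_def coeff_sum using ix Y
      by (intro sum.cong) (auto simp: inj_on_eq_iff)
    then have "Polynomial.coeff (p Y) (ix Y) \<noteq> 0"
      using Y finite_root_basis cor_self_nonzero[OF Y] by simp
    then show ?thesis by (metis coeff_0)
  qed
  then have "finite (\<Union>Y\<in>root_basis. {z. poly (p Y) z = 0})"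
    using finite_root_basis poly_roots_finite by blast
  moreover have "infinite (range (of_nat :: nat \<Rightarrow> complex))"
    by (rule range_inj_infinite) (simp add: inj_def)
  ultimately obtain m :: nat where m: "of_nat m \<notin> (\<Union>Y\<in>root_basis. {z. poly (p Y) z = 0})"
    by (meson finite_subset image_subsetI)
  define h where "h = (\<Sum>Y'\<in>root_basis. lscale L (of_nat m ^ ix Y') (cor Y'))"
  have H: "cor Y' \<in> lcartan L" if "Y' \<in> root_basis" for Y'
    by (rule cor_cartan[OF root_basisD(1)[OF that]])
  have "Re (wt Y h) \<noteq> 0" if Y: "Y \<in> root_basis" for Y
  proof -
    have YB: "Y \<in> B" using root_basisD(1)[OF Y] .
    have wh: "wt Y h = (\<Sum>Y'\<in>root_basis. of_nat m ^ ix Y' * wt Y (cor Y'))"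
      unfolding h_def by (rule wt_linear[OF YB H])
    then have "wt Y h = poly (p Y) (of_nat m)"
      by (simp add: p_def poly_sum poly_monom mult.commute)
    then have "wt Y h \<noteq> 0" using m Y by auto
    \<comment> \<open>Rational values are real, so a nonzero value has nonzero real part.\<close>
    moreover have "wt Y h \<in> \<rat>"
      unfolding wh using wt_cor_rational[OF YB]
      by (intro Rats_sum Rats_mult Rats_power) auto
    then have "wt Y h \<in> \<real>" by (auto elim!: Rats_cases')
    ultimately show ?thesis by (auto elim!: Reals_cases)
  qed
  moreover have "h \<in> lcartan L"
    unfolding h_def by (intro g.subspace_sum[OF cartan_subspace] g.subspace_scale[OF cartan_subspace] H)
  ultimately show ?thesis by blast
qed

text \<open>If \<eta>(t) = m a / 2 with a = \<open>wt Y (cor Y)\<close>, the two kinds of summands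
  of the Casimir value are m (a / 2) and m^2 (a^2 / (8 hv)). The factors beside the integers do not
  depend on the representation.\<close>

lemma weight_denominator:
  "\<exists>n>0. \<forall>Y\<in>root_basis. of_nat n * (wt Y (cor Y) / 2) \<in> \<int> \<and>
     of_nat n * (wt Y (cor Y) ^ 2 / (8 * hv)) \<in> \<int>"
proof -
  let ?S = "(\<lambda>Y. wt Y (cor Y) / 2) ` root_basis \<union> (\<lambda>Y. wt Y (cor Y) ^ 2 / (8 * hv)) ` root_basis"
  have "?S \<subseteq> \<rat>"
    using cor_self_rational hv_rational(1)
    by (auto intro!: Rats_divide Rats_mult Rats_power Rats_number_of)
  then obtain n where "n > 0" "\<forall>q\<in>?S. of_nat n * q \<in> \<int>"
    using common_denominator[of ?S] finite_root_basis by auto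
  then show ?thesis by blast
qed

end

section \<open>The Casimir operator\<close>

locale weight_basis_rep = weight_basis L X hv B + V: lie_rep s L \<rho> F G
  for L :: "('g::ab_group_add) lie_data" and X :: "'k::finite \<Rightarrow> 'g" and hv :: complex
    and B :: "'g set" and s :: "complex \<Rightarrow> 'v::ab_group_add \<Rightarrow> 'v" and \<rho> :: "'g \<Rightarrow> 'v \<Rightarrow> 'v"
    and F G :: "'v set"
begin

definition casimir_op :: "'v \<Rightarrow> 'v" where
  "casimir_op v = (\<Sum>k\<in>UNIV. \<rho> (X k) (\<rho> (X k) v))"

lemma casimir_op_basis: "casimir_op v = (\<Sum>Y\<in>B. \<rho> Y (\<rho> (dual Y) v))"
proof -
  have "\<rho> (X k) (\<rho> (X k) v) = (\<Sum>Y\<in>B. \<rho> Y (\<rho> (lscale L (coord (X k) Y) (X k)) v))" for k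
  proof -
    have "\<rho> (X k) (\<rho> (X k) v) = \<rho> (\<Sum>Y\<in>B. lscale L (coord (X k) Y) Y) (\<rho> (X k) v)"
      by (simp only: coord_expand)
    then show ?thesis by (simp add: V.\<rho>_sum V.\<rho>_scale V.\<rho>_scale_right)
  qed
  then have "casimir_op v = (\<Sum>Y\<in>B. \<Sum>k\<in>UNIV. \<rho> Y (\<rho> (lscale L (coord (X k) Y) (X k)) v))"
    unfolding casimir_op_def by (simp add: sum.swap[of _ B])
  also have "\<dots> = (\<Sum>Y\<in>B. \<rho> Y (\<rho> (dual Y) v))"
    by (simp only: dual_def V.\<rho>_sum V.\<rho>_sum_right)
  finally show ?thesis .
qed

text \<open>Moving \<open>\<rho> y\<close> past the two factors produces the coefficients of \<open>[X k, y]\<close>, which are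
  antisymmetric because the form is invariant.\<close>

lemma casimir_op_commute: "casimir_op (\<rho> y v) = \<rho> y (casimir_op v)"
proof -
  define c where "c k l = lform L (lbrk L (X k) y) (X l)" for k l
  have anti: "c k l = - c l k" for k l
  proof -
    have "c k l = lform L (X k) (lbrk L y (X l))" by (simp add: c_def form_inv)
    also have "\<dots> = lform L (X k) (lscale L (- 1) (lbrk L (X l) y))" by (subst brk_anti) simp
    also have "\<dots> = - c l k" by (simp only: form_scale_right) (simp add: c_def form_sym)
    finally show ?thesis .
  qed
  have exp: "\<rho> (lbrk L (X k) y) w = (\<Sum>l\<in>UNIV. s (c k l) (\<rho> (X l) w))" for k w
  proof -
    have "\<rho> (lbrk L (X k) y) w = \<rho> (\<Sum>l\<in>UNIV. lscale L (c k l) (X l)) w"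
      by (simp only: c_def form_expand)
    then show ?thesis by (simp add: V.\<rho>_sum V.\<rho>_scale)
  qed
  have "\<rho> (X k) (\<rho> (X k) (\<rho> y v)) = \<rho> y (\<rho> (X k) (\<rho> (X k) v)) +
      ((\<Sum>l\<in>UNIV. s (c k l) (\<rho> (X l) (\<rho> (X k) v))) + (\<Sum>l\<in>UNIV. s (c k l) (\<rho> (X k) (\<rho> (X l) v))))" for k
  proof -
    have "\<rho> (X k) (\<rho> (X k) (\<rho> y v)) = \<rho> y (\<rho> (X k) (\<rho> (X k) v)) +
        (\<rho> (lbrk L (X k) y) (\<rho> (X k) v) + \<rho> (X k) (\<rho> (lbrk L (X k) y) v))"
      by (simp only: V.\<rho>_brk V.\<rho>_diff_right) simp
    then show ?thesis by (simp only: exp V.\<rho>_sum_right V.\<rho>_scale_right)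
  qed
  then have "casimir_op (\<rho> y v) = \<rho> y (casimir_op v) +
      ((\<Sum>k\<in>UNIV. \<Sum>l\<in>UNIV. s (c k l) (\<rho> (X l) (\<rho> (X k) v))) +
       (\<Sum>k\<in>UNIV. \<Sum>l\<in>UNIV. s (c k l) (\<rho> (X k) (\<rho> (X l) v))))"
    by (simp only: casimir_op_def sum.distrib V.\<rho>_sum_right)
  also have "(\<Sum>k\<in>UNIV. \<Sum>l\<in>UNIV. s (c k l) (\<rho> (X k) (\<rho> (X l) v))) =
      (\<Sum>k\<in>UNIV. \<Sum>l\<in>UNIV. s (c l k) (\<rho> (X l) (\<rho> (X k) v)))"
    by (rule sum.swap)
  also have "\<dots> = - (\<Sum>k\<in>UNIV. \<Sum>l\<in>UNIV. s (c k l) (\<rho> (X l) (\<rho> (X k) v)))"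
  proof -
    have "s (c l k) (\<rho> (X l) (\<rho> (X k) v)) = - s (c k l) (\<rho> (X l) (\<rho> (X k) v))" for k l
      using anti[of l k] by simp
    then show ?thesis by (simp only: sum_negf)
  qed
  finally show ?thesis by simp
qed

lemma weight_linear:
  assumes v: "v \<in> V.weight_space \<eta>" "v \<noteq> 0" and "\<And>i. i \<in> I \<Longrightarrow> f i \<in> lcartan L"
  shows "\<eta> (\<Sum>i\<in>I. lscale L (c i) (f i)) = (\<Sum>i\<in>I. c i * \<eta> (f i))"
proof -
  have w: "\<rho> h v = s (\<eta> h) v" if "h \<in> lcartan L" for h
    using v(1) that by (simp add: V.weight_space_def)
  have "(\<Sum>i\<in>I. lscale L (c i) (f i)) \<in> lcartan L"
    by (intro g.subspace_sum[OF cartan_subspace] g.subspace_scale[OF cartan_subspace] assms)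
  then have "s (\<eta> (\<Sum>i\<in>I. lscale L (c i) (f i))) v = \<rho> (\<Sum>i\<in>I. lscale L (c i) (f i)) v"
    by (rule w [symmetric])
  also have "\<dots> = s (\<Sum>i\<in>I. c i * \<eta> (f i)) v"
    unfolding V.\<rho>_sum V.scale_sum_left
    by (intro sum.cong) (simp_all add: V.\<rho>_scale w assms(3))
  finally show ?thesis using v(2) by simp
qed

text \<open>A common eigenvector is built one Cartan basis vector at a time: the joint eigenspace
  found so far is stable under the next operator, which commutes with the earlier ones.\<close>

lemma weight_vector_exists:
  assumes "F \<noteq> {0}"
  shows "\<exists>\<eta>. \<exists>v\<in>V.weight_space \<eta>. v \<noteq> 0"
proof -
  let ?C = "B - root_basis"
  have C: "Y \<in> lcartan L" if "Y \<in> ?C" for Y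
    using cartan_basis[of Y] that by blast
  have "\<exists>\<eta>. \<exists>v\<in>F. v \<noteq> 0 \<and> (\<forall>Y\<in>A. \<rho> Y v = s (\<eta> Y) v)" if "finite A" "A \<subseteq> lcartan L" for A
    using that
  proof (induction A rule: finite_induct)
    case empty
    show ?case using assms V.subspace_0[OF V.F_sub] by auto
  next
    case (insert h A)
    then obtain \<eta> v where v: "v \<in> F" "v \<noteq> 0" "\<forall>Y\<in>A. \<rho> Y v = s (\<eta> Y) v" by auto
    define W where "W = {w \<in> F. \<forall>Y\<in>A. \<rho> Y w = s (\<eta> Y) w}"
    have inv: "\<rho> h w \<in> W" if w: "w \<in> W" for w
    proof -
      have "\<rho> Y (\<rho> h w) = s (\<eta> Y) (\<rho> h w)" if Y: "Y \<in> A" for Y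
      proof -
        have "\<rho> Y (\<rho> h w) = \<rho> (lbrk L Y h) w + \<rho> h (\<rho> Y w)" by (simp add: V.\<rho>_brk)
        also have "lbrk L Y h = 0" using cartan_commute insert.prems Y by auto
        finally show ?thesis using w Y by (simp add: W_def V.\<rho>_0 V.\<rho>_scale_right)
      qed
      then show ?thesis using w V.\<rho>_F by (simp add: W_def)
    qed
    have sub: "V.subspace W"
      unfolding W_def using V.F_sub
      by (intro V.subspaceI)
        (auto simp: V.subspace_0 V.subspace_add V.subspace_scale V.\<rho>_0_right V.\<rho>_add_right
          V.\<rho>_scale_right V.scale_right_distrib mult.commute)
    have "W \<subseteq> V.span G" using V.F_span by (auto simp: W_def)
    moreover have "v \<in> W" using v by (simp add: W_def)
    ultimately obtain w a where w: "w \<in> W" "w \<noteq> 0" "\<rho> h w = s a w"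
      using eigenvector_exists[OF V.\<rho>_linear V.finite_G _ _ v(2) inv sub] by blast
    have "\<forall>Y\<in>insert h A. \<rho> Y w = s ((\<eta>(h := a)) Y) w"
      using w insert.hyps by (auto simp: W_def)
    moreover have "w \<in> F" using w(1) by (simp add: W_def)
    ultimately show ?case
      using w(2) by (intro exI[of _ "\<eta>(h := a)"] bexI[of _ w] conjI)
  qed
  from this[of ?C] obtain \<eta> v where v: "v \<in> F" "v \<noteq> 0" "\<forall>Y\<in>?C. \<rho> Y v = s (\<eta> Y) v"
    using finite_B C by blast
  \<comment> \<open>The eigenvalues on the basis vectors extend linearly to a weight on the whole
    Cartan subalgebra.\<close>
  have "\<rho> h v = s (\<Sum>Y\<in>?C. coord h Y * \<eta> Y) v" if h: "h \<in> lcartan L" for h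
  proof -
    have "\<rho> h v = \<rho> (\<Sum>Y\<in>?C. lscale L (coord h Y) Y) v"
      by (simp only: cartan_expand[OF h])
    then show ?thesis using v(3)
      unfolding V.\<rho>_sum V.scale_sum_left by (simp add: V.\<rho>_scale)
  qed
  then have "v \<in> V.weight_space (\<lambda>h. \<Sum>Y\<in>?C. coord h Y * \<eta> Y)"
    using v(1) by (simp add: V.weight_space_def)
  then show ?thesis using v(2) by blast
qed

text \<open>Take a weight whose value at h has maximal real part; a root vector that is positive at
  h would lead beyond it.\<close>

lemma highest_weight_vector_exists:
  assumes "F \<noteq> {0}" and h: "h \<in> lcartan L"
  shows "\<exists>\<eta>. \<exists>v\<in>V.weight_space \<eta>. v \<noteq> 0 \<and>
    (\<forall>\<alpha>. Re (\<alpha> h) > 0 \<longrightarrow> (\<forall>x\<in>root_space L \<alpha>. \<rho> x v = 0))"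
proof -
  let ?E = "{\<eta> h |\<eta>. \<exists>v\<in>V.weight_space \<eta>. v \<noteq> 0}"
  have "?E \<subseteq> {a. \<exists>v\<in>F. v \<noteq> 0 \<and> \<rho> h v = s a v}"
    using h by (auto simp: V.weight_space_def)
  then have fin: "finite (Re ` ?E)"
    using V.finite_eigenvalues[OF V.\<rho>_linear V.finite_G V.F_span] finite_subset by blast
  moreover have "Re ` ?E \<noteq> {}" using weight_vector_exists[OF assms(1)] by blast
  ultimately have "Max (Re ` ?E) \<in> Re ` ?E" by (rule Max_in)
  then obtain \<eta> v where v: "v \<in> V.weight_space \<eta>" "v \<noteq> 0" "Re (\<eta> h) = Max (Re ` ?E)" by auto
  have "\<rho> x v = 0" if \<alpha>: "Re (\<alpha> h) > 0" and x: "x \<in> root_space L \<alpha>" for \<alpha> x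
  proof (rule ccontr)
    assume "\<rho> x v \<noteq> 0"
    then have "\<eta> h + \<alpha> h \<in> ?E"
      using V.weight_space_raise[OF x v(1)] by (intro CollectI exI[of _ "\<lambda>h. \<eta> h + \<alpha> h"]) blast
    then have "Re (\<eta> h + \<alpha> h) \<in> Re ` ?E" by blast
    then have "Re (\<eta> h + \<alpha> h) \<le> Max (Re ` ?E)" using fin by (rule Max_ge[rotated])
    then show False using v(3) \<alpha> by simp
  qed
  then show ?thesis using v by blast
qed

text \<open>The classical (\<eta>, \<eta> + 2\<rho>): the trace form turns (\<eta>, \<eta>) into the
  first sum, and the second is the pairing with the sum of the positive roots.\<close>

definition casimir_value :: "('g \<Rightarrow> complex) \<Rightarrow> 'g \<Rightarrow> complex" where
  "casimir_value \<eta> h = (\<Sum>Y\<in>root_basis. \<eta> (cor Y) ^ 2) / (2 * hv) +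
     (\<Sum>Y\<in>{Y \<in> root_basis. Re (wt Y h) > 0}. \<eta> (cor Y))"

text \<open>If Y is positive, Y kills v and Y Y' v = [Y, Y'] v; if Y is negative, Y' already kills
  v. The Cartan part is (\<eta>, \<eta>).\<close>

lemma casimir_op_highest_weight:
  assumes v: "v \<in> V.weight_space \<eta>" "v \<noteq> 0"
    and high: "\<And>\<alpha> x. Re (\<alpha> h) > 0 \<Longrightarrow> x \<in> root_space L \<alpha> \<Longrightarrow> \<rho> x v = 0"
    and h: "\<And>Y. Y \<in> root_basis \<Longrightarrow> Re (wt Y h) \<noteq> 0"
  shows "casimir_op v = s (casimir_value \<eta> h) v"
proof -
  let ?C = "B - root_basis"
  have w: "\<rho> h v = s (\<eta> h) v" if "h \<in> lcartan L" for h
    using v(1) that by (simp add: V.weight_space_def)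
  have C: "Y \<in> B" "Y \<in> lcartan L" "dual Y \<in> lcartan L" if "Y \<in> ?C" for Y
    using cartan_basis[of Y] dual_cartan[of Y] that by auto
  have c1: "\<rho> Y (\<rho> (dual Y) v) = s (\<eta> Y * \<eta> (dual Y)) v" if "Y \<in> ?C" for Y
    using C[OF that] by (simp add: w V.\<rho>_scale_right mult.commute)
  have c2: "\<rho> Y (\<rho> (dual Y) v) = s (if Re (wt Y h) > 0 then \<eta> (cor Y) else 0) v" if Y: "Y \<in> root_basis" for Y
  proof (cases "Re (wt Y h) > 0")
    case True
    have YB: "Y \<in> B" using root_basisD(1)[OF Y] .
    have "\<rho> Y v = 0" by (rule high[OF True wt_props(2)[OF YB]])
    then have "\<rho> Y (\<rho> (dual Y) v) = \<rho> (cor Y) v" by (simp add: cor_def V.\<rho>_brk V.\<rho>_0_right)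
    then show ?thesis using True by (simp add: w cor_cartan[OF YB])
  next
    case False
    have "\<rho> (dual Y) v = 0"
      by (rule high[OF _ dual_root_space[OF root_basisD(1)[OF Y]]]) (use False h[OF Y] in simp)
    then show ?thesis using False by (simp add: V.\<rho>_0_right)
  qed
  have "casimir_op v = (\<Sum>Y\<in>?C. \<rho> Y (\<rho> (dual Y) v)) + (\<Sum>Y\<in>root_basis. \<rho> Y (\<rho> (dual Y) v))"
    unfolding casimir_op_basis
    by (rule sum.subset_diff[OF _ finite_B]) (auto simp: root_basis_def)
  also have "\<dots> = s ((\<Sum>Y\<in>?C. \<eta> Y * \<eta> (dual Y)) + (\<Sum>Y\<in>root_basis. if Re (wt Y h) > 0 then \<eta> (cor Y) else 0)) v"
    by (simp only: V.scale_left_distrib V.scale_sum_left c1 c2 cong: sum.cong)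
  also have "(\<Sum>Y\<in>root_basis. if Re (wt Y h) > 0 then \<eta> (cor Y) else 0) =
      (\<Sum>Y\<in>{Y \<in> root_basis. Re (wt Y h) > 0}. \<eta> (cor Y))"
    using finite_root_basis by (intro sum.mono_neutral_cong_right) auto
  also have "(\<Sum>Y\<in>?C. \<eta> Y * \<eta> (dual Y)) = (\<Sum>Y\<in>root_basis. \<eta> (cor Y) ^ 2) / (2 * hv)"
  proof -
    \<comment> \<open>This vector represents \<eta> under the form, so the Cartan sum is \<eta>(t) =
      (t, t), to which the trace form applies.\<close>
    define t where "t = (\<Sum>Y\<in>?C. lscale L (\<eta> Y) (dual Y))"
    have t: "t \<in> lcartan L"
      unfolding t_def by (intro g.subspace_sum[OF cartan_subspace] g.subspace_scale[OF cartan_subspace] C)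
    have form_t: "lform L t h = \<eta> h" if h: "h \<in> lcartan L" for h
    proof -
      have "lform L t h = (\<Sum>Y\<in>?C. coord h Y * \<eta> Y)"
        by (simp add: t_def form_sum_left form_scale_left form_dual mult.commute)
      also have "\<dots> = \<eta> (\<Sum>Y\<in>?C. lscale L (coord h Y) Y)"
        by (rule weight_linear[OF v C(2), symmetric])
      also have "\<dots> = \<eta> h" by (simp only: cartan_expand[OF h])
      finally show ?thesis .
    qed
    have "(\<Sum>Y\<in>?C. \<eta> Y * \<eta> (dual Y)) = \<eta> t"
      unfolding t_def by (rule weight_linear[OF v C(3), symmetric])
    also have "\<dots> = lform L t t" by (rule form_t[OF t, symmetric])
    also have "\<dots> = (\<Sum>Y\<in>B. wt Y t * wt Y t) / (2 * hv)"
      using trace_form[OF t t] hv_rational(2) by (simp add: field_simps)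
    also have "(\<Sum>Y\<in>B. wt Y t * wt Y t) = (\<Sum>Y\<in>root_basis. wt Y t * wt Y t)"
      using cartan_basis by (intro sum.mono_neutral_right finite_B) (auto simp: root_basis_def)
    also have "\<dots> = (\<Sum>Y\<in>root_basis. \<eta> (cor Y) ^ 2)"
    proof (rule sum.cong[OF refl])
      fix Y assume "Y \<in> root_basis"
      then have Y: "Y \<in> B" by (rule root_basisD)
      have "wt Y t = \<eta> (cor Y)"
        using form_cor[OF Y t] form_t[OF cor_cartan[OF Y]] by (simp add: form_sym)
      then show "wt Y t * wt Y t = \<eta> (cor Y) ^ 2" by (simp add: power2_eq_square)
    qed
    finally show ?thesis .
  qed
  finally show ?thesis by (simp only: casimir_value_def)
qed

lemma casimir_value_integral:
  assumes v: "v \<in> V.weight_space \<eta>" "v \<noteq> 0"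
    and n: "\<forall>Y\<in>root_basis. of_nat n * (wt Y (cor Y) / 2) \<in> \<int> \<and>
     of_nat n * (wt Y (cor Y) ^ 2 / (8 * hv)) \<in> \<int>"
  shows "of_nat n * casimir_value \<eta> h \<in> \<int>"
proof -
  have "\<forall>Y\<in>root_basis. \<exists>m::int. 2 * \<eta> (cor Y) = of_int m * wt Y (cor Y)"
    using weight_integral_basis[OF V.lie_rep_axioms _ v] by blast
  then obtain m where m: "\<And>Y. Y \<in> root_basis \<Longrightarrow> 2 * \<eta> (cor Y) = of_int (m Y) * wt Y (cor Y)"
    using bchoice[of root_basis "\<lambda>Y m. 2 * \<eta> (cor Y) = of_int m * wt Y (cor Y)"] by auto
  have eq: "\<eta> (cor Y) = of_int (m Y) * (wt Y (cor Y) / 2)" if "Y \<in> root_basis" for Y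
    using m[OF that] by (simp add: field_simps)
  have 1: "of_nat n * \<eta> (cor Y) \<in> \<int>" if "Y \<in> root_basis" for Y
  proof -
    have "of_nat n * \<eta> (cor Y) = of_int (m Y) * (of_nat n * (wt Y (cor Y) / 2))"
      unfolding eq[OF that] by simp
    then show ?thesis
      using Ints_mult[OF Ints_of_int conjunct1[OF bspec[OF n that]], of "m Y"] by (simp only:)
  qed
  have 2: "of_nat n * (\<eta> (cor Y) ^ 2 / (2 * hv)) \<in> \<int>" if "Y \<in> root_basis" for Y
  proof -
    have "of_nat n * (\<eta> (cor Y) ^ 2 / (2 * hv)) =
        of_int (m Y ^ 2) * (of_nat n * (wt Y (cor Y) ^ 2 / (8 * hv)))"
      unfolding eq[OF that] by (simp add: power_mult_distrib power_divide)
    then show ?thesis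
      using Ints_mult[OF Ints_of_int conjunct2[OF bspec[OF n that]], of "m Y ^ 2"] by (simp only:)
  qed
  have "of_nat n * casimir_value \<eta> h =
      (\<Sum>Y\<in>root_basis. of_nat n * (\<eta> (cor Y) ^ 2 / (2 * hv))) +
      (\<Sum>Y\<in>{Y \<in> root_basis. Re (wt Y h) > 0}. of_nat n * \<eta> (cor Y))"
    by (simp only: casimir_value_def distrib_left sum_distrib_left sum_divide_distrib)
  also have "\<dots> \<in> \<int>"
    by (intro Ints_add Ints_sum 2 1) simp_all
  finally show ?thesis .
qed

text \<open>The multiplier n is fixed by the Lie algebra alone, which is what makes the bound
  uniform in the representation.\<close>

theorem casimir_eigenvector:
  assumes "F \<noteq> {0}"
    and n: "\<forall>Y\<in>root_basis. of_nat n * (wt Y (cor Y) / 2) \<in> \<int> \<and>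
     of_nat n * (wt Y (cor Y) ^ 2 / (8 * hv)) \<in> \<int>"
  shows "\<exists>v\<in>F. \<exists>c. v \<noteq> 0 \<and> casimir_op v = s c v \<and> of_nat n * c \<in> \<int>"
proof -
  obtain h where h: "h \<in> lcartan L" "\<And>Y. Y \<in> root_basis \<Longrightarrow> Re (wt Y h) \<noteq> 0"
    using regular_element by auto
  obtain \<eta> v where v: "v \<in> V.weight_space \<eta>" "v \<noteq> 0"
    "\<And>\<alpha> x. Re (\<alpha> h) > 0 \<Longrightarrow> x \<in> root_space L \<alpha> \<Longrightarrow> \<rho> x v = 0"
    using highest_weight_vector_exists[OF assms(1) h(1)] by auto
  have "v \<in> F" using v(1) by (simp add: V.weight_space_def)
  moreover have "casimir_op v = s (casimir_value \<eta> h) v"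
    by (rule casimir_op_highest_weight[OF v h(2)])
  ultimately show ?thesis
    using casimir_value_integral[OF v(1,2) n, of h] v(2) by blast
qed

end

text \<open>Vectors of \<open>\<complex>\<^sup>n\<close> are represented by the sequences that vanish from \<open>n\<close> on, encoded as formal
  power series; this provides a type on which the matrices act.\<close>

definition mat_op :: "nat \<Rightarrow> complex mat \<Rightarrow> complex fps \<Rightarrow> complex fps" where
  "mat_op n A f = Abs_fps (\<lambda>i. if i < n then \<Sum>j<n. A $$ (i, j) * fps_nth f j else 0)"

definition vec_seq :: "complex vec \<Rightarrow> complex fps" where
  "vec_seq v = Abs_fps (\<lambda>i. if i < dim_vec v then v $ i else 0)"

abbreviation seq_scale :: "complex \<Rightarrow> complex fps \<Rightarrow> complex fps" where
  "seq_scale a f \<equiv> fps_const a * f"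

interpretation seq: vector_space seq_scale
  by unfold_locales (simp_all add: algebra_simps flip: fps_const_add fps_const_mult)

lemma index_mult_square_mat:
  assumes "A \<in> carrier_mat n n" "C \<in> carrier_mat n n" "i < n" "j < n"
  shows "(A * C) $$ (i, j) = (\<Sum>l<n. A $$ (i, l) * C $$ (l, j))"
  using assms by (auto simp: scalar_prod_def atLeast0LessThan)

lemma mat_op_add: "A \<in> carrier_mat n n \<Longrightarrow> C \<in> carrier_mat n n \<Longrightarrow>
    mat_op n (A + C) f = mat_op n A f + mat_op n C f"
  and mat_op_diff: "A \<in> carrier_mat n n \<Longrightarrow> C \<in> carrier_mat n n \<Longrightarrow>
    mat_op n (A - C) f = mat_op n A f - mat_op n C f"
  and mat_op_smult: "A \<in> carrier_mat n n \<Longrightarrow> mat_op n (a \<cdot>\<^sub>m A) f = seq_scale a (mat_op n A f)"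
  by (rule fps_ext, force simp: mat_op_def sum.distrib sum_subtractf sum_distrib_left algebra_simps)+

lemma mat_op_mult:
  assumes "A \<in> carrier_mat n n" "C \<in> carrier_mat n n"
  shows "mat_op n (A * C) f = mat_op n A (mat_op n C f)"
proof (rule fps_ext)
  fix i
  show "fps_nth (mat_op n (A * C) f) i = fps_nth (mat_op n A (mat_op n C f)) i"
  proof (cases "i < n")
    case True
    have "fps_nth (mat_op n (A * C) f) i = (\<Sum>j<n. \<Sum>l<n. A $$ (i, l) * C $$ (l, j) * fps_nth f j)"
      using assms True
      by (simp add: mat_op_def scalar_prod_def sum_distrib_right atLeast0LessThan)
    also have "\<dots> = (\<Sum>l<n. \<Sum>j<n. A $$ (i, l) * C $$ (l, j) * fps_nth f j)"
      by (rule sum.swap)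
    also have "\<dots> = fps_nth (mat_op n A (mat_op n C f)) i"
      using True by (simp add: mat_op_def sum_distrib_left mult.assoc)
    finally show ?thesis .
  qed (simp add: mat_op_def)
qed

lemma mat_op_vec_seq:
  assumes "A \<in> carrier_mat n n" "v \<in> carrier_vec n"
  shows "vec_seq (A *\<^sub>v v) = mat_op n A (vec_seq v)"
  using assms by (intro fps_ext) (auto simp: vec_seq_def mat_op_def scalar_prod_def atLeast0LessThan)

lemma lie_rep_of_matrices:
  assumes "is_rep L (n, \<rho>)"
  shows "lie_rep seq_scale L (\<lambda>x. mat_op n (\<rho> x)) {f. \<forall>i\<ge>n. fps_nth f i = 0} ((\<lambda>i. fps_X ^ i) ` {..<n})"
proof -
  let ?F = "{f :: complex fps. \<forall>i\<ge>n. fps_nth f i = 0}"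
  have \<rho>: "\<rho> x \<in> carrier_mat n n" for x using assms by (simp add: is_rep_def)
  show ?thesis
  proof (intro lie_rep.intro lie_rep_axioms.intro)
    show "vector_space seq_scale" by (rule seq.vector_space_axioms)
    show "?F \<subseteq> seq.span ((\<lambda>i. fps_X ^ i) ` {..<n})"
    proof
      fix f :: "complex fps" assume f: "f \<in> ?F"
      have "f = (\<Sum>i<n. seq_scale (fps_nth f i) (fps_X ^ i))"
      proof (rule fps_ext)
        fix j
        have "(\<Sum>i<n. fps_nth f i * (if j = i then 1 else 0)) = (if j < n then fps_nth f j else 0)"
          by (simp add: if_distrib cong: if_cong)
        then show "fps_nth f j = fps_nth (\<Sum>i<n. seq_scale (fps_nth f i) (fps_X ^ i)) j"
          using f by (auto simp: fps_sum_nth)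
      qed
      moreover have "(\<Sum>i<n. seq_scale (fps_nth f i) (fps_X ^ i)) \<in> seq.span ((\<lambda>i. fps_X ^ i) ` {..<n})"
        by (intro seq.span_sum seq.span_scale seq.span_base) auto
      ultimately show "f \<in> seq.span ((\<lambda>i. fps_X ^ i) ` {..<n})" by simp
    qed
    show "seq.subspace ?F" by (rule seq.subspaceI) auto
    show "Vector_Spaces.linear seq_scale seq_scale (mat_op n (\<rho> x))" for x
      by unfold_locales
        (auto intro!: fps_ext simp: mat_op_def algebra_simps sum.distrib sum_distrib_left)
    show "mat_op n (\<rho> (x + y)) f = mat_op n (\<rho> x) f + mat_op n (\<rho> y) f" for x y f
      using assms by (simp add: is_rep_def mat_op_add)
    show "mat_op n (\<rho> (lscale L a x)) f = seq_scale a (mat_op n (\<rho> x) f)" for a x f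
      using assms by (simp add: is_rep_def mat_op_smult)
    show "mat_op n (\<rho> (lbrk L x y)) f =
        mat_op n (\<rho> x) (mat_op n (\<rho> y) f) - mat_op n (\<rho> y) (mat_op n (\<rho> x) f)" for x y f
    proof -
      have "mat_op n (\<rho> (lbrk L x y)) f = mat_op n (\<rho> x * \<rho> y - \<rho> y * \<rho> x) f"
        using assms by (simp add: is_rep_def)
      also have "\<dots> = mat_op n (\<rho> x * \<rho> y) f - mat_op n (\<rho> y * \<rho> x) f"
        by (rule mat_op_diff[OF mult_carrier_mat[OF \<rho> \<rho>] mult_carrier_mat[OF \<rho> \<rho>]])
      finally show ?thesis by (simp only: mat_op_mult \<rho>)
    qed
  qed (auto simp: mat_op_def)
qed

section \<open>The Casimir scalar of a matrix representation\<close>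

definition casimir_mat :: "('k::finite \<Rightarrow> 'g) \<Rightarrow> 'g rep \<Rightarrow> complex mat" where
  "casimir_mat X V = mat (fst V) (fst V) (\<lambda>(i, j). \<Sum>k\<in>UNIV. (snd V (X k) * snd V (X k)) $$ (i, j))"

lemma casimir_eqI:
  assumes "casimir_mat X V = c \<cdot>\<^sub>m 1\<^sub>m (fst V)" "0 < fst V"
  shows "casimir X V = c"
proof -
  have "c' = c" if "casimir_mat X V = c' \<cdot>\<^sub>m 1\<^sub>m (fst V)" for c'
  proof -
    \<comment> \<open>Positive dimension is essential: on the zero space every scalar would satisfy
      the description.\<close>
    have "(c' \<cdot>\<^sub>m 1\<^sub>m (fst V)) $$ (0, 0) = (c \<cdot>\<^sub>m 1\<^sub>m (fst V)) $$ (0, 0)"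
      using assms(1) that by simp
    then show ?thesis using assms(2) by simp
  qed
  with assms(1) show ?thesis
    unfolding casimir_def casimir_mat_def [symmetric] by (intro the_equality) auto
qed

text \<open>A class consists of the representations isomorphic to an irreducible one; the
  intertwiner carries the scalar over to each of them.\<close>

lemma casimir_mat_iso:
  assumes "is_rep L V" "is_rep L W" "rep_iso V W" "casimir_mat X V = c \<cdot>\<^sub>m 1\<^sub>m (fst V)"
  shows "casimir_mat X W = c \<cdot>\<^sub>m 1\<^sub>m (fst W)"
proof -
  define n where "n = fst V"
  obtain P where P: "fst W = n" "P \<in> carrier_mat n n" "invertible_mat P"
    "\<And>x. P * snd V x = snd W x * P"
    using assms(3) by (auto simp: rep_iso_def n_def)
  have V: "snd V x \<in> carrier_mat n n" and W: "snd W x \<in> carrier_mat n n" for x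
    using assms(1,2) P(1) by (auto simp: is_rep_def n_def split: prod.splits)
  obtain Q where Q: "P * Q = 1\<^sub>m n" "Q * P = 1\<^sub>m (dim_row Q)"
    using P(2,3) by (auto simp: invertible_mat_def inverts_mat_def)
  \<comment> \<open>The definition of invertibility leaves the shape of the inverse open; it is
    recovered from the two products.\<close>
  have Qc: "Q \<in> carrier_mat n n"
  proof (rule carrier_matI)
    show "dim_col Q = n" using Q(1) by (metis index_mult_mat(3) index_one_mat(3))
    show "dim_row Q = n" using Q(2) P(2) by (metis carrier_matD(2) index_mult_mat(3) index_one_mat(3))
  qed
  have CW: "casimir_mat X W \<in> carrier_mat n n" by (simp add: casimir_mat_def P(1))
  have sq: "snd W x * snd W x * P = P * (snd V x * snd V x)" for x
  proof -
    have "snd W x * snd W x * P = snd W x * (snd W x * P)"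
      by (rule assoc_mult_mat[OF W W P(2)])
    also have "\<dots> = snd W x * (P * snd V x)"
      by (simp only: P(4))
    also have "\<dots> = snd W x * P * snd V x"
      by (rule assoc_mult_mat[OF W P(2) V, symmetric])
    also have "\<dots> = P * snd V x * snd V x"
      by (simp only: P(4))
    also have "\<dots> = P * (snd V x * snd V x)"
      by (rule assoc_mult_mat[OF P(2) V V])
    finally show ?thesis .
  qed
  have "casimir_mat X W * P = P * casimir_mat X V"
  proof (rule eq_matI)
    fix i j assume "i < dim_row (P * casimir_mat X V)" "j < dim_col (P * casimir_mat X V)"
    then have ij: "i < n" "j < n" using P(2) by (simp_all add: casimir_mat_def n_def)
    have "(casimir_mat X W * P) $$ (i, j) =
        (\<Sum>l<n. (\<Sum>k\<in>UNIV. (snd W (X k) * snd W (X k)) $$ (i, l)) * P $$ (l, j))"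
      using ij P(1,2) by (simp add: casimir_mat_def scalar_prod_def atLeast0LessThan)
    also have "\<dots> = (\<Sum>k\<in>UNIV. \<Sum>l<n. (snd W (X k) * snd W (X k)) $$ (i, l) * P $$ (l, j))"
      unfolding sum_distrib_right by (rule sum.swap)
    also have "\<dots> = (\<Sum>k\<in>UNIV. (snd W (X k) * snd W (X k) * P) $$ (i, j))"
      by (intro sum.cong refl index_mult_square_mat[OF _ P(2) ij, symmetric] mult_carrier_mat[OF W W])
    also have "\<dots> = (\<Sum>k\<in>UNIV. (P * (snd V (X k) * snd V (X k))) $$ (i, j))"
      by (simp only: sq)
    also have "\<dots> = (\<Sum>k\<in>UNIV. \<Sum>l<n. P $$ (i, l) * (snd V (X k) * snd V (X k)) $$ (l, j))"
      by (intro sum.cong refl index_mult_square_mat[OF P(2) _ ij] mult_carrier_mat[OF V V])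
    also have "\<dots> = (\<Sum>l<n. P $$ (i, l) * (\<Sum>k\<in>UNIV. (snd V (X k) * snd V (X k)) $$ (l, j)))"
      unfolding sum_distrib_left by (rule sum.swap)
    also have "\<dots> = (P * casimir_mat X V) $$ (i, j)"
      using ij P(2) by (simp add: casimir_mat_def n_def [symmetric] scalar_prod_def atLeast0LessThan)
    finally show "(casimir_mat X W * P) $$ (i, j) = (P * casimir_mat X V) $$ (i, j)" .
  qed (use P in \<open>simp_all add: casimir_mat_def n_def\<close>)
  also have "\<dots> = c \<cdot>\<^sub>m P"
    using P(2) mult_smult_distrib[OF P(2) one_carrier_mat] by (simp add: assms(4) n_def [symmetric])
  finally have "casimir_mat X W * (P * Q) = c \<cdot>\<^sub>m P * Q"
    using assoc_mult_mat[OF CW P(2) Qc] by simp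
  then show ?thesis
    using CW P(1) Q(1) mult_smult_assoc_mat[OF P(2) Qc] by simp
qed

context weight_basis
begin

text \<open>An eigenspace of the Casimir operator is a subrepresentation because the operator
  commutes with the action. The highest weight vector makes one of them nonzero, with a controlled
  eigenvalue, so it is the whole space.\<close>

lemma casimir_mat_irreducible:
  assumes irr: "irreducible_rep L V"
    and m: "\<forall>Y\<in>root_basis. of_nat m * (wt Y (cor Y) / 2) \<in> \<int> \<and>
      of_nat m * (wt Y (cor Y) ^ 2 / (8 * hv)) \<in> \<int>"
  shows "\<exists>c. casimir_mat X V = c \<cdot>\<^sub>m 1\<^sub>m (fst V) \<and> of_nat m * c \<in> \<int>"
proof -
  obtain n \<rho> where V: "V = (n, \<rho>)" by (cases V)
  have rep: "is_rep L (n, \<rho>)" and n: "0 < n"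
    and inv: "\<And>W. W \<subseteq> carrier_vec n \<Longrightarrow> 0\<^sub>v n \<in> W \<Longrightarrow> (\<forall>v\<in>W. \<forall>w\<in>W. v + w \<in> W) \<Longrightarrow>
        (\<forall>a. \<forall>v\<in>W. a \<cdot>\<^sub>v v \<in> W) \<Longrightarrow> (\<forall>x. \<forall>v\<in>W. \<rho> x *\<^sub>v v \<in> W) \<Longrightarrow> W = {0\<^sub>v n} \<or> W = carrier_vec n"
    using irr by (simp_all add: irreducible_rep_def V)
  have \<rho>: "\<rho> x \<in> carrier_mat n n" for x using rep by (simp add: is_rep_def)
  let ?F = "{f :: complex fps. \<forall>i\<ge>n. fps_nth f i = 0}"
  interpret R: weight_basis_rep L X hv B seq_scale "\<lambda>x. mat_op n (\<rho> x)" ?F "(\<lambda>i. fps_X ^ i) ` {..<n}"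
    by (intro weight_basis_rep.intro weight_basis_axioms lie_rep_of_matrices rep)
  have "(1 :: complex fps) \<in> ?F" using n by auto
  then have "?F \<noteq> {0}" using one_neq_zero by blast
  from R.casimir_eigenvector[OF this m]
  obtain f c where f: "f \<in> ?F" "f \<noteq> 0" "R.casimir_op f = seq_scale c f" "of_nat m * c \<in> \<int>" by blast
  define C where "C = casimir_mat X V"
  have C: "C \<in> carrier_mat n n" by (simp add: C_def casimir_mat_def V)
  have op: "R.casimir_op f = mat_op n C f" for f
  proof (rule fps_ext)
    fix i
    have "fps_nth (R.casimir_op f) i = (\<Sum>k\<in>UNIV. fps_nth (mat_op n (\<rho> (X k) * \<rho> (X k)) f) i)"
      by (simp only: R.casimir_op_def fps_sum_nth mat_op_mult \<rho>)
    also have "\<dots> = fps_nth (mat_op n C f) i"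
      by (simp add: mat_op_def C_def casimir_mat_def V sum_distrib_right sum.swap[of _ UNIV] del: index_mult_mat(1))
    finally show "fps_nth (R.casimir_op f) i = fps_nth (mat_op n C f) i" .
  qed
  \<comment> \<open>Irreducibility is stated for subsets of \<open>carrier_vec n\<close>, so the
    eigenspace is pulled back from sequences to vectors.\<close>
  define W where "W = {v \<in> carrier_vec n. R.casimir_op (vec_seq v) = seq_scale c (vec_seq v)}"
  have seq_add: "vec_seq (v + w) = vec_seq v + vec_seq w" if "v \<in> carrier_vec n" "w \<in> carrier_vec n" for v w
    using that by (intro fps_ext) (auto simp: vec_seq_def)
  have seq_smult: "vec_seq (a \<cdot>\<^sub>v v) = seq_scale a (vec_seq v)" for a v
    by (intro fps_ext) (auto simp: vec_seq_def)
  have op_add: "R.casimir_op (f + g) = R.casimir_op f + R.casimir_op g" for f g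
    by (simp only: R.casimir_op_def R.V.\<rho>_add_right sum.distrib)
  have op_scale: "R.casimir_op (seq_scale a f) = seq_scale a (R.casimir_op f)" for a f
    by (simp only: R.casimir_op_def R.V.\<rho>_scale_right seq.scale_sum_right)
  have "W = {0\<^sub>v n} \<or> W = carrier_vec n"
  proof (rule inv)
    show "W \<subseteq> carrier_vec n" by (auto simp: W_def)
    have "vec_seq (0\<^sub>v n) = 0" by (intro fps_ext) (simp add: vec_seq_def)
    moreover have "R.casimir_op 0 = 0"
      by (simp only: R.casimir_op_def R.V.\<rho>_0_right sum.neutral_const)
    ultimately show "0\<^sub>v n \<in> W" by (simp add: W_def)
    show "\<forall>v\<in>W. \<forall>w\<in>W. v + w \<in> W"
      by (auto simp: W_def seq_add op_add ring_distribs)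
    show "\<forall>a. \<forall>v\<in>W. a \<cdot>\<^sub>v v \<in> W"
      by (auto simp: W_def seq_smult op_scale mult.left_commute)
    show "\<forall>x. \<forall>v\<in>W. \<rho> x *\<^sub>v v \<in> W"
    proof (intro allI ballI)
      fix x v assume v: "v \<in> W"
      then have vc: "v \<in> carrier_vec n" by (simp add: W_def)
      have "R.casimir_op (vec_seq (\<rho> x *\<^sub>v v)) = mat_op n (\<rho> x) (R.casimir_op (vec_seq v))"
        unfolding mat_op_vec_seq[OF \<rho> vc] by (rule R.casimir_op_commute)
      also have "\<dots> = seq_scale c (vec_seq (\<rho> x *\<^sub>v v))"
        using v by (simp add: W_def R.V.\<rho>_scale_right mat_op_vec_seq[OF \<rho> vc])
      finally show "\<rho> x *\<^sub>v v \<in> W" using mult_mat_vec_carrier[OF \<rho> vc] by (simp add: W_def)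
    qed
  qed
  moreover have "W \<noteq> {0\<^sub>v n}"
  proof -
    let ?v = "vec n (fps_nth f)"
    have "vec_seq ?v = f" using f(1) by (intro fps_ext) (auto simp: vec_seq_def)
    then have "?v \<in> W" using f(3) by (simp add: W_def)
    moreover have "?v \<noteq> 0\<^sub>v n"
    proof
      assume "?v = 0\<^sub>v n"
      then have "fps_nth f i = 0" if "i < n" for i using that by (metis index_vec index_zero_vec(1))
      then have "f = 0" using f(1) by (intro fps_ext) (metis (mono_tags) fps_zero_nth mem_Collect_eq not_le)
      then show False using f(2) by simp
    qed
    ultimately show ?thesis by blast
  qed
  ultimately have W: "W = carrier_vec n" by blast
  have "C = c \<cdot>\<^sub>m 1\<^sub>m n"
  proof (rule eq_matI)
    fix i j assume "i < dim_row (c \<cdot>\<^sub>m 1\<^sub>m n)" "j < dim_col (c \<cdot>\<^sub>m 1\<^sub>m n)"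
    then have ij: "i < n" "j < n" by simp_all
    have "unit_vec n j \<in> W" by (simp add: W)
    then have "fps_nth (mat_op n C (vec_seq (unit_vec n j))) i = c * fps_nth (vec_seq (unit_vec n j)) i"
      by (simp add: W_def op)
    moreover have "fps_nth (vec_seq (unit_vec n j)) l = (if l = j then 1 else 0)" for l
      using ij by (auto simp: vec_seq_def)
    ultimately show "C $$ (i, j) = (c \<cdot>\<^sub>m 1\<^sub>m n) $$ (i, j)"
      using ij by (simp add: mat_op_def if_distrib cong: if_cong)
  qed (use C in auto)
  then show ?thesis using f(4) by (auto simp: C_def V)
qed

theorem casimir_denominator:
  "\<exists>m>0. \<forall>\<mu>\<in>level_classes L l. \<forall>V\<in>\<mu>. of_nat m * casimir X V \<in> \<int>"
proof -
  obtain m where m: "m > 0" "\<forall>Y\<in>root_basis. of_nat m * (wt Y (cor Y) / 2) \<in> \<int> \<and>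
      of_nat m * (wt Y (cor Y) ^ 2 / (8 * hv)) \<in> \<int>"
    using weight_denominator by blast
  have "of_nat m * casimir X V \<in> \<int>" if \<mu>: "\<mu> \<in> level_classes L l" "V \<in> \<mu>" for \<mu> V
  proof -
    obtain V0 where V0: "irreducible_rep L V0" "\<mu> = rep_class L V0"
      using \<mu>(1) by (auto simp: level_classes_def)
    then have V: "is_rep L V" "rep_iso V0 V" using \<mu>(2) by (auto simp: rep_class_def)
    obtain c where c: "casimir_mat X V0 = c \<cdot>\<^sub>m 1\<^sub>m (fst V0)" "of_nat m * c \<in> \<int>"
      using casimir_mat_irreducible[OF V0(1) m(2)] by blast
    have "is_rep L V0" "0 < fst V0"
      using V0(1) by (auto simp: irreducible_rep_def split: prod.splits)
    then have "casimir_mat X V = c \<cdot>\<^sub>m 1\<^sub>m (fst V)" "0 < fst V"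
      using casimir_mat_iso[OF _ V c(1)] V(2) by (auto simp: rep_iso_def)
    then have "casimir X V = c" by (rule casimir_eqI)
    then show ?thesis using c(2) by simp
  qed
  then show ?thesis using m(1) by blast
qed

end

section \<open>The monodromy of the connection\<close>

text \<open>One factor of the order clears the denominators of all Casimir scalars, the other that
  of 1 / (2 (l + hv)); the exponent then is 2 \<pi> i times an integer.\<close>

lemma (in simple_lie) monodromy_order:
  "\<exists>n>0. \<forall>\<mu>\<in>level_classes L l. \<forall>V\<in>\<mu>.
     exp (- (2 * of_real pi * \<i> * (casimir X V / (2 * (of_nat l + hv))))) ^ n = 1"
proof -
  obtain B where "B \<subseteq> lcartan L \<union> (\<Union>\<alpha>\<in>roots L. root_space L \<alpha>)" "g.independent B" "g.span B = UNIV"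
    by (rule weight_basis_exists)
  then interpret weight_basis L X hv B by unfold_locales
  obtain m where m: "m > 0" "\<And>\<mu> V. \<mu> \<in> level_classes L l \<Longrightarrow> V \<in> \<mu> \<Longrightarrow> of_nat m * casimir X V \<in> \<int>"
    using casimir_denominator[of l] by auto
  have "1 / (2 * (of_nat l + hv)) \<in> \<rat>"
    by (intro Rats_divide Rats_mult Rats_add hv_rational Rats_1 Rats_number_of Rats_of_nat)
  then have "{1 / (2 * (of_nat l + hv))} \<subseteq> \<rat>" by (simp only: insert_subset empty_subsetI)
  from common_denominator[OF _ this]
  obtain j where j: "j > 0" "of_nat j * (1 / (2 * (of_nat l + hv))) \<in> \<int>" by blast
  have "exp (- (2 * of_real pi * \<i> * (casimir X V / (2 * (of_nat l + hv))))) ^ (m * j) = 1"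
    if "\<mu> \<in> level_classes L l" "V \<in> \<mu>" for \<mu> V
  proof -
    have "of_nat m * casimir X V * (of_nat j * (1 / (2 * (of_nat l + hv)))) \<in> \<int>"
      by (intro Ints_mult m(2)[OF that] j(2))
    then obtain k where k: "of_nat m * casimir X V * (of_nat j * (1 / (2 * (of_nat l + hv)))) = of_int k"
      by (elim Ints_cases)
    have "of_nat (m * j) * (- (2 * of_real pi * \<i> * (casimir X V / (2 * (of_nat l + hv))))) =
        - (2 * of_real pi * \<i>) * (of_nat m * casimir X V * (of_nat j * (1 / (2 * (of_nat l + hv)))))"
      by simp
    also have "\<dots> = \<i> * of_real (2 * pi * of_int (- k))"
      unfolding k by simp
    finally have "exp (of_nat (m * j) * (- (2 * of_real pi * \<i> * (casimir X V / (2 * (of_nat l + hv)))))) =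
        cis (2 * pi * of_int (- k))"
      by (simp only: cis_conv_exp)
    then have "exp (- (2 * of_real pi * \<i> * (casimir X V / (2 * (of_nat l + hv))))) ^ (m * j) =
        cis (2 * pi * of_int (- k))"
      by (simp only: exp_of_nat_mult)
    then show ?thesis by (simp only: cis_multiple_2pi Ints_of_int)
  qed
  then show ?thesis using m(1) j(1) by (intro exI[of _ "m * j"]) auto
qed

theorem corollary36:
  fixes L :: "('g::ab_group_add) lie_data" and X :: "'k::finite \<Rightarrow> 'g" and hv :: complex
    and l :: nat
    and e :: "complex \<Rightarrow> 'r::comm_ring_1"
    and Co :: "('p, 's, 'a, 'b, 'r) fam" and x0 :: "('a, 'b, 'p, 's) morph"
    and Cn :: "('q, 't, 'a, 'b, 'r) fam" and \<nu> :: "('q, 't, 'p, 's) morph"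
    and x :: "'i::finite + bool \<Rightarrow> ('a, 'b, 'q, 't) morph"
    and E :: "'i + bool \<Rightarrow> 'q set \<Rightarrow> 't \<Rightarrow> 'r fps"
    and C :: "('u, 'v, 'c, 'd, 'r fps) fam" and \<theta> :: "'p \<Rightarrow> 'u"
    and \<kappa> :: "'u set \<Rightarrow> 'v \<Rightarrow> nat \<Rightarrow> 't" and \<sigma> :: "'i \<Rightarrow> ('c, 'd, 'u, 'v) morph"
    and Vo :: "'i \<Rightarrow> 'g rep" and V :: "'g rep set \<Rightarrow> 'g rep"
    and b :: "'g rep set \<Rightarrow> complex vec \<Rightarrow> complex vec \<Rightarrow> complex"
    and \<beta> :: "'g rep set \<Rightarrow> (('g, 'r) word \<Rightarrow>\<^sub>0 'r) \<Rightarrow> (('g, 'r) word \<Rightarrow>\<^sub>0 'r) \<Rightarrow> 'r"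
    and \<epsilon> :: "'g rep set \<Rightarrow> nat \<Rightarrow> ((('g, 'r) word \<Rightarrow>\<^sub>0 'r) \<times> (('g, 'r) word \<Rightarrow>\<^sub>0 'r)) list"
    and \<Phi> :: "(('i \<Rightarrow> ('g, 'r fps) word) \<Rightarrow>\<^sub>0 'r fps) \<Rightarrow> 'g rep set \<Rightarrow> nat \<Rightarrow>
              (('i + bool \<Rightarrow> ('g, 'r) word) \<Rightarrow>\<^sub>0 'r)"
    and D :: "'v \<Rightarrow> 'v" and g :: "'i \<Rightarrow> 'r fps fls" and s0 :: "'r fps"
    and \<D> :: "(('i \<Rightarrow> ('g, 'r fps) word) \<Rightarrow>\<^sub>0 'r fps) \<Rightarrow> (('i \<Rightarrow> ('g, 'r fps) word) \<Rightarrow>\<^sub>0 'r fps)"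
  defines "P \<equiv> level_classes L l"
    and "ex \<equiv> smoothing_expansion Cn x E C \<kappa> \<sigma>"
    and "U \<equiv> punctured C \<sigma>"
    and "e' \<equiv> (\<lambda>a. fps_const (e a))"
  defines "NH \<equiv> H_rels L l e' Vo"
    and "N \<equiv> covacua_rels L l e' Vo (ex ` sects (ftot C) U)"
    and "M \<equiv> (\<lambda>\<mu>. covacua_rels L l e (normalization_reps Vo (V \<mu>) (V (dual_class L \<mu>)))
                (expansions Cn x E))"
  assumes lie: "simple_lie_algebra L" "cartan_subalgebra L" "positive_system L"
      "highest_root_vector L" "normalized_form L" "orthonormal_basis L X"
      "\<forall>y. (\<Sum>k\<in>UNIV. lbrk L (X k) (lbrk L (X k) y)) = lscale L (2 * hv) y"
    and base: "regular_local_ring (ring_of_type_algebra :: 'r ring)"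
      "e \<in> Ring.ring_hom ring_of_type_algebra ring_of_type_algebra"
    and curve: "nodal_family Co x0" "marked_normalization Co x0 Cn \<nu> x"
      "\<forall>j. formal_parameter Cn (x j) (E j)"
      "smoothing Co x0 Cn \<nu> x E C \<theta> \<kappa> \<sigma>"
    and reps: "\<forall>i. irreducible_rep L (Vo i) \<and> level L (Vo i) \<le> l" "\<forall>\<mu>\<in>P. V \<mu> \<in> \<mu>"
    and glueing: "\<forall>\<mu>\<in>P. equivariant_duality (V \<mu>) (V (dual_class L \<mu>)) (b \<mu>)"
      "\<forall>\<mu>\<in>P. extended_pairing L l e (V \<mu>) (V (dual_class L \<mu>)) (b \<mu>) (\<beta> \<mu>)"
      "\<forall>\<mu>\<in>P. \<forall>d. glueing_tensor L l e (V \<mu>) (V (dual_class L \<mu>)) (\<beta> \<mu>) d (\<epsilon> \<mu> d)"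
    and decomposition: "glueing_decomposition P N M \<epsilon> \<Phi>"
    and connection: "wzw_derivation C U ex D g" "wzw_connection e X (of_nat l + hv) NH N g s0 \<D>"
      "acts_in_summands e P M \<Phi> \<D> (\<lambda>\<mu>. casimir X (V \<mu>) / (2 * (of_nat l + hv)))"
  shows "(\<exists>n>0. \<forall>s. flat_section e N \<D> s \<longrightarrow> (monodromy e ^^ n) s - s \<in> mv_rels N) \<and>
    (\<forall>\<mu>\<in>P. let z = exp (- of_real pi * \<i> * (casimir X (V \<mu>) / (of_nat l + hv))) in
       (\<exists>n>0. z ^ n = 1) \<and>
       (\<forall>s. flat_section e N \<D> s \<longrightarrow> in_summand P M \<Phi> \<mu> s \<longrightarrow>
          monodromy e s - mv_scale e z s \<in> mv_rels N))"
proof -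
  interpret simple_lie L X hv
    using lie by unfold_locales blast+
  let ?\<chi> = "\<lambda>\<mu>. casimir X (V \<mu>) / (2 * (of_nat l + hv))"
  interpret summand_connection e P N M \<Phi> \<D> ?\<chi>
  proof unfold_locales
    show "e (a + b) = e a + e b" "e (a * b) = e a * e b" "e 1 = 1" for a b
      using base(2) by (simp_all add: Ring.ring_hom_def ring_of_type_algebra_def)
    show "smul.subspace (M \<mu>)" for \<mu>
      unfolding M_def covacua_rels_def by (rule smul.subspace_span)
    show "acts_in_summands e P M \<Phi> \<D> ?\<chi>" by (rule connection(3))
  qed (use decomposition in \<open>simp_all only: glueing_decomposition_def\<close>)
  let ?z = "\<lambda>\<mu>. exp (- (2 * of_real pi * \<i> * ?\<chi> \<mu>))"
  obtain n where n: "n > 0" "\<forall>\<mu>\<in>level_classes L l. \<forall>V\<in>\<mu>.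
      exp (- (2 * of_real pi * \<i> * (casimir X V / (2 * (of_nat l + hv))))) ^ n = 1"
    using monodromy_order[of l] by auto
  have zn: "?z \<mu> ^ n = 1" if "\<mu> \<in> P" for \<mu>
    using bspec[OF bspec[OF n(2) that[unfolded P_def]] bspec[OF reps(2) that]] .
  \<comment> \<open>The phase of \<tau>^(-\<chi>) is exp (-2 \<pi> i \<chi>), whose 2 cancels
    against the one in the denominator of \<chi>.\<close>
  have z: "exp (- of_real pi * \<i> * (casimir X (V \<mu>) / (of_nat l + hv))) = ?z \<mu>" for \<mu>
  proof -
    have "2 * p * (c / (2 * q)) = p * (c / q)" for p c q :: complex by simp
    from this[of "of_real pi * \<i>" "casimir X (V \<mu>)" "of_nat l + hv"] show ?thesis
      by (simp only: mult.assoc mult_minus_left)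
  qed
  show ?thesis
    unfolding Let_def z
  proof (intro conjI ballI exI allI impI)
    show "0 < n" "0 < n" by (fact n)+
    show "(monodromy e ^^ n) s - s \<in> mv_rels N" if "flat_section e N \<D> s" for s
      by (rule monodromy_finite_order[OF that zn])
    show "?z \<mu> ^ n = 1" if "\<mu> \<in> P" for \<mu>
      by (rule zn[OF that])
    show "monodromy e s - mv_scale e (?z \<mu>) s \<in> mv_rels N"
      if "\<mu> \<in> P" "flat_section e N \<D> s" "in_summand P M \<Phi> \<mu> s" for \<mu> s
      by (rule monodromy_in_summand[OF that(2,1,3)])
  qed
qed

end
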